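(* Let $\{(p_n,\mathcal D_n,L_n)\}_{n\ge1}$ be a sequence of Hadamard triples on $\mathbb R$ (with $p_n>1$ integers and $0\in\mathcal D_n\subset\{0,1,2,\dots\}$), and suppose that $$\sup_n\max\{p_n^{-1}d:d\in\mathcal D_n\}<\infty\quad\text{and}\quad \sup_n\#\mathcal D_n<\infty .$$ Let $\mu_{\{p_n,\mathcal D_n\}}$ and $\nu_n$ be as in the context. Then the following are equivalent: (i) there exists a subsequence $\{\nu_{n_k}\}$ which is an equi-positive family; (ii) $\limsup_{k\to\infty}T_{p_k,\mathcal D_k}:=\bigcap_{n\ge1}\bigcup_{k\ge n}T_{p_k,\mathcal D_k}\supset(0,1)$; (iii) at least one of the following holds: $\#\{j:p_j>\#\mathcal D_j\}=\infty$, or $\gcd\{\gcd\mathcal D_j: j\ge n\}=1$ for every $n\ge1$. Moreover, under these equivalent conditions $\mu_{\{p_n,\mathcal D_n\}}$ is a spectral measure.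
   Context: A Hadamard triple on $\mathbb R$ is a triple $(p,\mathcal D,L)$ with $p>1$ an integer, $\mathcal D,L\subset\mathbb Z$ finite with $\#\mathcal D=\#L$, such that the matrix $\frac{1}{\sqrt{\#\mathcal D}}\big[e^{2\pi i d\ell/p}\big]_{\ell\in L,d\in\mathcal D}$ is unitary. For a finite set $A\subset\mathbb R$, $\delta_A=\frac{1}{\#A}\sum_{a\in A}\delta_a$ (uniform probability measure on $A$). The Fourier transform of a finite Borel measure is $\widehat\mu(\xi)=\int e^{2\pi i x\xi}\,d\mu(x)$; in particular $\widehat{\delta_{cA}}(\xi)=\frac1{\#A}\sum_{a\in A}e^{2\pi i c a\xi}$. The Cantor-Moran measure $\mu_{\{p_n,\mathcal D_n\}}=\delta_{p_1^{-1}\mathcal D_1}*\delta_{(p_1p_2)^{-1}\mathcal D_2}*\cdots$ is the weak limit of the finite convolutions $\delta_{p_1^{-1}\mathcal D_1}*\cdots*\delta_{(p_1\cdots p_n)^{-1}\mathcal D_n}$, and $\nu_n=\delta_{p_{n+1}^{-1}\mathcal D_{n+1}}*\delta_{(p_{n+1}p_{n+2})^{-1}\mathcal D_{n+2}}*\cdots$ (these exist and have supports in a common compact set under the stated boundedness hypothesis). A Borel probability measure $\mu$ is spectral if there is a countable $\Lambda\subset\mathbb R$ such that $\{e^{2\pi i\lambda x}:\lambda\in\Lambda\}$ is an orthogonal basis of $L^2(\mu)$. A collection $\Phi$ of Borel probability measures on $\mathbb R$ with supports in a common compact set is an equi-positive family if there is $\epsilon_0>0$ such that for every $x\in[0,1)$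 and every $\nu\in\Phi$ there is $k_{x,\nu}\in\mathbb Z$ with $|\widehat\nu(x+k_{x,\nu})|>\epsilon_0$. Double Points Condition Set (DPCS): for an integer $p>1$ and $D\subset\mathbb Z$ finite, $T_{p,D}$ is the set of $\xi\in[0,1)$ for which there exist two distinct $\ell_1,\ell_2\in\{0,1,\dots,p-1\}$ with $\widehat{\delta_{p^{-1}D}}(\xi+\ell_i)\neq0$ for $i=1,2$. *)

theory Defs
  imports "HOL-Probability.Probability"
begin

text \<open>Hadamard triple: p > 1, D, L finite subsets of Z with equal cardinality, and the
  matrix (1/sqrt N) [exp(2 pi i d l / p)]_{l in L, d in D} is unitary, written out
  entrywise as M M^* = I (M square, so this is unitarity).\<close>
definition hadamard_triple :: "nat \<Rightarrow> int set \<Rightarrow> int set \<Rightarrow> bool" where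
  "hadamard_triple p D L \<longleftrightarrow> p > 1 \<and> finite D \<and> finite L \<and> card D = card L \<and>
     (\<forall>l\<in>L. \<forall>l'\<in>L.
        (\<Sum>d\<in>D. (cis (2 * pi * of_int d * of_int l / of_nat p) / sqrt (card D)) *
                  cnj (cis (2 * pi * of_int d * of_int l' / of_nat p) / sqrt (card D)))
        = (if l = l' then 1 else 0))"

definition unif_measure :: "real set \<Rightarrow> real measure" where
  "unif_measure A = distr (measure_pmf (pmf_of_set A)) borel (\<lambda>x. x)"

definition fourier :: "real measure \<Rightarrow> real \<Rightarrow> complex" where
  "fourier \<mu> \<xi> = integral\<^sup>L \<mu> (\<lambda>x. cis (2 * pi * x * \<xi>))"

text \<open>Finite convolutions delta_{p_1^{-1} D_1} * ... * delta_{(p_1...p_n)^{-1} D_n};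
  sequences are indexed from 1 (the values at index 0 are irrelevant).\<close>
fun moran_partial :: "(nat \<Rightarrow> nat) \<Rightarrow> (nat \<Rightarrow> int set) \<Rightarrow> nat \<Rightarrow> real measure" where
  "moran_partial p D 0 = return borel 0"
| "moran_partial p D (Suc n) = convolution (moran_partial p D n)
     (unif_measure ((\<lambda>d. of_int d / (\<Prod>i\<in>{1..Suc n}. real (p i))) ` D (Suc n)))"

definition moran :: "(nat \<Rightarrow> nat) \<Rightarrow> (nat \<Rightarrow> int set) \<Rightarrow> real measure" where
  "moran p D = (THE \<mu>. real_distribution \<mu> \<and> weak_conv_m (moran_partial p D) \<mu>)"

definition moran_tail :: "(nat \<Rightarrow> nat) \<Rightarrow> (nat \<Rightarrow> int set) \<Rightarrow> nat \<Rightarrow> real measure" where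
  "moran_tail p D n = moran (\<lambda>k. p (n + k)) (\<lambda>k. D (n + k))"

definition equi_positive :: "real measure set \<Rightarrow> bool" where
  "equi_positive \<Phi> \<longleftrightarrow>
     (\<forall>\<nu>\<in>\<Phi>. real_distribution \<nu>) \<and>
     (\<exists>K. compact K \<and> (\<forall>\<nu>\<in>\<Phi>. emeasure \<nu> (UNIV - K) = 0)) \<and>
     (\<exists>\<epsilon>0>0. \<forall>x\<in>{0..<1}. \<forall>\<nu>\<in>\<Phi>. \<exists>k::int. cmod (fourier \<nu> (x + of_int k)) > \<epsilon>0)"

text \<open>Double Points Condition Set T_{p,D}; the Fourier transform of delta_{p^{-1}D}
  is written out explicitly.\<close>
definition DPCS :: "nat \<Rightarrow> int set \<Rightarrow> real set" where
  "DPCS p D = {\<xi>\<in>{0..<1}. \<exists>l1\<in>{0..<p}. \<exists>l2\<in>{0..<p}. l1 \<noteq> l2 \<and>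
     (\<forall>l\<in>{l1, l2}. (\<Sum>d\<in>D. cis (2 * pi * of_int d * (\<xi> + of_nat l) / of_nat p)) / of_nat (card D) \<noteq> 0)}"

text \<open>Spectral measure: some countable set of exponentials is an orthogonal basis of L^2(mu):
  pairwise orthogonal, and complete (only the a.e.-zero function in L^2(mu) is orthogonal to all).\<close>
definition spectral_measure :: "real measure \<Rightarrow> bool" where
  "spectral_measure \<mu> \<longleftrightarrow> (\<exists>\<Lambda>::real set. countable \<Lambda> \<and>
     (\<forall>a\<in>\<Lambda>. \<forall>b\<in>\<Lambda>. a \<noteq> b \<longrightarrow>
        integral\<^sup>L \<mu> (\<lambda>x. cis (2 * pi * a * x) * cnj (cis (2 * pi * b * x))) = 0) \<and>
     (\<forall>f::real \<Rightarrow> complex. f \<in> borel_measurable \<mu> \<longrightarrow> integrable \<mu> (\<lambda>x. (cmod (f x))\<^sup>2) \<longrightarrow>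
        (\<forall>a\<in>\<Lambda>. integral\<^sup>L \<mu> (\<lambda>x. f x * cnj (cis (2 * pi * a * x))) = 0) \<longrightarrow>
        (AE x in \<mu>. f x = 0)))"

end

theory Submission
  imports Defs
begin

text \<open>
  Write \<open>M\<^sub>j\<close> for the mask (the Fourier transform of the uniform measure on \<open>D\<^sub>j\<close>).
  Since \<open>0 \<in> D\<^sub>j\<close> and the squared masks over the p translates of a point sum to \<open>p / #D\<close>, a point
  fails the double point condition only if \<open>p = #D\<close> and it lies in \<open>(1/g)\<int>\<close> with \<open>g = gcd D\<close>;
  this gives (ii) \<open>\<longleftrightarrow>\<close> (iii). If (iii) fails, some \<open>g \<ge> 2\<close> divides all digits of all late levels,
  and the tail transforms vanish on \<open>1/g + \<int>\<close>.

  Conversely, by Lagrange interpolation at K nodes with K large, a tail transform cannot be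
  small at K separated points of the unit interval, because its value at 0 is 1. So it suffices to bound
  the supremum of the n-th tail transform over \<open>x + \<int>\<close> from below by suprema at K separated descendants
  of x. A large modulus p produces them in one step. For bounded moduli
  there are finitely many digit sets: each point that is not close to \<open>(1/g)\<int>\<close> splits into two descendants
  with masks bounded below, while points close to such lattices travel unharmed, in one jump, to
  the first level where (iii) forces one of them to split.

  Along the good levels one corrects the spectra of the finite convolutions by multiples of the periods so
  that the tail factor stays bounded below; dominated convergence in the Parseval sum
  then yields a spectrum of the limit.
\<close>

section \<open>Masks and Hadamard triples\<close>

text \<open>The obstacle is that a constant factor lost at every level would destroy the lower bound
  over long stretches of levels, and (iii) does not bound the distance to the next helpful level.
  Two facts keep the total loss finite. The number K of points is fixed beforehand by the support
  bound alone: all tails live in [0, 2C], interpolation asks only for (4 pi C)^K / K! < 1/2, so only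
  K - 1 splittings are paid for. Between two splittings the whole family moves at once: when p = #D
  the digits form a complete residue system, gcd D is prime to p, and a rational whose denominator
  divides gcd D lifts to another one; the skipped masks then form a partial transform at a small
  frequency eta, which is within 4 pi C |eta| of 1 whatever the number of levels. The points must
  travel together because interpolation compares values of one and the same tail transform. For the
  spectrum, frequencies once chosen stay fixed: far down they are rescaled to points near 0, where
  every tail transform is at least 1/2.\<close>

definition dmask :: "int set \<Rightarrow> real \<Rightarrow> complex" where
  "dmask D y = (\<Sum>d\<in>D. cis (2 * pi * (of_int d * y))) / of_nat (card D)"

lemma cis_2pi_eq_1_iff: "cis (2 * pi * y) = 1 \<longleftrightarrow> y \<in> \<int>"
proof
  assume "cis (2 * pi * y) = 1"
  hence "cos (2 * pi * y) = 1" by (metis cis.sel(1) one_complex.sel(1))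
  then obtain n :: int where "2 * pi * y = of_int n * (2 * pi)"
    by (auto simp: cos_one_2pi_int)
  hence "y = of_int n" by (simp add: field_simps)
  thus "y \<in> \<int>" by simp
qed (rule cis_multiple_2pi)

lemma cis_lipschitz: "cmod (cis t - 1) \<le> \<bar>t\<bar>"
  by (metis cis_conv_exp iexp_approx1[of t 0, simplified] power_one_right)

lemma dmask_0: "finite D \<Longrightarrow> D \<noteq> {} \<Longrightarrow> dmask D 0 = 1"
  by (simp add: dmask_def)

lemma norm_dmask_le: "cmod (dmask D y) \<le> 1"
proof (cases "card D = 0")
  case False
  have "cmod (\<Sum>d\<in>D. cis (2 * pi * (of_int d * y))) \<le> (\<Sum>d\<in>D. 1)"
    by (rule sum_norm_le) simp
  thus ?thesis using False by (simp add: dmask_def norm_divide)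
qed (simp add: dmask_def)

text \<open>Every character of a digit is trivial on u. Integral u gives periodicity of the mask;
  fractional u whose denominator divides all digits is the case that lets points travel through
  levels.\<close>

lemma dmask_invisible:
  assumes "\<And>d. d \<in> D \<Longrightarrow> of_int d * u \<in> \<int>"
  shows "dmask D (u + y) = dmask D y"
  unfolding dmask_def
proof (intro arg_cong2[where f="(/)"] sum.cong refl)
  fix d assume d: "d \<in> D"
  have "cis (2 * pi * (of_int d * (u + y))) = cis (2 * pi * (of_int d * u)) * cis (2 * pi * (of_int d * y))"
    by (simp add: cis_mult ring_distribs)
  thus "cis (2 * pi * (of_int d * (u + y))) = cis (2 * pi * (of_int d * y))"
    using cis_multiple_2pi[OF assms[OF d]] by simp
qed

lemma dmask_add_int: "k \<in> \<int> \<Longrightarrow> dmask D (k + y) = dmask D y"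
  by (rule dmask_invisible) auto

lemma dmask_eq_1:
  assumes "finite D" "D \<noteq> {}" "\<And>d. d \<in> D \<Longrightarrow> of_int d * u \<in> \<int>"
  shows "dmask D u = 1"
  using dmask_invisible[of D u 0] assms dmask_0 by simp

lemma continuous_on_dmask [continuous_intros]:
  "continuous_on A f \<Longrightarrow> continuous_on A (\<lambda>x. dmask D (f x))"
  unfolding dmask_def divide_inverse cis_conv_exp by (intro continuous_intros)

text \<open>Equality case of the triangle inequality: all unimodular summands share one phase, and
  the digit 0 fixes that phase to be 1.\<close>

lemma dmask_unit_imp:
  assumes "finite D" "0 \<in> D" "cmod (dmask D y) = 1" "d \<in> D"
  shows "of_int d * y \<in> \<int>"
proof -
  define N where "N = card D"
  let ?c = "\<lambda>d. cis (2 * pi * (of_int d * y))"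
  have N: "N > 0" using assms unfolding N_def by (auto simp: card_gt_0_iff)
  define s where "s = (\<Sum>d\<in>D. ?c d)"
  have ns: "cmod s = real N" using assms(3) N by (simp add: dmask_def s_def N_def norm_divide field_simps)
  \<comment> \<open>The rotation that turns the sum into its modulus, so that real parts bounded by
    1 must all equal 1.\<close>
  define z where "z = cnj (sgn s)"
  have z1: "cmod z = 1" using ns N by (auto simp: z_def norm_sgn)
  have "z * s = of_real (cmod s)"
  proof -
    have "z * s = s * cnj s / of_real (cmod s)" by (simp add: z_def sgn_eq field_simps)
    also have "s * cnj s = of_nat N * of_nat N" using complex_norm_square[of s] ns
      by (simp add: power2_eq_square)
    also have "\<dots> / of_real (cmod s) = of_real (cmod s)" using ns N by simp
    finally show ?thesis .
  qed
  hence "z * s = of_nat N" using ns by simp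
  moreover have "(\<Sum>d\<in>D. z * ?c d) = z * s" by (simp only: s_def sum_distrib_left)
  ultimately have zs: "(\<Sum>d\<in>D. z * ?c d) = of_nat N" by simp
  have "(\<Sum>d\<in>D. 1 - Re (z * ?c d)) = 0"
    using arg_cong[OF zs, of Re] by (simp add: sum_subtractf N_def)
  moreover have "\<forall>d\<in>D. 0 \<le> 1 - Re (z * ?c d)"
  proof
    fix d show "0 \<le> 1 - Re (z * ?c d)"
      using complex_Re_le_cmod[of "z * ?c d"] z1 by (simp add: norm_mult del: times_complex.sel)
  qed
  ultimately have re: "\<forall>d\<in>D. Re (z * ?c d) = 1"
    using sum_nonneg_eq_0_iff[of D "\<lambda>d. 1 - Re (z * ?c d)"] assms(1) by (simp del: times_complex.sel)
  have eq1: "z * ?c d = 1" if "d \<in> D" for d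
  proof -
    have "cmod (z * ?c d) = 1" using z1 by (simp add: norm_mult)
    moreover have "Re (z * ?c d) = 1" using re that by blast
    ultimately have "Im (z * ?c d) = 0" by (metis cmod_power2 add_cancel_right_right one_power2 zero_eq_power2)
    thus ?thesis using \<open>Re (z * ?c d) = 1\<close> by (intro complex_eqI) (simp_all del: times_complex.sel)
  qed
  from eq1[OF assms(2)] have "z = 1" by simp
  with eq1[OF assms(4)] show ?thesis by (simp add: cis_2pi_eq_1_iff)
qed

text \<open>Unimodular entries force the columns of a square matrix with orthonormal rows to be
  orthonormal: the columns already have norm one, so the mass of each Gram row sits on the diagonal.\<close>

lemma orthonormal_columns:
  fixes a :: "'i \<Rightarrow> 'j \<Rightarrow> complex"
  assumes fin: "finite I" "finite J" and card: "card I = card J"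
    and unim: "\<And>i j. i \<in> I \<Longrightarrow> j \<in> J \<Longrightarrow> a i j * cnj (a i j) = 1 / of_nat (card J)"
    and rows: "\<And>i i'. i \<in> I \<Longrightarrow> i' \<in> I \<Longrightarrow> (\<Sum>j\<in>J. a i j * cnj (a i' j)) = (if i = i' then 1 else 0)"
    and jj: "j \<in> J" "j' \<in> J"
  shows "(\<Sum>i\<in>I. cnj (a i j) * a i j') = (if j = j' then 1 else 0)"
proof -
  define s where "s k = (\<Sum>i\<in>I. cnj (a i j) * a i k)" for k
  have n: "card J > 0" using jj fin by (auto simp: card_gt_0_iff)
  have col: "(\<Sum>i\<in>I. cnj (a i j) * a i j) = 1"
    using unim[OF _ jj(1)] n card by (simp add: mult.commute)
  have "(\<Sum>k\<in>J. s k * cnj (s k)) = (\<Sum>k\<in>J. \<Sum>i\<in>I. \<Sum>i'\<in>I. cnj (a i j) * a i' j * (a i k * cnj (a i' k)))"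
    by (simp add: s_def sum_product ac_simps)
  also have "\<dots> = (\<Sum>i\<in>I. \<Sum>i'\<in>I. cnj (a i j) * a i' j * (\<Sum>k\<in>J. a i k * cnj (a i' k)))"
    unfolding sum_distrib_left by (subst sum.swap) (intro sum.cong refl, rule sum.swap)
  also have "\<dots> = (\<Sum>i\<in>I. \<Sum>i'\<in>I. cnj (a i j) * a i' j * (if i = i' then 1 else 0))"
    by (intro sum.cong refl) (simp add: rows)
  also have "\<dots> = (\<Sum>i\<in>I. cnj (a i j) * a i j)"
    using fin by (simp add: if_distrib sum.delta cong: if_cong)
  finally have "(\<Sum>k\<in>J. s k * cnj (s k)) = 1" using col by simp
  hence "complex_of_real (\<Sum>k\<in>J. (cmod (s k))\<^sup>2) = 1" by (simp only: of_real_sum complex_norm_square)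
  hence tot: "(\<Sum>k\<in>J. (cmod (s k))\<^sup>2) = 1" by (metis of_real_eq_1_iff)
  have sj: "s j = 1" using col by (simp add: s_def)
  have "(\<Sum>k\<in>J-{j}. (cmod (s k))\<^sup>2) = 0"
    using tot sj fin jj by (simp add: sum.remove[of J j])
  hence "\<forall>k\<in>J-{j}. s k = 0"
    using fin by (subst (asm) sum_nonneg_eq_0_iff) auto
  thus ?thesis using sj jj by (auto simp: s_def)
qed

lemma hadamardD:
  assumes "hadamard_triple p D L"
  shows "p > 1" "finite D" "finite L" "card L = card D"
  using assms by (auto simp: hadamard_triple_def)

text \<open>The definition of a Hadamard triple gives orthogonality of rows, a sum over digits;
  Parseval sums over translates by \<open>L\<close> need the orthogonality of columns.\<close>

lemma hadamard_columns:
  assumes H: "hadamard_triple p D L" and d: "d \<in> D" "d' \<in> D"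
  shows "(\<Sum>l\<in>L. cis (2 * pi * (of_int (d' - d) * of_int l / real p))) = (if d = d' then of_nat (card D) else 0)"
proof -
  define N where "N = card D"
  note hd = hadamardD[OF H]
  have N: "N > 0" unfolding N_def using d hd by (auto simp: card_gt_0_iff)
  define a where "a l d = cis (2 * pi * of_int d * of_int l / of_nat p) / sqrt (card D)" for l d :: int
  have sq: "complex_of_real (sqrt (real N)) * complex_of_real (sqrt (real N)) = of_nat N"
    by (metis of_nat_0_le_iff of_real_mult of_real_of_nat_eq real_sqrt_mult_self abs_of_nonneg)
  have un: "a l e * cnj (a l e') = cis (2 * pi * (of_int (e - e') * of_int l / real p)) / of_nat N" for l e e'
    by (simp add: a_def cis_cnj cis_mult sq N_def[symmetric] divide_simps)
       (simp add: algebra_simps diff_divide_distrib)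
  have "(\<Sum>l\<in>L. cnj (a l d) * a l d') = (if d = d' then 1 else 0)"
  proof (rule orthonormal_columns[where J=D])
    fix l e assume "l \<in> L" "e \<in> D"
    show "a l e * cnj (a l e) = 1 / of_nat (card D)" using un[of l e e] by (simp add: N_def)
  next
    fix i i' assume "i \<in> L" "i' \<in> L"
    thus "(\<Sum>j\<in>D. a i j * cnj (a i' j)) = (if i = i' then 1 else 0)"
      using H by (auto simp: hadamard_triple_def a_def)
  qed (use hd d in auto)
  also have "(\<Sum>l\<in>L. cnj (a l d) * a l d') = (\<Sum>l\<in>L. cis (2 * pi * (of_int (d' - d) * of_int l / real p))) / of_nat N"
    by (simp add: mult.commute[of "cnj _"] un sum_divide_distrib)
  finally show ?thesis using N by (auto simp: N_def split: if_splits)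
qed

text \<open>Digits congruent modulo p give equal columns, which cannot be orthogonal.\<close>

lemma hadamard_mod_inj:
  assumes H: "hadamard_triple p D L" and d: "d \<in> D" "d' \<in> D" and c: "int p dvd d' - d"
  shows "d = d'"
proof (rule ccontr)
  assume ne: "d \<noteq> d'"
  from c obtain k where k: "d' - d = int p * k" by auto
  have "cis (2 * pi * (of_int (d' - d) * of_int l / real p)) = 1" for l :: int
    using hadamardD(1)[OF H] unfolding k by (intro cis_multiple_2pi) simp
  hence "(\<Sum>l\<in>L. cis (2 * pi * (of_int (d' - d) * of_int l / real p))) = of_nat (card D)"
    using hadamardD[OF H] by simp
  thus False using hadamard_columns[OF H d] ne d hadamardD[OF H] by auto
qed

lemma hadamard_inj_mod: "hadamard_triple p D L \<Longrightarrow> inj_on (\<lambda>d. d mod int p) D"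
  by (rule inj_onI) (metis hadamard_mod_inj mod_eq_dvd_iff)

lemma hadamard_card_le: 
  assumes H: "hadamard_triple p D L"
  shows "card D \<le> p"
proof -
  have "(\<lambda>d. d mod int p) ` D \<subseteq> {0..<int p}" using hadamardD(1)[OF H] by auto
  from card_mono[OF _ this] show ?thesis
    using card_image[OF hadamard_inj_mod[OF H]] by simp
qed

text \<open>After expanding the square only diagonal pairs of digits survive. The two uses are
  \<open>T = L\<close> with \<open>c = card D\<close>, where the sum is 1, and \<open>T\<close> a
  full set of residues with \<open>c = p\<close>, where it is p / #D.\<close>

lemma dmask_square_sum:
  fixes T :: "int set"
  assumes fin: "finite D" "D \<noteq> {}" "finite T"
    and orth: "\<And>d d'. d \<in> D \<Longrightarrow> d' \<in> D \<Longrightarrow>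
      (\<Sum>l\<in>T. cis (2 * pi * (of_int (d' - d) * of_int l / real p))) = (if d = d' then of_nat c else 0)"
  shows "(\<Sum>l\<in>T. (cmod (dmask D ((x + of_int l) / real p)))\<^sup>2) = real c / real (card D)"
proof -
  define N where "N = card D"
  have N: "N > 0" unfolding N_def using fin by (auto simp: card_gt_0_iff)
  let ?e = "\<lambda>d l. cis (2 * pi * (of_int d * ((x + of_int l) / real p)))"
  have split: "?e d' l * cnj (?e d l) = cis (2 * pi * (of_int (d' - d) * x / real p)) *
       cis (2 * pi * (of_int (d' - d) * of_int l / real p))" for d d' l
    by (simp add: cis_cnj cis_mult) (simp add: algebra_simps diff_divide_distrib add_divide_distrib)
  have "complex_of_real (\<Sum>l\<in>T. (cmod (dmask D ((x + of_int l) / real p)))\<^sup>2)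
      = (\<Sum>l\<in>T. (\<Sum>d'\<in>D. \<Sum>d\<in>D. ?e d' l * cnj (?e d l)) / (of_nat N * of_nat N))"
    unfolding of_real_sum complex_norm_square
    by (simp add: dmask_def sum_product N_def)
  also have "\<dots> = (\<Sum>d'\<in>D. \<Sum>d\<in>D. \<Sum>l\<in>T. ?e d' l * cnj (?e d l)) / (of_nat N * of_nat N)"
    unfolding sum_divide_distrib[symmetric]
    by (rule arg_cong2[where f="(/)", OF trans[OF sum.swap sum.cong[OF refl sum.swap]] refl])
  also have "\<dots> = (\<Sum>d'\<in>D. \<Sum>d\<in>D. cis (2 * pi * (of_int (d' - d) * x / real p)) * (if d = d' then of_nat c else 0)) / (of_nat N * of_nat N)"
    by (intro arg_cong2[where f="(/)"] sum.cong refl)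
       (simp only: split sum_distrib_left[symmetric] orth)
  also have "\<dots> = (\<Sum>d'\<in>D. of_nat c) / (of_nat N * of_nat N)"
    using fin by (simp add: if_distrib sum.delta' cong: if_cong)
  also have "\<dots> = complex_of_real (real c / real N)" using N by (simp add: N_def[symmetric])
  finally show ?thesis by (simp only: of_real_eq_iff N_def)
qed

lemma hadamard_dmask_sum:
  assumes H: "hadamard_triple p D L" and ne: "D \<noteq> {}"
  shows "(\<Sum>l\<in>L. (cmod (dmask D ((x + of_int l) / real p)))\<^sup>2) = 1"
  using dmask_square_sum[of D L p "card D" x] hadamard_columns[OF H] hadamardD[OF H] ne
  by (simp add: card_eq_0_iff)

lemma root_of_unity_sum:
  fixes m :: int
  assumes p: "p > 0"
  shows "(\<Sum>l\<in>{0..<int p}. cis (2 * pi * (of_int m * of_int l / real p))) = (if int p dvd m then of_nat p else 0)"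
proof (cases "int p dvd m")
  case True
  then obtain k where "m = int p * k" by auto
  hence "cis (2 * pi * (of_int m * of_int l / real p)) = 1" for l :: int
    using p by (intro cis_multiple_2pi) simp
  thus ?thesis using True by simp
next
  case False
  define w where "w = cis (2 * pi * (of_int m / real p))"
  have "w \<noteq> 1"
  proof
    assume "w = 1"
    hence "of_int m / real p \<in> \<int>" using cis_2pi_eq_1_iff[of "of_int m / real p"] by (simp add: w_def)
    then obtain k where "of_int m / real p = of_int k" by (auto elim: Ints_cases)
    hence "real_of_int m = real_of_int (k * int p)" using p by (simp add: field_simps)
    hence "m = k * int p" by (simp only: of_int_eq_iff)
    thus False using False by simp
  qed
  have "w ^ p = cis (real p * (2 * pi * (of_int m / real p)))" by (simp only: w_def Complex.DeMoivre)
  also have "real p * (2 * pi * (of_int m / real p)) = 2 * pi * of_int m" using p by simp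
  finally have wp: "w ^ p = 1" by (simp add: cis_multiple_2pi)
  have "(\<Sum>l\<in>{0..<int p}. cis (2 * pi * (of_int m * of_int l / real p))) = (\<Sum>l<p. w ^ l)"
  proof (rule sum.reindex_bij_witness[of _ int nat])
    fix l assume "l \<in> {0..<int p}"
    thus "w ^ nat l = cis (2 * pi * (of_int m * of_int l / real p))"
      by (simp add: w_def Complex.DeMoivre mult_ac)
  qed auto
  also have "\<dots> = 0" using \<open>w \<noteq> 1\<close> wp by (simp add: sum_gp_strict)
  finally show ?thesis using False by simp
qed

lemma hadamard_dmask_sum_full:
  assumes H: "hadamard_triple p D L" and ne: "D \<noteq> {}"
  shows "(\<Sum>l\<in>{0..<int p}. (cmod (dmask D ((x + of_int l) / real p)))\<^sup>2) = real p / real (card D)"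
proof (rule dmask_square_sum)
  fix d d' assume "d \<in> D" "d' \<in> D"
  thus "(\<Sum>l\<in>{0..<int p}. cis (2 * pi * (of_int (d' - d) * of_int l / real p))) = (if d = d' then of_nat p else 0)"
    using root_of_unity_sum[of p "d' - d"] hadamardD[OF H] hadamard_mod_inj[OF H, of d d'] by auto
qed (use hadamardD[OF H] ne in auto)

section \<open>Digit gcds and the double point condition\<close>

text \<open>As k is nonzero, y is rational, and b is its denominator in lowest terms. Integrality
  statements about y thereby become divisibility statements.\<close>

lemma denominator_ideal:
  fixes y :: real and k :: int
  assumes "k \<noteq> 0" "of_int k * y \<in> \<int>"
  obtains b :: nat where "b > 0" "\<And>j::int. of_int j * y \<in> \<int> \<longleftrightarrow> int b dvd j"
proof -
  obtain m :: int where m: "of_int k * y = of_int m" using assms(2) by (elim Ints_cases)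
  hence "y = of_int m / of_int k" using assms(1) by (simp add: field_simps)
  hence "y \<in> \<rat>" by simp
  then obtain a b :: int where ab: "b > 0" "coprime a b" "y = of_int a / of_int b"
    by (metis Rats_cases')
  have "of_int j * y \<in> \<int> \<longleftrightarrow> b dvd j" for j :: int
  proof
    assume "of_int j * y \<in> \<int>"
    then obtain i :: int where "of_int j * y = of_int i" by (elim Ints_cases)
    hence "real_of_int (j * a) = of_int (i * b)" using ab by (simp add: field_simps)
    hence "j * a = i * b" by (simp only: of_int_eq_iff)
    hence "b dvd j * a" by simp
    thus "b dvd j" using ab(2) by (simp add: coprime_dvd_mult_left_iff coprime_commute)
  next
    assume "b dvd j"
    then obtain i where "j = b * i" by auto
    thus "of_int j * y \<in> \<int>" using ab by simp
  qed
  thus ?thesis using that[of "nat b"] ab(1) by simp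
qed

text \<open>The denominator of y divides every element of \<open>S\<close>, hence the gcd. The set
  may be infinite, as it is for the gcds of all digit sets beyond a level.\<close>

lemma Gcd_times_in_Ints:
  fixes S :: "int set" and y :: real
  assumes "\<And>d. d \<in> S \<Longrightarrow> of_int d * y \<in> \<int>"
  shows "of_int (Gcd S) * y \<in> \<int>"
proof (cases "S \<subseteq> {0}")
  case True
  hence "Gcd S = 0" by (simp add: Gcd_0_iff)
  thus ?thesis by (metis Ints_0 mult_zero_left of_int_0)
next
  case False
  then obtain k where k: "k \<in> S" "k \<noteq> 0" by blast
  obtain b :: nat where b: "\<And>j::int. of_int j * y \<in> \<int> \<longleftrightarrow> int b dvd j"
    using denominator_ideal[OF k(2) assms[OF k(1)]] by metis
  have "int b dvd Gcd S" by (rule Gcd_greatest) (use assms b in blast)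
  thus ?thesis using b by blast
qed

text \<open>Incongruent digits, p in number, exhaust the residues modulo p.\<close>

lemma hadamard_digit_residue:
  assumes H: "hadamard_triple p D L" and c: "card D = p"
  obtains d where "d \<in> D" "int p dvd d - r"
proof -
  have p: "p > 1" and fin: "finite D" using hadamardD[OF H] by auto
  have "(\<lambda>d. d mod int p) ` D = {0..<int p}"
    using card_image[OF hadamard_inj_mod[OF H]] c p fin by (intro card_subset_eq) auto
  moreover have "r mod int p \<in> {0..<int p}" using p by simp
  ultimately obtain d where "d \<in> D" "d mod int p = r mod int p" by (metis imageE)
  thus ?thesis using that mod_eq_dvd_iff by blast
qed

text \<open>Some digit d is congruent to 1 modulo p, so a common divisor of the gcd and of p divides
  both d and d - 1.\<close>

lemma coprime_Gcd_modulus: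
  assumes H: "hadamard_triple p D L" and c: "card D = p"
  shows "coprime (Gcd D) (int p)"
proof (rule coprimeI)
  fix q assume q: "q dvd Gcd D" "q dvd int p"
  obtain d where d: "d \<in> D" "int p dvd d - 1" using hadamard_digit_residue[OF H c] by blast
  have "q dvd d" using q d by (meson Gcd_dvd dvd_trans)
  moreover have "q dvd d - 1" using q d by (meson dvd_trans)
  ultimately have "q dvd d - (d - 1)" by (rule dvd_diff)
  thus "is_unit q" by simp
qed

text \<open>Dividing by P keeps a point in the lattice (1/g)Z if the right translate is taken first;
  that translate solves a linear congruence modulo P, solvable because g is invertible
  there.\<close>

lemma coprime_lift:
  fixes g P :: int and x :: real
  assumes "coprime g P" "of_int g * x \<in> \<int>" "P > 0"
  obtains l where "l \<in> {0..<P}" "of_int g * ((x + of_int l) / of_int P) \<in> \<int>"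
proof -
  obtain m :: int where m: "of_int g * x = of_int m" using assms(2) by (elim Ints_cases)
  obtain u v where uv: "u * g + v * P = 1" using bezout_int[of g P] assms(1) by auto
  \<comment> \<open>u is the inverse of g modulo P, so this is the residue for which P divides m + g
    l.\<close>
  define l where "l = (- m * u) mod P"
  have l: "l = - m * u - P * ((- m * u) div P)" unfolding l_def by (rule minus_mult_div_eq_mod[symmetric])
  have "m + g * l = m * (1 - u * g) - P * (g * ((- m * u) div P))" unfolding l by (simp add: algebra_simps)
  also have "1 - u * g = v * P" using uv by linarith
  finally have "m + g * l = P * (m * v - g * ((- m * u) div P))" by (simp add: algebra_simps)
  then obtain i where "m + g * l = P * i" by blast
  hence "real_of_int m + of_int g * of_int l = of_int P * of_int i"
    by (metis of_int_add of_int_mult)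
  hence "of_int g * ((x + of_int l) / of_int P) = of_int i"
    using assms(3) m by (simp add: field_simps)
  moreover have "l \<in> {0..<P}" using assms(3) by (simp add: l_def)
  ultimately show ?thesis using that by (metis Ints_of_int)
qed

lemma dvd_Gcd_Ints:
  fixes D :: "int set"
  assumes "of_int (Gcd D) * y \<in> \<int>" "d \<in> D"
  shows "of_int d * y \<in> \<int>"
proof -
  obtain k where "d = Gcd D * k" using Gcd_dvd[OF assms(2)] by (auto elim: dvdE)
  hence "of_int d * y = of_int k * (of_int (Gcd D) * y)" by (metis mult.assoc mult.commute of_int_mult)
  thus ?thesis using assms(1) by simp
qed

text \<open>When D is a complete residue system, the squared masks over the p translates sum to 1, so a
  unimodular value at one translate annihilates all others.\<close>

lemma dmask_nonzero_imp:
  assumes H: "hadamard_triple p D L" and c: "card D = p"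
    and x: "of_int (Gcd D) * x \<in> \<int>" and nz: "dmask D (x / real p) \<noteq> 0"
  shows "of_int (Gcd D) * (x / real p) \<in> \<int>"
proof -
  have p: "p > 1" and fin: "finite D" using hadamardD[OF H] by auto
  have ne: "D \<noteq> {}" using c p by auto
  obtain l where l: "l \<in> {0..<int p}" "of_int (Gcd D) * ((x + of_int l) / of_int (int p)) \<in> \<int>"
    by (rule coprime_lift[OF coprime_Gcd_modulus[OF H c] x]) (use p in simp)
  have one: "dmask D ((x + of_int l) / real p) = 1"
    by (rule dmask_eq_1[OF fin ne]) (rule dvd_Gcd_Ints, use l(2) in auto)
  have "(\<Sum>k\<in>{0..<int p}. (cmod (dmask D ((x + of_int k) / real p)))\<^sup>2) = 1"
    using hadamard_dmask_sum_full[OF H ne] c p by simp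
  hence "(\<Sum>k\<in>{0..<int p}-{l}. (cmod (dmask D ((x + of_int k) / real p)))\<^sup>2) = 0"
    using l(1) one by (simp add: sum.remove[of _ l])
  hence z: "dmask D ((x + of_int k) / real p) = 0" if "k \<in> {0..<int p}-{l}" for k
    using that by (subst (asm) sum_nonneg_eq_0_iff) auto
  have "l = 0" using z[of 0] nz p by force
  thus ?thesis using l(2) by simp
qed

text \<open>If a single translate carries the whole sum p / #D of squared masks, then p = #D and
  that mask is unimodular. Conversely, for p = #D and x in (1/g)Z with g = gcd D, two nonvanishing
  translates both divide into (1/g)Z, so p divides g (l1 - l2), hence l1 - l2, because g is prime to
  p.\<close>

lemma exists_two_nonzero_iff:
  assumes H: "hadamard_triple p D L" and z: "0 \<in> D"
  shows "(\<exists>l1\<in>{0..<int p}. \<exists>l2\<in>{0..<int p}. l1 \<noteq> l2 \<and> dmask D ((x + of_int l1) / real p) \<noteq> 0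
             \<and> dmask D ((x + of_int l2) / real p) \<noteq> 0)
     \<longleftrightarrow> card D < p \<or> of_int (Gcd D) * x \<notin> \<int>" (is "?L \<longleftrightarrow> ?R")
proof
  have p: "p > 1" and fin: "finite D" using hadamardD[OF H] by auto
  have ne: "D \<noteq> {}" using z by auto
  have N: "card D > 0" using fin ne by (simp add: card_gt_0_iff)
  let ?m = "\<lambda>l. dmask D ((x + of_int l) / real p)"
  note S = hadamard_dmask_sum_full[OF H ne, of x]
  {
    assume R: ?R
    show ?L
    proof (rule ccontr)
      assume nL: "\<not> ?L"
      have "(\<Sum>l\<in>{0..<int p}. (cmod (?m l))\<^sup>2) \<noteq> 0" using S p N by simp
      then obtain l where l: "l \<in> {0..<int p}" "?m l \<noteq> 0" by (metis (mono_tags, lifting) norm_zero sum.neutral zero_power2)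
      have "?m k = 0" if "k \<in> {0..<int p} - {l}" for k using nL l that by blast
      hence "(\<Sum>k\<in>{0..<int p} - {l}. (cmod (?m k))\<^sup>2) = 0" by simp
      hence sl: "(cmod (?m l))\<^sup>2 = real p / real (card D)" using S l(1) by (simp add: sum.remove[of _ l])
      moreover have "(cmod (?m l))\<^sup>2 \<le> 1" using norm_dmask_le by (simp add: power_le_one)
      ultimately have "real p / real (card D) \<le> 1" by simp
      hence "p \<le> card D" using N by (simp add: field_simps)
      hence c: "card D = p" using hadamard_card_le[OF H] by simp
      hence "cmod (?m l) = 1" using sl p by (simp add: power2_eq_1_iff) (use norm_ge_zero[of "?m l"] in linarith)
      hence "of_int (Gcd D) * ((x + of_int l) / real p) \<in> \<int>"
        using Gcd_times_in_Ints dmask_unit_imp[OF fin z] by blast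
      then obtain i where "of_int (Gcd D) * ((x + of_int l) / real p) = of_int i" by (elim Ints_cases)
      moreover have "of_int (Gcd D) * (x + of_int l) = real p * (of_int (Gcd D) * ((x + of_int l) / real p))"
        using p by simp
      ultimately have "of_int (Gcd D) * x = of_int (i * int p - Gcd D * l)" by (simp add: distrib_left mult.commute)
      hence "of_int (Gcd D) * x \<in> \<int>" by simp
      thus False using R c by simp
    qed
  }
  {
    assume ?L
    then obtain l1 l2 where l: "l1 \<in> {0..<int p}" "l2 \<in> {0..<int p}" "l1 \<noteq> l2" "?m l1 \<noteq> 0" "?m l2 \<noteq> 0" by blast
    show ?R
    proof (rule ccontr)
      assume "\<not> ?R"
      hence c: "card D = p" and gx: "of_int (Gcd D) * x \<in> \<int>" using hadamard_card_le[OF H] by auto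
      have "of_int (Gcd D) * ((x + of_int l) / real p) \<in> \<int>" if "?m l \<noteq> 0" for l
        using dmask_nonzero_imp[OF H c _ that] gx by (simp add: distrib_left)
      from Ints_diff[OF this[OF l(4)] this[OF l(5)]]
      have "of_int (Gcd D) * of_int (l1 - l2) / real p \<in> \<int>"
        by (simp add: diff_divide_distrib[symmetric] algebra_simps)
      then obtain i where "of_int (Gcd D) * of_int (l1 - l2) / real p = of_int i" by (elim Ints_cases)
      hence "real_of_int (Gcd D * (l1 - l2)) = of_int (i * int p)" using p by (simp add: divide_eq_eq)
      hence "Gcd D * (l1 - l2) = i * int p" by (simp only: of_int_eq_iff)
      hence "int p dvd (l1 - l2) * Gcd D" by (simp add: mult.commute)
      hence "int p dvd l1 - l2" using coprime_Gcd_modulus[OF H c]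
        by (simp add: coprime_dvd_mult_left_iff coprime_commute)
      hence "l1 mod int p = l2 mod int p" by (simp add: mod_eq_dvd_iff)
      thus False using l by simp
    qed
  }
qed

lemma DPCS_iff:
  assumes H: "hadamard_triple p D L" and z: "0 \<in> D"
  shows "x \<in> DPCS p D \<longleftrightarrow> 0 \<le> x \<and> x < 1 \<and> (card D < p \<or> of_int (Gcd D) * x \<notin> \<int>)"
proof -
  let ?m = "\<lambda>l::int. dmask D ((x + of_int l) / real p)"
  have "(\<exists>l1\<in>{0..<int p}. \<exists>l2\<in>{0..<int p}. l1 \<noteq> l2 \<and> ?m l1 \<noteq> 0 \<and> ?m l2 \<noteq> 0)
     \<longleftrightarrow> (\<exists>l1\<in>{0..<p}. \<exists>l2\<in>{0..<p}. l1 \<noteq> l2 \<and> ?m (int l1) \<noteq> 0 \<and> ?m (int l2) \<noteq> 0)"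
  proof -
    have "{0..<int p} = int ` {0..<p}" by (simp add: image_int_atLeastLessThan)
    thus ?thesis by auto
  qed
  thus ?thesis unfolding exists_two_nonzero_iff[OF H z, of x, symmetric]
    by (auto simp: DPCS_def dmask_def mult.assoc)
qed

section \<open>Existence and Fourier transform of Cantor-Moran measures\<close>

definition pprod :: "(nat \<Rightarrow> nat) \<Rightarrow> nat \<Rightarrow> real" where
  "pprod p n = (\<Prod>i\<in>{1..n}. real (p i))"

text \<open>The Fourier transform of \<open>moran_partial p D n\<close>, as
  \<open>fourier_partial\<close> confirms.\<close>

definition mprod :: "(nat \<Rightarrow> nat) \<Rightarrow> (nat \<Rightarrow> int set) \<Rightarrow> nat \<Rightarrow> real \<Rightarrow> complex" where
  "mprod p D n \<xi> = (\<Prod>j\<in>{1..n}. dmask (D j) (\<xi> / pprod p j))"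

lemma pprod_0 [simp]: "pprod p 0 = 1" by (simp add: pprod_def)
lemma pprod_Suc: "pprod p (Suc n) = pprod p n * real (p (Suc n))" by (simp add: pprod_def)
lemma pprod_add: "pprod p (n + k) = pprod p n * pprod (\<lambda>i. p (n + i)) k"
  by (induction k) (auto simp: pprod_Suc)
lemma pprod_Ints: "pprod p n \<in> \<int>"
  by (auto simp: pprod_def intro!: Ints_prod)

lemma mprod_0 [simp]: "mprod p D 0 \<xi> = 1" by (simp add: mprod_def)
lemma mprod_Suc: "mprod p D (Suc n) \<xi> = mprod p D n \<xi> * dmask (D (Suc n)) (\<xi> / pprod p (Suc n))"
  by (simp add: mprod_def)
lemma mprod_add: "mprod p D (n + k) \<xi> = mprod p D n \<xi> * mprod (\<lambda>i. p (n + i)) (\<lambda>i. D (n + i)) k (\<xi> / pprod p n)"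
proof (induction k)
  case (Suc k)
  show ?case using Suc pprod_add[of p n "Suc k"] by (simp add: mprod_Suc)
qed simp
lemma norm_mprod_le: "cmod (mprod p D n \<xi>) \<le> 1"
  by (induction n) (auto simp: mprod_Suc norm_mult intro!: mult_le_one norm_dmask_le)

lemma dmask_near_1:
  assumes "finite D" "D \<noteq> {}" and B: "\<And>d. d \<in> D \<Longrightarrow> \<bar>of_int d * y\<bar> \<le> B"
  shows "cmod (dmask D y - 1) \<le> 2 * pi * B"
proof -
  have N: "card D > 0" using assms by (simp add: card_gt_0_iff)
  have "dmask D y - 1 = (\<Sum>d\<in>D. cis (2 * pi * (of_int d * y)) - 1) / of_nat (card D)"
    using N by (simp add: dmask_def sum_subtractf diff_divide_distrib)
  hence "cmod (dmask D y - 1) = cmod (\<Sum>d\<in>D. cis (2 * pi * (of_int d * y)) - 1) / real (card D)"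
    by (simp add: norm_divide)
  also have "cmod (\<Sum>d\<in>D. cis (2 * pi * (of_int d * y)) - 1) \<le> (\<Sum>d\<in>D. 2 * pi * B)"
  proof (rule sum_norm_le)
    fix d assume d: "d \<in> D"
    have "cmod (cis (2 * pi * (of_int d * y)) - 1) \<le> 2 * pi * \<bar>of_int d * y\<bar>"
      using cis_lipschitz[of "2 * pi * (of_int d * y)"] by (simp add: abs_mult)
    also have "\<dots> \<le> 2 * pi * B" using B[OF d] by simp
    finally show "cmod (cis (2 * pi * (of_int d * y)) - 1) \<le> 2 * pi * B" .
  qed
  finally show ?thesis using N by (simp add: divide_right_mono)
qed

text \<open>Bridge to \<open>char\<close>, through which Levy's uniqueness and continuity theorems
  are used.\<close>

lemma fourier_char: "fourier \<mu> \<xi> = char \<mu> (2 * pi * \<xi>)"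
  by (simp add: fourier_def char_def cis_conv_exp mult_ac)

section \<open>Transforms of distributions on the line, convolutions and uniform measures\<close>

context real_distribution begin

lemma integrable_cis: "integrable M (\<lambda>x. cis (a * x))"
  by (rule integrable_const_bound[of _ 1])
     (auto simp: cis_conv_exp intro!: borel_measurable_continuous_onI continuous_intros)

lemma fourier_0: "fourier M 0 = 1"
  by (simp add: fourier_char char_zero)

lemma norm_fourier_le: "cmod (fourier M \<xi>) \<le> 1"
  by (simp add: fourier_char cmod_char_le_1)

text \<open>The constant depends on the support bound only, so one modulus of continuity serves all
  partial and tail measures.\<close>

lemma fourier_lipschitz:
  assumes supp: "AE x in M. 0 \<le> x \<and> x \<le> R"
  shows "cmod (fourier M a - fourier M b) \<le> 2 * pi * R * \<bar>a - b\<bar>"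
proof -
  have I: "integrable M (\<lambda>x. cis (2 * pi * x * c))" for c
    using integrable_cis[of "2 * pi * c"] by (simp add: mult_ac)
  have "fourier M a - fourier M b = (\<integral>x. cis (2 * pi * x * a) - cis (2 * pi * x * b) \<partial>M)"
    unfolding fourier_def by (simp add: I)
  also have "cmod \<dots> \<le> (\<integral>x. cmod (cis (2 * pi * x * a) - cis (2 * pi * x * b)) \<partial>M)"
    by (rule integral_norm_bound)
  also have "\<dots> \<le> (\<integral>x. 2 * pi * R * \<bar>a - b\<bar> \<partial>M)"
  proof (rule integral_mono_AE)
    show "AE x in M. cmod (cis (2 * pi * x * a) - cis (2 * pi * x * b)) \<le> 2 * pi * R * \<bar>a - b\<bar>"
      using supp
    proof eventually_elim
      fix x :: real assume x: "0 \<le> x \<and> x \<le> R"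
      have "cis (2 * pi * x * a) - cis (2 * pi * x * b) = cis (2 * pi * x * b) * (cis (2 * pi * x * (a - b)) - 1)"
        by (simp add: cis_mult algebra_simps)
      hence "cmod (cis (2 * pi * x * a) - cis (2 * pi * x * b)) = cmod (cis (2 * pi * x * (a - b)) - 1)"
        by (simp add: norm_mult)
      also have "\<dots> \<le> 2 * pi * (x * \<bar>a - b\<bar>)"
        using cis_lipschitz[of "2 * pi * x * (a - b)"] x by (simp add: abs_mult mult.assoc)
      also have "\<dots> \<le> 2 * pi * (R * \<bar>a - b\<bar>)" using x by (intro mult_left_mono mult_right_mono) auto
      finally show "cmod (cis (2 * pi * x * a) - cis (2 * pi * x * b)) \<le> 2 * pi * R * \<bar>a - b\<bar>"
        by (simp add: mult_ac)
    qed
  qed (use I in auto)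
  finally show ?thesis by (simp add: prob_space del: space_eq_univ)
qed

end

lemma convolution_facts:
  assumes "real_distribution M" "real_distribution N"
  shows real_distribution_convolution: "real_distribution (M \<star> N)"
    and fourier_convolution: "fourier (M \<star> N) \<xi> = fourier M \<xi> * fourier N \<xi>"
    and AE_convolution: "(AE x in M. 0 \<le> x \<and> x \<le> a) \<Longrightarrow> (AE x in N. 0 \<le> x \<and> x \<le> b) \<Longrightarrow>
        AE x in M \<star> N. 0 \<le> x \<and> x \<le> a + b"
proof -
  interpret M: real_distribution M by fact
  interpret N: real_distribution N by fact
  interpret P: pair_prob_space M N ..
  have m: "(\<lambda>(x, y). x + y) \<in> M \<Otimes>\<^sub>M N \<rightarrow>\<^sub>M (borel :: real measure)" by measurable
  show "real_distribution (M \<star> N)"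
    unfolding convolution_def by (rule P.real_distribution_distr) (use m in simp)
  have I: "integrable (M \<Otimes>\<^sub>M N) (\<lambda>z. cis (2 * pi * (fst z + snd z) * \<xi>))"
    by (rule P.integrable_const_bound[of _ 1])
       (auto simp: cis_conv_exp)
  have "fourier (M \<star> N) \<xi> = (\<integral>z. cis (2 * pi * (fst z + snd z) * \<xi>) \<partial>(M \<Otimes>\<^sub>M N))"
    unfolding fourier_def convolution_def
    by (subst integral_distr[OF m])
       (auto simp: case_prod_beta cis_conv_exp intro!: borel_measurable_continuous_onI continuous_intros)
  also have "\<dots> = (\<integral>x. \<integral>y. cis (2 * pi * (x + y) * \<xi>) \<partial>N \<partial>M)"
    using P.integral_fst'[OF I] by simp
  also have "\<dots> = (\<integral>x. \<integral>y. cis (2 * pi * x * \<xi>) * cis (2 * pi * y * \<xi>) \<partial>N \<partial>M)"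
    by (simp add: cis_mult ring_distribs)
  also have "\<dots> = fourier M \<xi> * fourier N \<xi>" by (simp add: fourier_def)
  finally show "fourier (M \<star> N) \<xi> = fourier M \<xi> * fourier N \<xi>" .
  assume A: "AE x in M. 0 \<le> x \<and> x \<le> a" and B: "AE x in N. 0 \<le> x \<and> x \<le> b"
  have "AE z in M \<Otimes>\<^sub>M N. 0 \<le> fst z + snd z \<and> fst z + snd z \<le> a + b"
  proof (rule P.AE_pair_measure)
    show "AE x in M. AE y in N. 0 \<le> fst (x, y) + snd (x, y) \<and> fst (x, y) + snd (x, y) \<le> a + b"
      using A
    proof eventually_elim
      case (elim x)
      show ?case using B by eventually_elim (use elim in auto)
    qed
  qed measurable
  thus "AE x in M \<star> N. 0 \<le> x \<and> x \<le> a + b"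
    unfolding convolution_def by (subst AE_distr_iff[OF m]) (auto simp: case_prod_beta)
qed

lemma unif_measure_facts:
  assumes A: "finite A" "A \<noteq> {}"
  shows real_distribution_unif: "real_distribution (unif_measure A)"
    and fourier_unif: "fourier (unif_measure A) \<xi> = (\<Sum>a\<in>A. cis (2 * pi * a * \<xi>)) / of_nat (card A)"
    and AE_unif: "(\<And>x. x \<in> A \<Longrightarrow> P x) \<Longrightarrow> Measurable.pred borel P \<Longrightarrow> AE x in unif_measure A. P x"
proof -
  let ?M = "measure_pmf (pmf_of_set A)"
  show "real_distribution (unif_measure A)" unfolding unif_measure_def
    by (rule prob_space.real_distribution_distr[OF measure_pmf.prob_space_axioms]) simp
  have "fourier (unif_measure A) \<xi> = (\<integral>x. cis (2 * pi * x * \<xi>) \<partial>?M)"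
    unfolding fourier_def unif_measure_def
    by (subst integral_distr) (auto simp: cis_conv_exp intro!: borel_measurable_continuous_onI continuous_intros)
  also have "\<dots> = (\<Sum>a\<in>A. pmf (pmf_of_set A) a *\<^sub>R cis (2 * pi * a * \<xi>))"
    by (rule integral_measure_pmf) (use A in \<open>auto simp: set_pmf_of_set\<close>)
  also have "\<dots> = (\<Sum>a\<in>A. cis (2 * pi * a * \<xi>) / of_nat (card A))"
    by (rule sum.cong) (use A in \<open>auto simp: pmf_of_set indicator_def scaleR_conv_of_real\<close>)
  finally show "fourier (unif_measure A) \<xi> = (\<Sum>a\<in>A. cis (2 * pi * a * \<xi>)) / of_nat (card A)"
    by (simp add: sum_divide_distrib)
  assume "\<And>x. x \<in> A \<Longrightarrow> P x" "Measurable.pred borel P"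
  thus "AE x in unif_measure A. P x"
    unfolding unif_measure_def using A by (subst AE_distr_iff) (auto simp: AE_measure_pmf_iff set_pmf_of_set pred_def)
qed

text \<open>These conditions survive dropping initial levels (\<open>shift\<close>). Each tail is
  therefore again an instance with the same \<open>C\<close>, and every bound in terms of
  \<open>C\<close> holds for all tails at once.\<close>

locale moran_system =
  fixes p :: "nat \<Rightarrow> nat" and D :: "nat \<Rightarrow> int set" and C :: real
  assumes p_gt_1: "n \<ge> 1 \<Longrightarrow> p n > 1"
    and finite_D: "n \<ge> 1 \<Longrightarrow> finite (D n)"
    and zero_D: "n \<ge> 1 \<Longrightarrow> 0 \<in> D n"
    and nonneg_D: "n \<ge> 1 \<Longrightarrow> d \<in> D n \<Longrightarrow> 0 \<le> d"
    and bound_D: "n \<ge> 1 \<Longrightarrow> d \<in> D n \<Longrightarrow> of_int d \<le> C * real (p n)"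
begin

lemma shift: "moran_system (\<lambda>k. p (n + k)) (\<lambda>k. D (n + k)) C"
  proof
  fix m :: nat and d assume m: "m \<ge> 1"
  hence "n + m \<ge> 1" by simp
  thus "1 < p (n + m)" "finite (D (n + m))" "0 \<in> D (n + m)" "d \<in> D (n + m) \<Longrightarrow> 0 \<le> d"
    "d \<in> D (n + m) \<Longrightarrow> of_int d \<le> C * real (p (n + m))"
    using p_gt_1 finite_D zero_D nonneg_D bound_D by blast+
qed

lemma C_nonneg: "0 \<le> C"
  using bound_D[of 1 0] zero_D[of 1] p_gt_1[of 1] by (auto simp: zero_le_mult_iff)

lemma D_nonempty: "n \<ge> 1 \<Longrightarrow> D n \<noteq> {}" using zero_D by blast

lemma pprod_ge: "2 ^ n \<le> pprod p n"
proof (induction n)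
  case (Suc n)
  have "(2::real) ^ n * 2 \<le> pprod p n * real (p (Suc n))"
    using Suc p_gt_1[of "Suc n"] by (intro mult_mono) (auto intro: order_trans[OF _ Suc])
  thus ?case by (simp add: pprod_Suc mult.commute)
qed simp

lemma pprod_pos: "0 < pprod p n"
  using pprod_ge[of n] by (meson less_le_trans zero_less_numeral zero_less_power)

lemma digit_bound:
  assumes "d \<in> D (Suc n)"
  shows "of_int d / pprod p (Suc n) \<le> C * (1 / 2) ^ n"
proof -
  have "of_int d / pprod p (Suc n) \<le> C * real (p (Suc n)) / pprod p (Suc n)"
    using bound_D[of "Suc n" d] assms pprod_pos[of "Suc n"] by (intro divide_right_mono) auto
  also have "\<dots> = C / pprod p n" using p_gt_1[of "Suc n"] by (simp add: pprod_Suc)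
  also have "\<dots> \<le> C / 2 ^ n" using pprod_ge[of n] C_nonneg by (intro divide_left_mono) (auto simp: pprod_pos)
  finally show ?thesis by (simp add: power_one_over)
qed

text \<open>The support bound is the geometric sum of C / 2^i over i < n, one term per convolution
  factor by \<open>digit_bound\<close>.\<close>

lemma partial_facts:
  shows real_distribution_partial: "real_distribution (moran_partial p D n)"
    and fourier_partial: "fourier (moran_partial p D n) \<xi> = mprod p D n \<xi>"
    and AE_partial: "AE x in moran_partial p D n. 0 \<le> x \<and> x \<le> C * (2 - 2 * (1 / 2) ^ n)"
proof (induction n)
  case 0
  { case 1 show ?case
      by (auto simp: real_distribution_def real_distribution_axioms_def intro!: prob_space_return) }
  { case 2 show ?case by (simp add: fourier_def integral_return cis_conv_exp) }
  { case 3 show ?case by (subst moran_partial.simps) (subst AE_return, auto) }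
next
  case (Suc n)
  let ?A = "(\<lambda>d. of_int d / pprod p (Suc n)) ` D (Suc n)"
  have P: "pprod p (Suc n) > 0" by (rule pprod_pos)
  have A: "finite ?A" "?A \<noteq> {}" using finite_D[of "Suc n"] D_nonempty[of "Suc n"] by auto
  have eq: "moran_partial p D (Suc n) = (moran_partial p D n \<star> unif_measure ?A)"
    by (simp add: pprod_def)
  note R = Suc.IH(1) real_distribution_unif[OF A]
  have inj: "inj_on (\<lambda>d. of_int d / pprod p (Suc n)) (D (Suc n))" using P by (auto simp: inj_on_def)
  { case 1 show ?case unfolding eq by (rule real_distribution_convolution[OF R]) }
  { case 2 show ?case unfolding eq fourier_convolution[OF R] Suc.IH(2) mprod_Suc fourier_unif[OF A]
      by (simp add: sum.reindex[OF inj] card_image[OF inj] dmask_def mult.assoc) }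
  { case 3
    have "AE x in unif_measure ?A. 0 \<le> x \<and> x \<le> C * (1 / 2) ^ n"
    proof (rule AE_unif[OF A])
      fix x assume "x \<in> ?A"
      thus "0 \<le> x \<and> x \<le> C * (1 / 2) ^ n"
        using digit_bound[of _ n] nonneg_D[of "Suc n"] P by auto
    qed measurable
    from AE_convolution[OF R Suc.IH(3) this]
    show ?case unfolding eq by (simp add: algebra_simps) }
qed

lemma AE_partial': "AE x in moran_partial p D n. 0 \<le> x \<and> x \<le> 2 * C"
  using AE_partial[of n]
proof eventually_elim
  case (elim x)
  have "C * (2 - 2 * (1 / 2) ^ n) \<le> C * 2" using C_nonneg by (intro mult_left_mono) auto
  thus ?case using elim by auto
qed

text \<open>The bound does not depend on n: it comes from the common support [0, 2C] of the partial
  measures, not from estimating the factors one by one. This is what makes long jumps through levels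
  cheap.\<close>

lemma mprod_near_1: "cmod (mprod p D n \<xi> - 1) \<le> 4 * pi * C * \<bar>\<xi>\<bar>"
  using real_distribution.fourier_lipschitz[OF real_distribution_partial AE_partial', of n \<xi> 0]
    real_distribution.fourier_0[OF real_distribution_partial, of n]
  by (simp add: fourier_partial)

lemma mprod_convergent: "convergent (\<lambda>n. mprod p D n \<xi>)"
proof -
  let ?f = "\<lambda>n. mprod p D (Suc n) \<xi> - mprod p D n \<xi>"
  have "summable ?f"
  proof (rule summable_comparison_test)
    show "\<exists>N. \<forall>n\<ge>N. cmod (?f n) \<le> 2 * pi * (\<bar>\<xi>\<bar> * C) * (1 / 2) ^ n"
    proof (intro exI allI impI)
      fix n
      have "cmod (?f n) = cmod (mprod p D n \<xi>) * cmod (dmask (D (Suc n)) (\<xi> / pprod p (Suc n)) - 1)"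
        by (simp add: mprod_Suc algebra_simps flip: norm_mult)
      also have "\<dots> \<le> 1 * (2 * pi * (\<bar>\<xi>\<bar> * (C * (1 / 2) ^ n)))"
      proof (intro mult_mono norm_mprod_le dmask_near_1)
        fix d assume d: "d \<in> D (Suc n)"
        have "\<bar>of_int d * (\<xi> / pprod p (Suc n))\<bar> = \<bar>\<xi>\<bar> * (of_int d / pprod p (Suc n))"
          using nonneg_D[OF _ d] pprod_pos[of "Suc n"] by (simp add: abs_mult)
        also have "\<dots> \<le> \<bar>\<xi>\<bar> * (C * (1 / 2) ^ n)" using digit_bound[OF d] by (intro mult_left_mono) auto
        finally show "\<bar>of_int d * (\<xi> / pprod p (Suc n))\<bar> \<le> \<bar>\<xi>\<bar> * (C * (1 / 2) ^ n)" .
      qed (use finite_D D_nonempty in auto)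
      finally show "cmod (?f n) \<le> 2 * pi * (\<bar>\<xi>\<bar> * C) * (1 / 2) ^ n" by (simp add: mult_ac)
    qed
  qed (intro summable_mult summable_geometric, simp)
  hence "convergent (\<lambda>n. \<Sum>k<n. ?f k)" by (simp add: summable_iff_convergent)
  hence "convergent (\<lambda>n. mprod p D n \<xi> - 1)" using sum_lessThan_telescope[of "\<lambda>n. mprod p D n \<xi>"] by simp
  thus ?thesis by (simp add: convergent_diff_const_right_iff)
qed

text \<open>The common support gives tightness, hence a limit along a subsequence. The
  characteristic functions of the whole sequence converge pointwise, necessarily to that of this
  limit, and Levy's continuity theorem upgrades the convergence to the whole sequence.\<close>

lemma weak_limit_exists: "\<exists>\<mu>. real_distribution \<mu> \<and> weak_conv_m (moran_partial p D) \<mu>"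
proof -
  note R = real_distribution_partial
  have "tight (moran_partial p D)" unfolding tight_def
  proof (intro conjI allI impI R)
    fix \<epsilon> :: real assume e: "\<epsilon> > 0"
    show "\<exists>a b. a < b \<and> (\<forall>n. 1 - \<epsilon> < measure (moran_partial p D n) {a<..b})"
    proof (intro exI conjI allI)
      show "-1 < 2 * C" using C_nonneg by simp
      fix n
      interpret real_distribution "moran_partial p D n" by (rule R)
      have "prob {-1<..2 * C} = 1"
        by (rule prob_eq_1[THEN iffD2]) (use AE_partial'[of n] in \<open>auto elim!: eventually_mono\<close>)
      thus "1 - \<epsilon> < prob {-1<..2 * C}" using e by simp
    qed
  qed
  from tight_imp_convergent_subsubsequence[OF this strict_mono_id]
  obtain r M where rM: "strict_mono r" "real_distribution M" "weak_conv_m (moran_partial p D \<circ> id \<circ> r) M" by blast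
  have "weak_conv_m (moran_partial p D) M"
  proof (rule levy_continuity[OF R rM(2)])
    fix t
    have "convergent (\<lambda>n. char (moran_partial p D n) t)"
      using mprod_convergent[of "t / (2 * pi)"] by (simp add: fourier_partial[symmetric] fourier_char)
    then obtain l where l: "(\<lambda>n. char (moran_partial p D n) t) \<longlonglongrightarrow> l" by (auto simp: convergent_def)
    have "(\<lambda>n. char ((moran_partial p D \<circ> id \<circ> r) n) t) \<longlonglongrightarrow> char M t"
      using R by (intro levy_continuity1 rM) auto
    moreover have "(\<lambda>n. char ((moran_partial p D \<circ> id \<circ> r) n) t) \<longlonglongrightarrow> l"
      using LIMSEQ_subseq_LIMSEQ[OF l rM(1)] by (simp add: o_def)
    ultimately show "(\<lambda>n. char (moran_partial p D n) t) \<longlonglongrightarrow> char M t"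
      using l LIMSEQ_unique by blast
  qed
  thus ?thesis using rM by blast
qed

text \<open>Two weak limits share their characteristic function, so the description in
  \<open>moran\<close> has a unique referent.\<close>

lemma moran_weak_limit:
  shows real_distribution_moran: "real_distribution (moran p D)"
    and weak_conv_moran: "weak_conv_m (moran_partial p D) (moran p D)"
proof -
  have "\<exists>!\<mu>. real_distribution \<mu> \<and> weak_conv_m (moran_partial p D) \<mu>"
  proof (rule ex_ex1I[OF weak_limit_exists])
    fix \<mu> \<nu> assume A: "real_distribution \<mu> \<and> weak_conv_m (moran_partial p D) \<mu>"
      "real_distribution \<nu> \<and> weak_conv_m (moran_partial p D) \<nu>"
    have "char \<mu> = char \<nu>"
    proof
      fix t show "char \<mu> t = char \<nu> t"
        using A levy_continuity1[of "moran_partial p D", OF real_distribution_partial] LIMSEQ_unique by blast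
    qed
    thus "\<mu> = \<nu>" using A Levy_uniqueness by blast
  qed
  from theI'[OF this] show "real_distribution (moran p D)" "weak_conv_m (moran_partial p D) (moran p D)"
    by (auto simp: moran_def)
qed

lemma fourier_moran_lim: "(\<lambda>n. mprod p D n \<xi>) \<longlonglongrightarrow> fourier (moran p D) \<xi>"
  using levy_continuity1[OF real_distribution_partial real_distribution_moran weak_conv_moran, of "2 * pi * \<xi>"]
  by (simp add: fourier_char[symmetric] fourier_partial)

text \<open>Weak convergence tests bounded continuous functions, so the support is detected by the
  distance to [0, 2C] truncated at 1: its integral is 0 for each partial measure, hence also in the
  limit.\<close>

lemma AE_moran: "AE x in moran p D. 0 \<le> x \<and> x \<le> 2 * C"
proof -
  let ?f = "\<lambda>x::real. min 1 (infdist x {0..2 * C})"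
  interpret real_distribution "moran p D" by (rule real_distribution_moran)
  have cont: "continuous_on UNIV ?f" by (intro continuous_intros)
  have meas: "?f \<in> borel_measurable borel" using cont by (rule borel_measurable_continuous_onI)
  have ne: "{0..2 * C} \<noteq> {}" using C_nonneg by simp
  have "(\<lambda>n. integral\<^sup>L (moran_partial p D n) ?f) \<longlonglongrightarrow> integral\<^sup>L (moran p D) ?f"
  proof (rule weak_conv_imp_integral_bdd_continuous_conv[OF real_distribution_partial real_distribution_moran weak_conv_moran])
    show "isCont ?f x" for x using cont by (simp add: continuous_on_eq_continuous_at)
    show "norm (?f x) \<le> 1" for x by (simp add: infdist_nonneg)
  qed
  moreover have "integral\<^sup>L (moran_partial p D n) ?f = 0" for n
  proof -
    interpret n: real_distribution "moran_partial p D n" by (rule real_distribution_partial)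
    have "AE x in moran_partial p D n. ?f x = 0"
      using AE_partial'[of n] by eventually_elim simp
    hence "integral\<^sup>L (moran_partial p D n) ?f = integral\<^sup>L (moran_partial p D n) (\<lambda>_. 0)"
      by (intro integral_cong_AE) (use meas in auto)
    thus ?thesis by simp
  qed
  ultimately have "integral\<^sup>L (moran p D) ?f = 0" by (simp add: LIMSEQ_const_iff)
  moreover have "integrable (moran p D) ?f"
    by (rule integrable_const_bound[of _ 1]) (use meas in \<open>auto simp: infdist_nonneg\<close>)
  ultimately have "AE x in moran p D. ?f x = 0"
    by (subst (asm) integral_nonneg_eq_0_iff_AE) (auto simp: infdist_nonneg)
  thus ?thesis
  proof eventually_elim
    case (elim x)
    hence "infdist x {0..2 * C} = 0" by (auto simp: min_def split: if_splits)
    hence "x \<in> {0..2 * C}" using in_closed_iff_infdist_zero[OF closed_atLeastAtMost ne] by blast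
    thus ?case by simp
  qed
qed

end

section \<open>Transforms at separated points\<close>

text \<open>The clause \<open>z < Max Z\<close> serves the induction: the zero found between the two
  largest elements lies above all earlier ones and is therefore new.\<close>

lemma rolle_step:
  fixes f f' :: "real \<Rightarrow> real"
  assumes der: "\<And>t. (f has_real_derivative f' t) (at t)"
    and Z: "finite Z" "Z \<noteq> {}" "\<And>z. z \<in> Z \<Longrightarrow> f z = 0"
  shows "\<exists>Z'. finite Z' \<and> Suc (card Z') = card Z \<and> (\<forall>z\<in>Z'. f' z = 0 \<and> z < Max Z)"
  using Z
proof (induction Z rule: finite_linorder_max_induct)
  case (insert b A)
  show ?case
  proof (cases "A = {}")
    case False
    then obtain Z' where Z': "finite Z'" "Suc (card Z') = card A" "\<forall>z\<in>Z'. f' z = 0 \<and> z < Max A"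
      using insert by auto
    have "Max A < b" "f (Max A) = f b" using insert False by auto
    then obtain c where c: "Max A < c" "c < b" "DERIV f c :> 0"
      using Rolle[of "Max A" b f] der
      by (metis DERIV_atLeastAtMost_imp_continuous_on real_differentiable_def)
    have "f' c = 0" using DERIV_unique[OF der c(3)] .
    moreover have "c \<notin> Z'" using Z' c by force
    moreover have "Max (insert b A) = b" using insert(1) \<open>Max A < b\<close> False by (subst Max_insert) auto
    moreover have "b \<notin> A" using insert by auto
    ultimately show ?thesis using Z' c insert(1)
      by (intro exI[of _ "insert c Z'"]) force
  qed (auto intro: exI[of _ "{}"])
qed simp

lemma rolle_zeros:
  fixes f :: "nat \<Rightarrow> real \<Rightarrow> real"
  assumes der: "\<And>m t. (f m has_real_derivative f (Suc m) t) (at t)"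
    and Z: "finite Z" "card Z = Suc n" "\<And>z. z \<in> Z \<Longrightarrow> f m z = 0"
  shows "\<exists>t. f (m + n) t = 0"
  using Z
proof (induction n arbitrary: m Z)
  case 0
  then obtain z where "z \<in> Z" by fastforce
  thus ?case using 0 by auto
next
  case (Suc n)
  hence "Z \<noteq> {}" by auto
  from rolle_step[OF der Suc.prems(1) this Suc.prems(3)]
  obtain Z' where "finite Z'" "card Z' = Suc n" "\<forall>z\<in>Z'. f (Suc m) z = 0" using Suc.prems(2) by auto
  from Suc.IH[of Z' "Suc m"] this show ?case by simp
qed

lemma pderiv_funpow_degree_le:
  fixes q :: "real poly"
  assumes "degree q \<le> K"
  shows "(pderiv ^^ K) q = [:fact K * coeff q K:]"
proof -
  have "degree ((pderiv ^^ K) q) = 0" using assms by (simp add: degree_higher_pderiv)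
  moreover have "coeff ((pderiv ^^ K) q) 0 = fact K * coeff q K"
    by (simp add: coeff_higher_pderiv pochhammer_fact)
  ultimately show ?thesis by (metis degree_eq_zeroE coeff_pCons_0)
qed

text \<open>The value at 0 of the Lagrange basis polynomial that is 1 at y and 0 at the other
  nodes.\<close>

definition lagrange_weight :: "real set \<Rightarrow> real \<Rightarrow> real" where
  "lagrange_weight Y y = (\<Prod>z\<in>Y - {y}. - z / (y - z))"

text \<open>The classical remainder of Lagrange interpolation, evaluated at 0: a K-th derivative of
  cos(a t), bounded by |a|^K, over K!, times the node polynomial at 0, whose modulus is at most 1 as
  the nodes lie in [0, 1]. If 0 is a node, the interpolation is exact there.\<close>

lemma cos_interpolation:
  fixes a :: real
  assumes Y: "finite Y" "Y \<subseteq> {0..1}"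
  shows "\<bar>1 - (\<Sum>y\<in>Y. cos (a * y) * lagrange_weight Y y)\<bar> \<le> \<bar>a\<bar> ^ card Y / fact (card Y)"
proof (cases "0 \<in> Y")
  case True
  have "lagrange_weight Y y = 0" if "y \<in> Y - {0}" for y
    unfolding lagrange_weight_def using that Y True by (intro prod_zero) auto
  moreover have "lagrange_weight Y 0 = 1"
    unfolding lagrange_weight_def by (rule prod.neutral) auto
  ultimately have "(\<Sum>y\<in>Y. cos (a * y) * lagrange_weight Y y) = 1"
    using True Y by (simp add: sum.remove[of Y 0])
  thus ?thesis by simp
next
  case False
  define K where "K = card Y"
  define l where "l y = (\<Prod>z\<in>Y - {y}. smult (1 / (y - z)) [:- z, 1:])" for y
  define W where "W = (\<Prod>z\<in>Y. [:- z, 1:])"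
  define S where "S = (\<Sum>y\<in>Y. smult (cos (a * y)) (l y))"
  \<comment> \<open>Chosen so that Q agrees with cos(a t) at 0 as well as at the K nodes; the
    interpolation error at 0 is then c times W(0).\<close>
  define c where "c = (1 - poly S 0) / poly W 0"
  define Q where "Q = S + smult c W"
  \<comment> \<open>The m-th derivative of cos(a t) - Q(t), with the derivatives of the cosine
    written as phase shifts.\<close>
  define f where "f m t = a ^ m * cos (a * t + real m * (pi / 2)) - poly ((pderiv ^^ m) Q) t" for m t
  have W0: "poly W t = (\<Prod>z\<in>Y. t - z)" for t by (simp add: W_def poly_prod)
  have l0: "poly (l y) t = (\<Prod>z\<in>Y - {y}. (t - z) / (y - z))" for y t
    by (simp add: l_def poly_prod diff_divide_distrib)
  have S0: "poly S 0 = (\<Sum>y\<in>Y. cos (a * y) * lagrange_weight Y y)"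
    by (simp add: S_def poly_sum l0 lagrange_weight_def)
  have nz: "poly W 0 \<noteq> 0" using False Y by (auto simp: W0)
  have SY: "poly S t = cos (a * t)" if "t \<in> Y" for t
  proof -
    have "poly (l y) t = 0" if "y \<in> Y - {t}" for y
      unfolding l0 using that \<open>t \<in> Y\<close> Y by (intro prod_zero) auto
    moreover have "poly (l t) t = 1" unfolding l0 by (rule prod.neutral) auto
    ultimately show ?thesis using that Y by (simp add: S_def poly_sum sum.remove[of Y t])
  qed
  have degl: "degree (l y) < K" if "y \<in> Y" for y
  proof -
    have "degree (l y) \<le> (\<Sum>z\<in>Y-{y}. 1)" unfolding l_def
      by (rule order_trans[OF degree_prod_sum_le]) (use Y in \<open>auto intro!: sum_mono\<close>)
    also have "\<dots> < K" using that Y card_gt_0_iff[of Y] by (auto simp: K_def)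
    finally show ?thesis .
  qed
  have cS: "coeff S K = 0" unfolding S_def coeff_sum
    by (rule sum.neutral) (use degl in \<open>auto simp: coeff_eq_0\<close>)
  have degS: "degree S \<le> K" unfolding S_def
    by (rule degree_sum_le[OF Y(1)]) (use degl in \<open>force intro: order_trans[OF degree_smult_le]\<close>)
  have dW: "degree W = K" unfolding W_def K_def by (subst degree_prod_eq_sum_degree) auto
  have "lead_coeff W = 1" unfolding W_def by (simp add: lead_coeff_prod)
  hence cW: "coeff W K = 1" using dW by simp
  have degQ: "degree Q \<le> K" unfolding Q_def
    by (rule degree_add_le) (use degS dW in \<open>auto intro: order_trans[OF degree_smult_le]\<close>)
  have cQ: "coeff Q K = c" by (simp add: Q_def cS cW)
  have der: "(f m has_real_derivative f (Suc m) t) (at t)" for m t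
  proof -
    have "cos (a * t + real (Suc m) * (pi / 2)) = - sin (a * t + real m * (pi / 2))"
    proof -
      have "a * t + real (Suc m) * (pi / 2) = (a * t + real m * (pi / 2)) + pi / 2" by (simp add: algebra_simps)
      thus ?thesis by (simp only: cos_add) simp
    qed
    thus ?thesis unfolding f_def
      by (auto intro!: derivative_eq_intros poly_DERIV simp: mult_ac)
  qed
  \<comment> \<open>K + 1 zeros leave one zero of the K-th derivative, where the polynomial part is
    the constant K! c.\<close>
  have "\<exists>t. f (0 + K) t = 0"
  proof (rule rolle_zeros[where f = f])
    show "(f m has_real_derivative f (Suc m) t) (at t)" for m t by (rule der)
    show "finite (insert 0 Y)" "card (insert 0 Y) = Suc K" using Y False by (auto simp: K_def)
    fix z assume "z \<in> insert 0 Y"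
    thus "f 0 z = 0"
    proof
      assume "z = 0" thus ?thesis using nz by (simp add: f_def Q_def c_def)
    next
      assume z: "z \<in> Y"
      hence "poly W z = 0" using Y by (auto simp: W0)
      thus ?thesis using SY[OF z] by (simp add: f_def Q_def)
    qed
  qed
  then obtain t where "f K t = 0" by auto
  hence "fact K * c = a ^ K * cos (a * t + real K * (pi / 2))"
    by (simp add: f_def pderiv_funpow_degree_le[OF degQ] cQ)
  from arg_cong[OF this, of abs] have "fact K * \<bar>c\<bar> = \<bar>a\<bar> ^ K * \<bar>cos (a * t + real K * (pi / 2))\<bar>"
    by (simp add: abs_mult power_abs)
  also have "\<dots> \<le> \<bar>a\<bar> ^ K * 1" by (intro mult_left_mono) auto
  finally have "\<bar>c\<bar> \<le> \<bar>a\<bar> ^ K / fact K" by (simp add: field_simps)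
  moreover have "\<bar>poly W 0\<bar> \<le> 1"
    unfolding W0 abs_prod by (rule prod_le_1) (use Y in auto)
  ultimately have "\<bar>c * poly W 0\<bar> \<le> \<bar>a\<bar> ^ K / fact K * 1" unfolding abs_mult by (intro mult_mono) auto
  moreover have "1 - poly S 0 = c * poly W 0" using nz by (simp add: c_def)
  ultimately show ?thesis by (simp add: S0 K_def)
qed

text \<open>The interpolation estimate is integrated over M. Real parts appear because the remainder
  argument through Rolle's theorem is one for real functions.\<close>

lemma fourier_interpolation:
  assumes "real_distribution M" and supp: "AE x in M. 0 \<le> x \<and> x \<le> R"
    and Y: "finite Y" "Y \<subseteq> {0..1}"
  shows "\<bar>1 - (\<Sum>y\<in>Y. Re (fourier M y) * lagrange_weight Y y)\<bar> \<le> (2 * pi * R) ^ card Y / fact (card Y)"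
proof -
  interpret real_distribution M by fact
  have I: "integrable M (\<lambda>x. cis (2 * pi * x * c))" for c
    using integrable_cis[of "2 * pi * c"] by (simp add: mult_ac)
  have IR: "integrable M (\<lambda>x. cos (2 * pi * x * c))" for c
    using integrable_Re[OF I[of c]] by simp
  have Re: "Re (fourier M c) = (\<integral>x. cos (2 * pi * x * c) \<partial>M)" for c
    unfolding fourier_def using integral_Re[OF I[of c]] by simp
  let ?g = "\<lambda>x. 1 - (\<Sum>y\<in>Y. cos (2 * pi * x * y) * lagrange_weight Y y)"
  have gI: "integrable M ?g" using IR by (intro Bochner_Integration.integrable_diff Bochner_Integration.integrable_sum integrable_mult_left) auto
  have "1 - (\<Sum>y\<in>Y. Re (fourier M y) * lagrange_weight Y y) = (\<integral>x. ?g x \<partial>M)"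
    using IR by (simp add: Re prob_space del: space_eq_univ)
  also have "\<bar>\<dots>\<bar> \<le> (\<integral>x. \<bar>?g x\<bar> \<partial>M)" by (rule integral_abs_bound)
  also have "\<dots> \<le> (\<integral>x. (2 * pi * R) ^ card Y / fact (card Y) \<partial>M)"
  proof (rule integral_mono_AE)
    show "AE x in M. \<bar>?g x\<bar> \<le> (2 * pi * R) ^ card Y / fact (card Y)"
      using supp
    proof eventually_elim
      case (elim x)
      have "\<bar>?g x\<bar> \<le> \<bar>2 * pi * x\<bar> ^ card Y / fact (card Y)" by (rule cos_interpolation[OF Y])
      also have "\<dots> \<le> (2 * pi * R) ^ card Y / fact (card Y)"
        using elim by (intro divide_right_mono power_mono) (auto simp: abs_mult)
      finally show ?case .
    qed
  qed (use gI in auto)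
  finally show ?thesis by (simp add: prob_space del: space_eq_univ)
qed

text \<open>The quantifier over all measures on [0, R] sits inside: a single \<epsilon> has to serve
  every tail at every level.\<close>

definition large_at_separated :: "real \<Rightarrow> nat \<Rightarrow> real \<Rightarrow> real \<Rightarrow> bool" where
  "large_at_separated R K \<sigma> \<epsilon> \<longleftrightarrow> (\<forall>M Y. real_distribution M \<longrightarrow> (AE x in M. 0 \<le> x \<and> x \<le> R) \<longrightarrow>
     finite Y \<longrightarrow> card Y = K \<longrightarrow> Y \<subseteq> {0..1} \<longrightarrow> (\<forall>y\<in>Y. \<forall>z\<in>Y. y \<noteq> z \<longrightarrow> \<sigma> \<le> \<bar>y - z\<bar>) \<longrightarrow>
     (\<exists>y\<in>Y. \<epsilon> \<le> cmod (fourier M y)))"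

lemma large_at_separatedD:
  assumes "large_at_separated R K \<sigma> \<epsilon>" "real_distribution M" "AE x in M. 0 \<le> x \<and> x \<le> R"
    "finite Y" "card Y = K" "Y \<subseteq> {0..1}" "\<And>y z. y \<in> Y \<Longrightarrow> z \<in> Y \<Longrightarrow> y \<noteq> z \<Longrightarrow> \<sigma> \<le> \<bar>y - z\<bar>"
  shows "\<exists>y\<in>Y. \<epsilon> \<le> cmod (fourier M y)"
  using assms unfolding large_at_separated_def by blast

text \<open>The order of quantifiers is essential: K depends on R alone, so that it may be fixed
  before the separation is known, which itself results from producing K points.\<close>

lemma fourier_large_at_separated_points:
  "\<exists>K>0. \<forall>\<sigma>. 0 < \<sigma> \<longrightarrow> \<sigma> \<le> 1 \<longrightarrow> (\<exists>\<epsilon>>0. large_at_separated R K \<sigma> \<epsilon>)"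
proof -
  have "(\<lambda>n. (2 * pi * R) ^ n / fact n) \<longlonglongrightarrow> 0"
    using summable_LIMSEQ_zero[OF summable_exp[of "2 * pi * R"]] by (simp add: field_simps)
  hence "eventually (\<lambda>n. (2 * pi * R) ^ n / fact n < 1 / 2 \<and> n > 0) sequentially"
    by (intro eventually_conj order_tendstoD eventually_gt_at_top) auto
  then obtain K where K: "K > 0" "(2 * pi * R) ^ K / fact K < 1 / 2"
    by (auto simp: eventually_sequentially)
  show ?thesis
  proof (intro exI[of _ K] conjI allI impI K)
    fix \<sigma> :: real assume s: "0 < \<sigma>" "\<sigma> \<le> 1"
    \<comment> \<open>Each of the K weights is at most 1 / \<sigma>^K, so values below this
      \<epsilon> give an interpolated sum of at most 1/4, whereas the sum is within 1/2 of
      1.\<close>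
    define \<epsilon> where "\<epsilon> = \<sigma> ^ K / (4 * real K)"
    have e: "\<epsilon> > 0" using s K by (simp add: \<epsilon>_def)
    show "\<exists>\<epsilon>>0. large_at_separated R K \<sigma> \<epsilon>" unfolding large_at_separated_def
    proof (intro exI[of _ \<epsilon>] conjI allI impI e)
      fix M Y assume M: "real_distribution M" "AE x in M. 0 \<le> x \<and> x \<le> R"
        and Y: "finite Y" "card Y = K" "Y \<subseteq> {0..1}" and sep: "\<forall>y\<in>Y. \<forall>z\<in>Y. y \<noteq> z \<longrightarrow> \<sigma> \<le> \<bar>y - z\<bar>"
      show "\<exists>y\<in>Y. \<epsilon> \<le> cmod (fourier M y)"
      proof (rule ccontr)
        assume "\<not> ?thesis"
        hence small: "cmod (fourier M y) < \<epsilon>" if "y \<in> Y" for y using that by force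
        have w: "\<bar>lagrange_weight Y y\<bar> \<le> 1 / \<sigma> ^ K" if y: "y \<in> Y" for y
        proof -
          have "\<bar>lagrange_weight Y y\<bar> \<le> (\<Prod>z\<in>Y-{y}. 1 / \<sigma>)"
            unfolding lagrange_weight_def abs_prod
          proof (rule prod_mono, intro conjI)
            fix z assume z: "z \<in> Y - {y}"
            have "\<sigma> \<le> \<bar>y - z\<bar>" using sep y z by auto
            moreover have "\<bar>z\<bar> \<le> 1" using z Y by auto
            ultimately show "\<bar>- z / (y - z)\<bar> \<le> 1 / \<sigma>" unfolding abs_divide using s by (intro frac_le) auto
          qed simp
          also have "\<dots> = (1 / \<sigma>) ^ (K - 1)" using y Y by simp
          also have "\<dots> \<le> (1 / \<sigma>) ^ K" using s by (intro power_increasing) auto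
          finally show ?thesis by (simp add: power_one_over)
        qed
        have "\<bar>\<Sum>y\<in>Y. Re (fourier M y) * lagrange_weight Y y\<bar> \<le> (\<Sum>y\<in>Y. \<epsilon> * (1 / \<sigma> ^ K))"
        proof (rule order_trans[OF sum_abs], rule sum_mono)
          fix y assume y: "y \<in> Y"
          have "\<bar>Re (fourier M y)\<bar> \<le> \<epsilon>" using abs_Re_le_cmod[of "fourier M y"] small[OF y] by linarith
          thus "\<bar>Re (fourier M y) * lagrange_weight Y y\<bar> \<le> \<epsilon> * (1 / \<sigma> ^ K)"
            unfolding abs_mult using w[OF y] e by (intro mult_mono) auto
        qed
        also have "\<dots> = 1 / 4" using s K Y by (simp add: \<epsilon>_def)
        finally have "\<bar>\<Sum>y\<in>Y. Re (fourier M y) * lagrange_weight Y y\<bar> \<le> 1 / 4" .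
        moreover have "\<bar>1 - (\<Sum>y\<in>Y. Re (fourier M y) * lagrange_weight Y y)\<bar> \<le> (2 * pi * R) ^ K / fact K"
          using fourier_interpolation[OF M Y(1,3)] Y(2) by simp
        ultimately show False using K(2) by linarith
      qed
    qed
  qed
qed

section \<open>A criterion for spectrality\<close>

context real_distribution begin

lemma cis_mult_integrable:
  fixes f :: "real \<Rightarrow> complex"
  assumes "integrable M f"
  shows "integrable M (\<lambda>x. f x * cis (a * x))"
proof (rule Bochner_Integration.integrable_bound[OF assms])
  have "(\<lambda>x. cis (a * x)) \<in> borel_measurable M"
    using integrable_cis by (rule borel_measurable_integrable)
  thus "(\<lambda>x. f x * cis (a * x)) \<in> borel_measurable M"
    using assms by (intro borel_measurable_times) auto
qed (simp add: norm_mult)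

text \<open>The positive and negative parts of h have equal mass c (take t = 0). Divided by c they
  are two probability densities with the same characteristic function, and Levy's uniqueness theorem
  identifies them.\<close>

lemma fourier_uniqueness_real:
  fixes h :: "real \<Rightarrow> real"
  assumes h: "integrable M h" and z: "\<And>t. (\<integral>x. of_real (h x) * cis (t * x) \<partial>M) = 0"
  shows "AE x in M. h x = 0"
proof -
  define u v where "u x = max (h x) 0" and "v x = max (- h x) 0" for x
  have uv: "integrable M u" "integrable M v" unfolding u_def v_def using h by auto
  have nn: "u x \<ge> 0" "v x \<ge> 0" for x by (auto simp: u_def v_def)
  have huv: "h x = u x - v x" for x by (auto simp: u_def v_def)
  have eq: "(\<integral>x. of_real (u x) * cis (t * x) \<partial>M) = (\<integral>x. of_real (v x) * cis (t * x) \<partial>M)" for t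
  proof -
    have "integrable M (\<lambda>x. of_real (u x) * cis (t * x))" "integrable M (\<lambda>x. of_real (v x) * cis (t * x))"
      using uv by (auto intro!: cis_mult_integrable)
    thus ?thesis using z[of t] by (simp add: huv left_diff_distrib)
  qed
  define c where "c = (\<integral>x. u x \<partial>M)"
  have "complex_of_real (\<integral>x. u x \<partial>M) = complex_of_real (\<integral>x. v x \<partial>M)"
    using eq[of 0] uv by simp
  hence c': "c = (\<integral>x. v x \<partial>M)" unfolding c_def using of_real_eq_iff by blast
  show ?thesis
  proof (cases "c = 0")
    case True
    have "AE x in M. u x = 0" using True uv nn by (simp add: c_def integral_nonneg_eq_0_iff_AE)
    moreover have "AE x in M. v x = 0" using True uv nn unfolding c' by (simp add: integral_nonneg_eq_0_iff_AE)
    ultimately show ?thesis by eventually_elim (simp add: huv)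
  next
    case False
    moreover have "c \<ge> 0" unfolding c_def by (rule Bochner_Integration.integral_nonneg) (rule nn)
    ultimately have cpos: "c > 0" by simp
    have dens: "real_distribution (density M (\<lambda>x. ennreal (w x / c)))"
      "char (density M (\<lambda>x. ennreal (w x / c))) t = (\<integral>x. of_real (w x) * cis (t * x) \<partial>M) / of_real c"
      if w: "integrable M w" "\<And>x. w x \<ge> 0" "(\<integral>x. w x \<partial>M) = c" for w t
    proof -
      have wm: "w \<in> borel_measurable M" using w by auto
      have wc: "integrable M (\<lambda>x. w x / c)" using w by simp
      have "emeasure (density M (\<lambda>x. ennreal (w x / c))) (space (density M (\<lambda>x. ennreal (w x / c)))) = (\<integral>\<^sup>+x. ennreal (w x / c) \<partial>M)"
        using wm by (subst emeasure_density) (auto intro!: nn_integral_cong)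
      also have "\<dots> = ennreal (\<integral>x. w x / c \<partial>M)"
        using wc w cpos by (intro nn_integral_eq_integral) auto
      also have "(\<integral>x. w x / c \<partial>M) = 1" using w cpos by simp
      finally have "prob_space (density M (\<lambda>x. ennreal (w x / c)))" by (intro prob_spaceI) simp
      thus "real_distribution (density M (\<lambda>x. ennreal (w x / c)))"
        by (auto simp: real_distribution_def real_distribution_axioms_def)
      have "char (density M (\<lambda>x. ennreal (w x / c))) t = (\<integral>x. (w x / c) *\<^sub>R iexp (t * x) \<partial>M)"
        unfolding char_def by (rule integral_density) (use wm w cpos in auto)
      also have "\<dots> = (\<integral>x. (of_real (w x) * cis (t * x)) / of_real c \<partial>M)"
        by (intro Bochner_Integration.integral_cong) (auto simp: cis_conv_exp scaleR_conv_of_real)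
      also have "\<dots> = (\<integral>x. of_real (w x) * cis (t * x) \<partial>M) / of_real c" by simp
      finally show "char (density M (\<lambda>x. ennreal (w x / c))) t = (\<integral>x. of_real (w x) * cis (t * x) \<partial>M) / of_real c" .
    qed
    have "density M (\<lambda>x. ennreal (u x / c)) = density M (\<lambda>x. ennreal (v x / c))"
      by (rule Levy_uniqueness)
         (use dens[OF uv(1) nn(1) c_def[symmetric]] dens[OF uv(2) nn(2) c'[symmetric]] eq in auto)
    hence "AE x in M. ennreal (u x / c) = ennreal (v x / c)"
      using uv by (subst (asm) density_unique_iff) auto
    thus ?thesis by eventually_elim (use cpos nn in \<open>simp add: huv\<close>)
  qed
qed

lemma fourier_uniqueness:
  fixes f :: "real \<Rightarrow> complex"
  assumes f: "integrable M f" and z: "\<And>t. (\<integral>x. f x * cis (t * x) \<partial>M) = 0"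
  shows "AE x in M. f x = 0"
proof -
  have I: "integrable M (\<lambda>x. f x * cis (t * x))" for t by (rule cis_mult_integrable[OF f])
  have cI: "integrable M (\<lambda>x. cnj (f x) * cis (t * x))" for t
    by (rule cis_mult_integrable) (use f in simp)
  have z': "(\<integral>x. cnj (f x) * cis (t * x) \<partial>M) = 0" for t
  proof -
    have "(\<integral>x. cnj (f x) * cis (t * x) \<partial>M) = (\<integral>x. cnj (f x * cis (- t * x)) \<partial>M)"
      by (simp add: cis_cnj)
    also have "\<dots> = 0" using z[of "- t"] by (subst Bochner_Integration.integral_cnj) simp
    finally show ?thesis .
  qed
  have "(\<integral>x. of_real (Re (f x)) * cis (t * x) \<partial>M) = 0" for t
  proof -
    have "(\<integral>x. of_real (Re (f x)) * cis (t * x) \<partial>M) = (\<integral>x. (f x * cis (t * x) + cnj (f x) * cis (t * x)) / 2 \<partial>M)"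
      by (intro Bochner_Integration.integral_cong refl) (simp add: complex_add_cnj flip: distrib_right)
    also have "\<dots> = 0" using I cI z z' by simp
    finally show ?thesis .
  qed
  hence 1: "AE x in M. Re (f x) = 0" using f by (intro fourier_uniqueness_real) auto
  have "(\<integral>x. of_real (Im (f x)) * cis (t * x) \<partial>M) = 0" for t
  proof -
    have "(\<integral>x. of_real (Im (f x)) * cis (t * x) \<partial>M) = (\<integral>x. (f x * cis (t * x) - cnj (f x) * cis (t * x)) / (2 * \<i>) \<partial>M)"
    proof (intro Bochner_Integration.integral_cong refl)
      fix x
      have "z * w - cnj z * w = (2 * \<i>) * (of_real (Im z) * w)" for z w
        by (simp add: complex_eq_iff algebra_simps)
      thus "of_real (Im (f x)) * cis (t * x) = (f x * cis (t * x) - cnj (f x) * cis (t * x)) / (2 * \<i>)" by simp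
    qed
    also have "\<dots> = 0" using I cI z z' by simp
    finally show ?thesis .
  qed
  hence 2: "AE x in M. Im (f x) = 0" using f by (intro fourier_uniqueness_real) auto
  show ?thesis using 1 2 by eventually_elim (simp add: complex_eq_iff)
qed

lemma exp_inner: "(\<integral>x. cis (2 * pi * a * x) * cnj (cis (2 * pi * b * x)) \<partial>M) = fourier M (a - b)"
  unfolding fourier_def by (intro Bochner_Integration.integral_cong refl) (simp add: cis_cnj cis_mult algebra_simps)

lemma exp_inner_integrable: "integrable M (\<lambda>x. cis (2 * pi * a * x) * cnj (cis (2 * pi * b * x)))"
proof -
  have "cis (2 * pi * a * x) * cnj (cis (2 * pi * b * x)) = cis (2 * pi * (a - b) * x)" for x
    by (simp add: cis_cnj cis_mult algebra_simps)
  thus ?thesis using integrable_cis by simp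
qed

lemma cnj_fourier: "cnj (fourier M t) = fourier M (- t)"
  unfolding fourier_def by (simp flip: Bochner_Integration.integral_cnj add: cis_cnj)

text \<open>h is what remains of the exponential with frequency t after projection onto the span of
  those in B; its squared norm is the defect in Bessel's inequality.\<close>

lemma projection_error:
  fixes B :: "real set" and t :: real
  assumes B: "finite B" and orth: "\<And>a b. a \<in> B \<Longrightarrow> b \<in> B \<Longrightarrow> a \<noteq> b \<Longrightarrow> fourier M (a - b) = 0"
  defines "h \<equiv> \<lambda>x. cis (2 * pi * t * x) - (\<Sum>l\<in>B. fourier M (t - l) * cis (2 * pi * l * x))"
  shows "integrable M (\<lambda>x. (cmod (h x))\<^sup>2)"
    and "(\<integral>x. (cmod (h x))\<^sup>2 \<partial>M) = 1 - (\<Sum>l\<in>B. (cmod (fourier M (t - l)))\<^sup>2)"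
proof -
  let ?c = "\<lambda>l. fourier M (t - l)"
  let ?e = "\<lambda>l x. cis (2 * pi * l * x)"
  have ex: "h x * cnj (h x) = ?e t x * cnj (?e t x) - (\<Sum>l\<in>B. cnj (?c l) * (?e t x * cnj (?e l x)))
      - (\<Sum>l\<in>B. ?c l * (?e l x * cnj (?e t x)))
      + (\<Sum>l\<in>B. \<Sum>k\<in>B. ?c l * cnj (?c k) * (?e l x * cnj (?e k x)))" for x
  proof -
    define S where "S = (\<Sum>l\<in>B. ?c l * ?e l x)"
    have "h x * cnj (h x) = ?e t x * cnj (?e t x) - ?e t x * cnj S - S * cnj (?e t x) + S * cnj S"
    proof -
      have hx: "h x = ?e t x - S" by (simp only: h_def S_def)
      show ?thesis unfolding hx by (simp add: algebra_simps)
    qed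
    moreover have "?e t x * cnj S = (\<Sum>l\<in>B. cnj (?c l) * (?e t x * cnj (?e l x)))"
      unfolding S_def cnj_sum sum_distrib_left by (intro sum.cong refl) (simp add: mult_ac)
    moreover have "S * cnj (?e t x) = (\<Sum>l\<in>B. ?c l * (?e l x * cnj (?e t x)))"
      unfolding S_def sum_distrib_right by (intro sum.cong refl) (simp add: mult_ac)
    moreover have "S * cnj S = (\<Sum>l\<in>B. \<Sum>k\<in>B. ?c l * cnj (?c k) * (?e l x * cnj (?e k x)))"
      unfolding S_def cnj_sum sum_product by (intro sum.cong refl) (simp add: mult_ac)
    ultimately show ?thesis by simp
  qed
  note I = exp_inner_integrable
  have int: "integrable M (\<lambda>x. h x * cnj (h x))" unfolding ex
    by (intro Bochner_Integration.integrable_add Bochner_Integration.integrable_diff Bochner_Integration.integrable_sum integrable_mult_right I)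
  have sq: "complex_of_real ((cmod (h x))\<^sup>2) = h x * cnj (h x)" for x by (rule complex_norm_square)
  have "integrable M (\<lambda>x. Re (h x * cnj (h x)))" using int by (rule integrable_Re)
  moreover have "Re (h x * cnj (h x)) = (cmod (h x))\<^sup>2" for x by (simp flip: sq)
  ultimately show "integrable M (\<lambda>x. (cmod (h x))\<^sup>2)" by simp
  have "(\<integral>x. h x * cnj (h x) \<partial>M) = fourier M (t - t) - (\<Sum>l\<in>B. cnj (?c l) * fourier M (t - l))
      - (\<Sum>l\<in>B. ?c l * fourier M (l - t)) + (\<Sum>l\<in>B. \<Sum>k\<in>B. ?c l * cnj (?c k) * fourier M (l - k))"
    unfolding ex by (simp add: I exp_inner Bochner_Integration.integral_sum)
  also have "(\<Sum>l\<in>B. \<Sum>k\<in>B. ?c l * cnj (?c k) * fourier M (l - k)) = (\<Sum>l\<in>B. \<Sum>k\<in>B. if l = k then ?c l * cnj (?c l) else 0)"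
    by (intro sum.cong refl) (use orth fourier_0 in auto)
  also have "\<dots> = (\<Sum>l\<in>B. ?c l * cnj (?c l))" using B by simp
  also have "(\<Sum>l\<in>B. ?c l * fourier M (l - t)) = (\<Sum>l\<in>B. ?c l * cnj (?c l))" by (simp add: cnj_fourier)
  also have "(\<Sum>l\<in>B. cnj (?c l) * fourier M (t - l)) = (\<Sum>l\<in>B. ?c l * cnj (?c l))" by (simp add: mult.commute)
  finally have "(\<integral>x. h x * cnj (h x) \<partial>M) = 1 - (\<Sum>l\<in>B. ?c l * cnj (?c l))" by (simp add: fourier_0)
  hence "complex_of_real (\<integral>x. (cmod (h x))\<^sup>2 \<partial>M) = complex_of_real (1 - (\<Sum>l\<in>B. (cmod (?c l))\<^sup>2))"
    by (simp only: sq complex_norm_square of_real_diff of_real_sum of_real_1 flip: integral_complex_of_real)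
  thus "(\<integral>x. (cmod (h x))\<^sup>2 \<partial>M) = 1 - (\<Sum>l\<in>B. (cmod (?c l))\<^sup>2)" by (simp only: of_real_eq_iff)
qed

text \<open>If f is orthogonal to all chosen exponentials, its inner product with any exponential
  equals that with the projection error, whose norm tends to 0 by the Parseval hypothesis. Hence all
  Fourier coefficients of f vanish and \<open>fourier_uniqueness\<close> applies.\<close>

lemma spectral_criterion:
  fixes B :: "nat \<Rightarrow> real set"
  assumes fin: "\<And>k. finite (B k)" and mono: "\<And>j k. j \<le> k \<Longrightarrow> B j \<subseteq> B k"
    and orth: "\<And>k a b. a \<in> B k \<Longrightarrow> b \<in> B k \<Longrightarrow> a \<noteq> b \<Longrightarrow> fourier M (a - b) = 0"
    and parseval: "\<And>\<xi>. (\<lambda>k. \<Sum>l\<in>B k. (cmod (fourier M (\<xi> + l)))\<^sup>2) \<longlonglongrightarrow> 1"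
  shows "spectral_measure M"
  unfolding spectral_measure_def
proof (intro exI[of _ "\<Union>k. B k"] conjI ballI allI impI)
  show "countable (\<Union>k. B k)" using fin by (intro countable_UN) (auto intro: countable_finite)
next
  fix a b assume ab: "a \<in> (\<Union>k. B k)" "b \<in> (\<Union>k. B k)" "a \<noteq> b"
  then obtain i j where "a \<in> B i" "b \<in> B j" by blast
  hence "a \<in> B (max i j)" "b \<in> B (max i j)" using mono[of i "max i j"] mono[of j "max i j"] by auto
  thus "(\<integral>x. cis (2 * pi * a * x) * cnj (cis (2 * pi * b * x)) \<partial>M) = 0"
    using orth ab(3) by (simp add: exp_inner)
next
  fix f :: "real \<Rightarrow> complex"
  assume fm: "f \<in> borel_measurable M" and f2: "integrable M (\<lambda>x. (cmod (f x))\<^sup>2)"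
    and f0: "\<forall>a\<in>\<Union>k. B k. (\<integral>x. f x * cnj (cis (2 * pi * a * x)) \<partial>M) = 0"
  define A where "A = (\<integral>x. (cmod (f x))\<^sup>2 \<partial>M)"
  \<comment> \<open>A weighted arithmetic-geometric inequality plays the part of Cauchy-Schwarz: the
    defect is sent to 0 for fixed s, and only then s itself.\<close>
  have amgm: "cmod (u * v) \<le> s * (cmod u)\<^sup>2 + (cmod v)\<^sup>2 / s" if s: "s > 0" for u v :: complex and s :: real
  proof -
    have "0 \<le> (s * cmod u - cmod v)\<^sup>2" by simp
    hence "2 * s * (cmod u * cmod v) \<le> s\<^sup>2 * (cmod u)\<^sup>2 + (cmod v)\<^sup>2" by (simp add: power2_eq_square algebra_simps)
    moreover have "0 \<le> s * (cmod u * cmod v)" using s by simp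
    ultimately have "s * (cmod u * cmod v) \<le> s\<^sup>2 * (cmod u)\<^sup>2 + (cmod v)\<^sup>2" by linarith
    thus ?thesis using s by (simp add: norm_mult field_simps power2_eq_square)
  qed
  have fint: "integrable M f"
  proof (rule Bochner_Integration.integrable_bound[OF _ fm])
    show "integrable M (\<lambda>x. 1 * (cmod (f x))\<^sup>2 + (cmod 1)\<^sup>2 / 1)" using f2 by simp
    show "AE x in M. norm (f x) \<le> norm (1 * (cmod (f x))\<^sup>2 + (cmod 1)\<^sup>2 / 1)"
      using amgm[of 1 _ 1] by (intro AE_I2) (simp add: add_nonneg_nonneg)
  qed
  have fe: "integrable M (\<lambda>x. f x * cnj (cis (2 * pi * a * x)))" for a
    using cis_mult_integrable[OF fint, of "- (2 * pi * a)"] by (simp add: cis_cnj)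
  have "(\<integral>x. f x * cnj (cis (2 * pi * t * x)) \<partial>M) = 0" for t
  proof -
    define I where "I = (\<integral>x. f x * cnj (cis (2 * pi * t * x)) \<partial>M)"
    define \<delta> where "\<delta> k = 1 - (\<Sum>l\<in>B k. (cmod (fourier M (t - l)))\<^sup>2)" for k
    \<comment> \<open>The hypothesis has \<xi> + l where the projection has t - l; conjugation
      symmetry makes \<xi> = - t the right instance.\<close>
    have "(\<lambda>k. \<Sum>l\<in>B k. (cmod (fourier M (t - l)))\<^sup>2) \<longlonglongrightarrow> 1"
    proof -
      have "cmod (fourier M (t - l)) = cmod (fourier M (- t + l))" for l
        using cnj_fourier[of "t - l"] by (metis complex_mod_cnj minus_diff_eq uminus_add_conv_diff)
      thus ?thesis using parseval[of "- t"] by simp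
    qed
    from tendsto_diff[OF tendsto_const[of 1] this] have d0: "\<delta> \<longlonglongrightarrow> 0" unfolding \<delta>_def by simp
    have bnd: "cmod I \<le> s * A + \<delta> k / s" if s: "s > 0" for s k
    proof -
      define h where "h x = cis (2 * pi * t * x) - (\<Sum>l\<in>B k. fourier M (t - l) * cis (2 * pi * l * x))" for x
      have orth_k: "fourier M (a - b) = 0" if "a \<in> B k" "b \<in> B k" "a \<noteq> b" for a b
        using orth that by blast
      note pe = projection_error[where B = "B k" and t = t, OF fin orth_k, folded h_def, unfolded \<delta>_def[symmetric]]
      have ex: "f x * cnj (h x) = f x * cnj (cis (2 * pi * t * x)) - (\<Sum>l\<in>B k. cnj (fourier M (t - l)) * (f x * cnj (cis (2 * pi * l * x))))" for x
        by (simp add: h_def algebra_simps sum_distrib_left)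
      have fh: "integrable M (\<lambda>x. f x * cnj (h x))" unfolding ex
        by (intro Bochner_Integration.integrable_diff Bochner_Integration.integrable_sum integrable_mult_right fe)
      have "(\<integral>x. f x * cnj (h x) \<partial>M) = I"
      proof -
        have "(\<integral>x. f x * cnj (h x) \<partial>M) = I - (\<Sum>l\<in>B k. cnj (fourier M (t - l)) * (\<integral>x. f x * cnj (cis (2 * pi * l * x)) \<partial>M))"
          unfolding ex I_def by (simp add: fe Bochner_Integration.integral_sum)
        also have "(\<Sum>l\<in>B k. cnj (fourier M (t - l)) * (\<integral>x. f x * cnj (cis (2 * pi * l * x)) \<partial>M)) = 0"
          by (rule sum.neutral) (use f0 in auto)
        finally show ?thesis by simp
      qed
      hence "cmod I \<le> (\<integral>x. cmod (f x * cnj (h x)) \<partial>M)" using integral_norm_bound by metis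
      also have "\<dots> \<le> (\<integral>x. s * (cmod (f x))\<^sup>2 + (cmod (h x))\<^sup>2 / s \<partial>M)"
        by (rule integral_mono) (use fh f2 pe amgm[OF s, of _ "cnj _"] in auto)
      also have "\<dots> = s * A + \<delta> k / s" using f2 pe by (simp add: A_def)
      finally show ?thesis .
    qed
    have "cmod I \<le> s * A" if s: "s > 0" for s
    proof (rule LIMSEQ_le_const)
      show "(\<lambda>k. s * A + \<delta> k / s) \<longlonglongrightarrow> s * A" using tendsto_add[OF tendsto_const tendsto_divide[OF d0 tendsto_const]] s by fastforce
      show "\<exists>N. \<forall>k\<ge>N. cmod I \<le> s * A + \<delta> k / s" using bnd[OF s] by blast
    qed
    moreover have "A \<ge> 0" unfolding A_def by simp
    ultimately have "cmod I \<le> 0"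
    proof -
      assume b: "\<And>s. s > 0 \<Longrightarrow> cmod I \<le> s * A" and A: "A \<ge> 0"
      show "cmod I \<le> 0"
      proof (rule field_le_epsilon)
        fix e :: real assume e: "e > 0"
        have "cmod I \<le> e / (A + 1) * A" by (rule b) (use e A in simp)
        also have "\<dots> \<le> e" using e A by (simp add: field_simps)
        finally show "cmod I \<le> 0 + e" by simp
      qed
    qed
    thus ?thesis by (simp add: I_def)
  qed
  note zero = this
  have "(\<integral>x. f x * cis (t * x) \<partial>M) = 0" for t
    using zero[of "- t / (2 * pi)"] by (simp add: cis_cnj)
  thus "AE x in M. f x = 0" by (rule fourier_uniqueness[OF fint])
qed

end

section \<open>Spectra from good levels\<close>

context moran_system begin

lemma moran_tail_shift: "moran_tail (\<lambda>i. p (n + i)) (\<lambda>i. D (n + i)) k = moran_tail p D (n + k)"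
  by (simp add: moran_tail_def add.assoc)

lemma real_distribution_tail: "real_distribution (moran_tail p D n)"
  unfolding moran_tail_def by (rule moran_system.real_distribution_moran[OF shift])

lemma AE_tail: "AE x in moran_tail p D n. 0 \<le> x \<and> x \<le> 2 * C"
  unfolding moran_tail_def by (rule moran_system.AE_moran[OF shift])

lemma fourier_tail_lipschitz:
  "cmod (fourier (moran_tail p D n) a - fourier (moran_tail p D n) b) \<le> 4 * pi * C * \<bar>a - b\<bar>"
  using real_distribution.fourier_lipschitz[OF real_distribution_tail AE_tail, of n a b] by simp

lemma fourier_tail_0: "fourier (moran_tail p D n) 0 = 1"
  by (rule real_distribution.fourier_0[OF real_distribution_tail])

lemma fourier_tail_near_0: "cmod (fourier (moran_tail p D n) a) \<ge> 1 - 4 * pi * C * \<bar>a\<bar>"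
proof -
  have "1 \<le> cmod (fourier (moran_tail p D n) a) + cmod (fourier (moran_tail p D n) a - 1)"
    using norm_triangle_ineq4[of "fourier (moran_tail p D n) a" "fourier (moran_tail p D n) a - 1"] by simp
  thus ?thesis using fourier_tail_lipschitz[of n a 0] by (simp add: fourier_tail_0)
qed

lemma fourier_split:
  "fourier (moran p D) \<xi> = mprod p D n \<xi> * fourier (moran_tail p D n) (\<xi> / pprod p n)"
proof -
  have "(\<lambda>k. mprod p D n \<xi> * mprod (\<lambda>i. p (n + i)) (\<lambda>i. D (n + i)) k (\<xi> / pprod p n))
    \<longlonglongrightarrow> mprod p D n \<xi> * fourier (moran_tail p D n) (\<xi> / pprod p n)"
    unfolding moran_tail_def by (intro tendsto_mult tendsto_const moran_system.fourier_moran_lim[OF shift])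
  moreover have "(\<lambda>k. mprod p D n \<xi> * mprod (\<lambda>i. p (n + i)) (\<lambda>i. D (n + i)) k (\<xi> / pprod p n))
    \<longlonglongrightarrow> fourier (moran p D) \<xi>"
    using LIMSEQ_ignore_initial_segment[OF fourier_moran_lim[of \<xi>], of n]
    by (simp add: mprod_add add.commute[of _ n])
  ultimately show ?thesis using LIMSEQ_unique by blast
qed

lemma fourier_tail_split:
  "fourier (moran_tail p D n) \<xi> = mprod (\<lambda>i. p (n + i)) (\<lambda>i. D (n + i)) k \<xi> *
     fourier (moran_tail p D (n + k)) (\<xi> / pprod (\<lambda>i. p (n + i)) k)"
  using moran_system.fourier_split[OF shift, of n \<xi> k]
  by (simp add: moran_tail_shift) (simp add: moran_tail_def)

lemma mprod_periodic: "k \<in> \<int> \<Longrightarrow> mprod p D m (\<xi> + pprod p m * k) = mprod p D m \<xi>"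
proof (induction m arbitrary: k)
  case (Suc m)
  have "mprod p D m (\<xi> + pprod p m * (real (p (Suc m)) * k)) = mprod p D m \<xi>"
    using Suc by simp
  moreover have "(\<xi> + pprod p (Suc m) * k) / pprod p (Suc m) = k + \<xi> / pprod p (Suc m)"
    using pprod_pos[of "Suc m"] by (simp add: field_simps)
  ultimately show ?case using Suc.prems by (simp add: mprod_Suc dmask_add_int pprod_Suc[of p m] mult.assoc)
qed simp

text \<open>Parseval's identity says that B is a spectrum of the n-th finite convolution at n = m;
  orthogonality is recovered in \<open>parseval_orthogonal\<close>. Integer frequencies make
  translations by integer multiples of \<open>pprod p m\<close> available.\<close>

definition parseval_set :: "nat \<Rightarrow> int set \<Rightarrow> bool" where
  "parseval_set m B \<longleftrightarrow> finite B \<and> (\<forall>\<xi>. (\<Sum>l\<in>B. (cmod (mprod p D m (\<xi> + of_int l)))\<^sup>2) = 1)"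

lemma mprod_0_right: "mprod p D m 0 = 1"
  by (simp add: mprod_def dmask_eq_1 finite_D D_nonempty)

text \<open>The indexed sum cannot count a frequency twice: at \<xi> = - f i the term of i is
  already 1, so a collision would give at least 2.\<close>

lemma parseval_image:
  assumes I: "finite I" and sum: "\<And>\<xi>. (\<Sum>i\<in>I. (cmod (mprod p D m (\<xi> + of_int (f i))))\<^sup>2) = 1"
  shows "parseval_set m (f ` I)"
proof -
  have "inj_on f I"
  proof (rule inj_onI, rule ccontr)
    fix i j assume ij: "i \<in> I" "j \<in> I" "f i = f j" "i \<noteq> j"
    let ?t = "\<lambda>k. (cmod (mprod p D m (- of_int (f i) + of_int (f k))))\<^sup>2"
    have "(\<Sum>k\<in>{i, j}. ?t k) \<le> (\<Sum>k\<in>I. ?t k)" using ij I by (intro sum_mono2) auto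
    thus False using sum[of "- of_int (f i)"] ij by (simp add: mprod_0_right)
  qed
  thus ?thesis using I sum by (simp add: parseval_set_def sum.reindex)
qed

lemma parseval_orthogonal:
  assumes "parseval_set m B" "a \<in> B" "b \<in> B" "a \<noteq> b"
  shows "mprod p D m (of_int a - of_int b) = 0"
proof -
  let ?t = "\<lambda>k. (cmod (mprod p D m (- of_int b + of_int k)))\<^sup>2"
  have fin: "finite B" and all: "\<forall>\<xi>. (\<Sum>l\<in>B. (cmod (mprod p D m (\<xi> + of_int l)))\<^sup>2) = 1"
    using assms(1) by (auto simp: parseval_set_def)
  have "(\<Sum>k\<in>{a, b}. ?t k) \<le> (\<Sum>k\<in>B. ?t k)" using assms fin by (intro sum_mono2) auto
  also have "\<dots> = 1" by (rule all[rule_format])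
  finally have "?t a \<le> 0" using assms(4) by (simp add: mprod_0_right)
  thus ?thesis by simp
qed

lemma pprod_of_int: "pprod p m = of_int (\<Prod>i\<in>{1..m}. int (p i))"
  by (simp add: pprod_def)

text \<open>The new spectrum is B + P L up to a shift, where P is the product of the first n moduli:
  the first n masks are P-periodic, so the Parseval sum factors, and the inner sum over
  \<open>L\<close> is 1 at every base point.\<close>

lemma parseval_extend:
  assumes had: "\<And>n. n \<ge> 1 \<Longrightarrow> \<exists>L. hadamard_triple (p n) (D n) L"
    and B: "parseval_set m B" and "m \<le> m'"
  shows "\<exists>B'. B \<subseteq> B' \<and> parseval_set m' B'"
  using \<open>m \<le> m'\<close>
proof (induction m' rule: dec_induct)
  case base
  thus ?case using B by blast
next
  case (step n)
  then obtain B' where B': "B \<subseteq> B'" "parseval_set n B'" by blast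
  obtain L where L: "hadamard_triple (p (Suc n)) (D (Suc n)) L" using had[of "Suc n"] by auto
  have ne: "D (Suc n) \<noteq> {}" using D_nonempty[of "Suc n"] by simp
  hence "L \<noteq> {}" using hadamardD[OF L] by (metis card_eq_0_iff)
  then obtain l0 where l0: "l0 \<in> L" by blast
  \<comment> \<open>Subtracting l0 puts 0 among the labels, and so the old spectrum inside the new
    one.\<close>
  define f where "f = (\<lambda>(b, l). b + (\<Prod>i\<in>{1..n}. int (p i)) * (l - l0))"
  have "parseval_set (Suc n) (f ` (B' \<times> L))"
  proof (rule parseval_image)
    show "finite (B' \<times> L)" using B' hadamardD[OF L] by (auto simp: parseval_set_def)
    fix \<xi>
    let ?P = "pprod p n" and ?q = "real (p (Suc n))"
    have "(cmod (mprod p D (Suc n) (\<xi> + of_int (f (b, l)))))\<^sup>2 = (cmod (mprod p D n (\<xi> + of_int b)))\<^sup>2 *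
        (cmod (dmask (D (Suc n)) (((\<xi> + of_int b) / ?P - of_int l0 + of_int l) / ?q)))\<^sup>2" for b l
    proof -
      have e: "\<xi> + of_int (f (b, l)) = \<xi> + of_int b + ?P * of_int (l - l0)"
        by (simp add: f_def pprod_of_int)
      have "(\<xi> + of_int b + ?P * of_int (l - l0)) / pprod p (Suc n) = ((\<xi> + of_int b) / ?P - of_int l0 + of_int l) / ?q"
        using pprod_pos[of n] by (simp add: pprod_Suc field_simps)
      thus ?thesis unfolding e mprod_Suc mprod_periodic[OF Ints_of_int] by (simp add: norm_mult power_mult_distrib)
    qed
    hence "(\<Sum>i\<in>B' \<times> L. (cmod (mprod p D (Suc n) (\<xi> + of_int (f i))))\<^sup>2) =
      (\<Sum>b\<in>B'. \<Sum>l\<in>L. (cmod (mprod p D n (\<xi> + of_int b)))\<^sup>2 *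
        (cmod (dmask (D (Suc n)) (((\<xi> + of_int b) / ?P - of_int l0 + of_int l) / ?q)))\<^sup>2)"
      by (simp add: sum.cartesian_product' split_def)
    also have "\<dots> = (\<Sum>b\<in>B'. (cmod (mprod p D n (\<xi> + of_int b)))\<^sup>2)"
      by (simp add: hadamard_dmask_sum[OF L ne] flip: sum_distrib_left)
    finally show "(\<Sum>i\<in>B' \<times> L. (cmod (mprod p D (Suc n) (\<xi> + of_int (f i))))\<^sup>2) = 1"
      using B' by (simp add: parseval_set_def)
  qed
  moreover have "B' \<subseteq> f ` (B' \<times> L)"
  proof
    fix b assume "b \<in> B'"
    thus "b \<in> f ` (B' \<times> L)" using l0 by (intro image_eqI[of _ _ "(b, l0)"]) (auto simp: f_def)
  qed
  ultimately show ?case using B' by blast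
qed

lemma pprod_exceeds: "\<exists>N. \<forall>n\<ge>N. A \<le> pprod p n"
proof -
  obtain N :: nat where N: "A < 2 ^ N" using real_arch_pow[of 2 A] by auto
  have "A \<le> pprod p n" if "n \<ge> N" for n
  proof -
    have "A \<le> 2 ^ N" using N by simp
    also have "\<dots> \<le> 2 ^ n" using that by (intro power_increasing) auto
    also have "\<dots> \<le> pprod p n" by (rule pprod_ge)
    finally show ?thesis .
  qed
  thus ?thesis by blast
qed

section \<open>Levels with a uniform lower bound, and spectra built along them\<close>

definition attains :: "nat \<Rightarrow> real \<Rightarrow> real \<Rightarrow> bool" where
  "attains n \<epsilon> x \<longleftrightarrow> (\<exists>k::int. \<epsilon> \<le> cmod (fourier (moran_tail p D n) (x + of_int k)))"

definition equi_level :: "real \<Rightarrow> nat \<Rightarrow> bool" where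
  "equi_level \<epsilon> n \<longleftrightarrow> (\<forall>x\<in>{0..<1}. attains n \<epsilon> x)"

text \<open>Old frequencies must not move, and need not: at a far level l / P is so close to 0 that
  the tail transform is at least 1/2, hence at least \<epsilon>. New frequencies are moved by
  multiples of P, which the Parseval sum does not notice.\<close>

lemma parseval_next:
  assumes had: "\<And>n. n \<ge> 1 \<Longrightarrow> \<exists>L. hadamard_triple (p n) (D n) L"
    and inf: "infinite {n. equi_level \<epsilon> n}" and e: "\<epsilon> \<le> 1 / 2"
    and B: "parseval_set m B"
  shows "\<exists>m' B'. m < m' \<and> B \<subseteq> B' \<and> parseval_set m' B' \<and>
    (\<forall>l\<in>B'. \<epsilon> \<le> cmod (fourier (moran_tail p D m') (of_int l / pprod p m')))"
proof -
  have finB: "finite B" using B by (simp add: parseval_set_def)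
  define A where "A = Max (insert 0 ((\<lambda>l. \<bar>real_of_int l\<bar>) ` B))"
  have A: "\<bar>real_of_int l\<bar> \<le> A" if "l \<in> B" for l unfolding A_def using finB that by (intro Max_ge) auto
  \<comment> \<open>Twice the Lipschitz constant of the tails times the largest old frequency, so
    that the tail transform drops by at most 1/2 from its value at 0.\<close>
  obtain N where N: "\<And>n. n \<ge> N \<Longrightarrow> 8 * pi * C * A \<le> pprod p n" using pprod_exceeds by blast
  have "\<exists>n>max m N. n \<in> {n. equi_level \<epsilon> n}" using inf unfolding infinite_nat_iff_unbounded by blast
  then obtain m' where m': "m' > max m N" "equi_level \<epsilon> m'" by blast
  let ?P = "pprod p m'"
  have P: "?P > 0" by (rule pprod_pos)
  obtain B2 where B2: "B \<subseteq> B2" "parseval_set m' B2" using parseval_extend[OF had B, of m'] m' by auto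
  have "\<exists>k::int. \<epsilon> \<le> cmod (fourier (moran_tail p D m') (of_int l / ?P + of_int k)) \<and> (l \<in> B \<longrightarrow> k = 0)" for l
  proof (cases "l \<in> B")
    case True
    have "\<bar>of_int l / ?P\<bar> = \<bar>of_int l\<bar> / ?P" using P by (simp add: abs_divide)
    also have "\<dots> \<le> A / ?P" using A[OF True] P by (intro divide_right_mono) auto
    finally have "4 * pi * C * \<bar>of_int l / ?P\<bar> \<le> 4 * pi * C * (A / ?P)"
      using C_nonneg by (intro mult_left_mono) auto
    also have "\<dots> \<le> 1 / 2"
    proof -
      have "8 * pi * C * A \<le> ?P" using N m' by simp
      hence "8 * pi * C * A / ?P \<le> 1" using P by (subst divide_le_eq_1_pos)
      thus ?thesis by simp
    qed
    finally show ?thesis using fourier_tail_near_0[where n = m' and a = "of_int l / ?P"] e by (intro exI[of _ 0]) auto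
  next
    case False
    have "frac (of_int l / ?P) \<in> {0..<1}" by (simp add: frac_ge_0 frac_lt_1)
    then obtain k :: int where "\<epsilon> \<le> cmod (fourier (moran_tail p D m') (frac (of_int l / ?P) + of_int k))"
      using m'(2) unfolding equi_level_def attains_def by blast
    thus ?thesis using False by (intro exI[of _ "k - \<lfloor>of_int l / ?P\<rfloor>"]) (simp add: frac_def algebra_simps)
  qed
  then obtain k :: "int \<Rightarrow> int" where k: "\<And>l. \<epsilon> \<le> cmod (fourier (moran_tail p D m') (of_int l / ?P + of_int (k l)))"
    "\<And>l. l \<in> B \<Longrightarrow> k l = 0" by metis
  define f where "f l = l + (\<Prod>i\<in>{1..m'}. int (p i)) * k l" for l
  have fr: "real_of_int (f l) = of_int l + ?P * of_int (k l)" for l by (simp add: f_def pprod_of_int)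
  have "parseval_set m' (f ` B2)"
  proof (rule parseval_image)
    fix \<xi>
    show "(\<Sum>i\<in>B2. (cmod (mprod p D m' (\<xi> + of_int (f i))))\<^sup>2) = 1"
      using B2(2) by (simp add: parseval_set_def fr mprod_periodic flip: add.assoc)
  qed (use B2 in \<open>simp add: parseval_set_def\<close>)
  moreover have "B \<subseteq> f ` B2"
  proof
    fix l assume "l \<in> B"
    thus "l \<in> f ` B2" using B2(1) k(2) by (intro image_eqI[of _ _ l]) (auto simp: f_def)
  qed
  moreover have "\<forall>l\<in>f ` B2. \<epsilon> \<le> cmod (fourier (moran_tail p D m') (of_int l / ?P))"
  proof safe
    fix l assume "l \<in> B2"
    have "of_int (f l) / ?P = of_int l / ?P + of_int (k l)" using P by (simp add: fr add_divide_distrib)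
    thus "\<epsilon> \<le> cmod (fourier (moran_tail p D m') (of_int (f l) / ?P))" using k(1)[of l] by simp
  qed
  ultimately show ?thesis using m' by (intro exI[of _ m'] exI[of _ "f ` B2"]) auto
qed

text \<open>Split the Parseval sum of level m_k into B_j and the rest. On B_j the masks converge to
  the limit transform F; on the rest they are dominated by 4/\<epsilon>^2 times |F|^2, whose sum is
  at most S - a_j, where S is the limit of the partial sums a_j. Letting k and then j grow gives S
  \<ge> 1.\<close>

theorem spectral_of_equi_levels:
  assumes had: "\<And>n. n \<ge> 1 \<Longrightarrow> \<exists>L. hadamard_triple (p n) (D n) L"
    and inf: "infinite {n. equi_level \<epsilon> n}" and e: "0 < \<epsilon>" "\<epsilon> \<le> 1 / 2"
  shows "spectral_measure (moran p D)"
proof -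
  define Good where "Good x \<longleftrightarrow> parseval_set (fst x) (snd x) \<and>
    (\<forall>l\<in>snd x. \<epsilon> \<le> cmod (fourier (moran_tail p D (fst x)) (of_int l / pprod p (fst x))))" for x
  have "\<exists>g. \<forall>n. Good (g n) \<and> fst (g n) < fst (g (Suc n)) \<and> snd (g n) \<subseteq> snd (g (Suc n))"
  proof (rule dependent_nat_choice[of "\<lambda>_. Good" "\<lambda>_ x y. fst x < fst y \<and> snd x \<subseteq> snd y"])
    have "Good (0, {0})" using e by (simp add: Good_def parseval_set_def fourier_tail_0)
    thus "\<exists>x. Good x" ..
    fix x assume "Good x"
    hence "parseval_set (fst x) (snd x)" by (simp add: Good_def)
    from parseval_next[OF had inf e(2) this]
    show "\<exists>y. Good y \<and> fst x < fst y \<and> snd x \<subseteq> snd y" by (auto simp: Good_def)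
  qed
  then obtain g where g: "\<And>n. Good (g n)" "\<And>n. fst (g n) < fst (g (Suc n))" "\<And>n. snd (g n) \<subseteq> snd (g (Suc n))"
    by blast
  define m where "m k = fst (g k)" for k
  define B where "B k = snd (g k)" for k
  have Bp: "parseval_set (m k) (B k)" and Be: "\<And>l. l \<in> B k \<Longrightarrow> \<epsilon> \<le> cmod (fourier (moran_tail p D (m k)) (of_int l / pprod p (m k)))" for k
    using g(1)[of k] by (auto simp: Good_def m_def B_def)
  have msm: "strict_mono m" using g(2) by (simp add: m_def strict_mono_Suc_iff)
  have Bmono: "B j \<subseteq> B k" if "j \<le> k" for j k
    using that by (rule lift_Suc_mono_le[of B, rotated]) (simp add: B_def g(3))
  have finB: "finite (B k)" for k using Bp by (simp add: parseval_set_def)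
  interpret real_distribution "moran p D" by (rule real_distribution_moran)
  let ?F = "fourier (moran p D)"
  have le: "cmod (?F \<xi>) \<le> cmod (mprod p D n \<xi>)" for \<xi> n
    unfolding fourier_split[of \<xi> n] norm_mult
    using real_distribution.norm_fourier_le[OF real_distribution_tail] by (intro mult_right_le_one_le) auto
  show ?thesis
  proof (rule spectral_criterion[where B = "\<lambda>k. real_of_int ` B k"])
    fix k a b assume ab: "a \<in> real_of_int ` B k" "b \<in> real_of_int ` B k" "a \<noteq> b"
    then obtain i j where ij: "i \<in> B k" "j \<in> B k" "i \<noteq> j" "a = of_int i" "b = of_int j" by auto
    have "cmod (?F (a - b)) \<le> 0"
      using le[of "a - b" "m k"] parseval_orthogonal[OF Bp ij(1-3)] by (simp add: ij)
    thus "?F (a - b) = 0" by simp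
  next
    fix \<xi> :: real
    define a where "a k = (\<Sum>l\<in>B k. (cmod (?F (\<xi> + of_int l)))\<^sup>2)" for k
    have inc: "a j \<le> a k" if "j \<le> k" for j k
      unfolding a_def using Bmono[OF that] finB by (intro sum_mono2) auto
    have a1: "a k \<le> 1" for k
    proof -
      have "a k \<le> (\<Sum>l\<in>B k. (cmod (mprod p D (m k) (\<xi> + of_int l)))\<^sup>2)"
        unfolding a_def by (intro sum_mono power_mono le) auto
      thus ?thesis using Bp[of k] by (simp add: parseval_set_def)
    qed
    have "\<exists>S. a \<longlonglongrightarrow> S \<and> (\<forall>k. a k \<le> S)"
      by (rule incseq_convergent[of a 1]) (use inc a1 in \<open>auto simp: incseq_def\<close>)
    then obtain S where S: "a \<longlonglongrightarrow> S" "\<And>k. a k \<le> S" by blast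
    have S1: "S \<le> 1" using LIMSEQ_le_const2[OF S(1)] a1 by blast
    obtain N where N: "\<And>n. n \<ge> N \<Longrightarrow> 8 * pi * C * \<bar>\<xi>\<bar> / \<epsilon> \<le> pprod p n" using pprod_exceeds by blast
    \<comment> \<open>The tail factor is at least \<epsilon> at l / P; the shift by \<xi> / P costs
      at most \<epsilon>/2 once k is large. Squaring the remaining \<epsilon>/2 gives the factor
      4/\<epsilon>^2.\<close>
    have low: "(cmod (mprod p D (m k) (\<xi> + of_int l)))\<^sup>2 \<le> (4 / \<epsilon>\<^sup>2) * (cmod (?F (\<xi> + of_int l)))\<^sup>2"
      if k: "k \<ge> N" and l: "l \<in> B k" for k l
    proof -
      let ?P = "pprod p (m k)"
      have P: "?P > 0" by (rule pprod_pos)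
      have "m k \<ge> N" using k seq_suble[OF msm, of k] by simp
      hence "8 * pi * C * \<bar>\<xi>\<bar> / \<epsilon> \<le> ?P" by (rule N)
      hence "4 * pi * C * \<bar>\<xi>\<bar> / ?P \<le> \<epsilon> / 2" using e P by (simp add: field_simps)
      moreover have "cmod (fourier (moran_tail p D (m k)) (of_int l / ?P) - fourier (moran_tail p D (m k)) ((\<xi> + of_int l) / ?P))
           \<le> 4 * pi * C * \<bar>\<xi>\<bar> / ?P"
        using fourier_tail_lipschitz[of "m k" "of_int l / ?P" "(\<xi> + of_int l) / ?P"] P by (simp add: add_divide_distrib)
      moreover have "cmod (fourier (moran_tail p D (m k)) (of_int l / ?P)) - cmod (fourier (moran_tail p D (m k)) ((\<xi> + of_int l) / ?P))
          \<le> cmod (fourier (moran_tail p D (m k)) (of_int l / ?P) - fourier (moran_tail p D (m k)) ((\<xi> + of_int l) / ?P))"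
        by (rule norm_triangle_ineq2)
      ultimately have "\<epsilon> / 2 \<le> cmod (fourier (moran_tail p D (m k)) ((\<xi> + of_int l) / ?P))"
        using Be[OF l] by linarith
      hence "cmod (mprod p D (m k) (\<xi> + of_int l)) * (\<epsilon> / 2) \<le> cmod (?F (\<xi> + of_int l))"
        unfolding fourier_split[of _ "m k"] norm_mult by (rule mult_left_mono) simp
      hence "(cmod (mprod p D (m k) (\<xi> + of_int l)) * (\<epsilon> / 2))\<^sup>2 \<le> (cmod (?F (\<xi> + of_int l)))\<^sup>2"
        using e by (intro power_mono) auto
      thus ?thesis using e by (simp add: power_mult_distrib field_simps)
    qed
    have key: "1 \<le> a j + (4 / \<epsilon>\<^sup>2) * (S - a j)" for j
    proof (rule LIMSEQ_le_const)
      show "(\<lambda>k. (\<Sum>l\<in>B j. (cmod (mprod p D (m k) (\<xi> + of_int l)))\<^sup>2) + (4 / \<epsilon>\<^sup>2) * (S - a j))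
          \<longlonglongrightarrow> a j + (4 / \<epsilon>\<^sup>2) * (S - a j)"
        unfolding a_def
        by (intro tendsto_add tendsto_sum tendsto_const tendsto_power tendsto_norm)
           (use LIMSEQ_subseq_LIMSEQ[OF fourier_moran_lim msm] in \<open>simp add: o_def\<close>)
      show "\<exists>K. \<forall>k\<ge>K. 1 \<le> (\<Sum>l\<in>B j. (cmod (mprod p D (m k) (\<xi> + of_int l)))\<^sup>2) + (4 / \<epsilon>\<^sup>2) * (S - a j)"
      proof (intro exI[of _ "max N j"] allI impI)
        fix k assume k: "k \<ge> max N j"
        have sub: "B j \<subseteq> B k" using Bmono k by simp
        have "1 = (\<Sum>l\<in>B k. (cmod (mprod p D (m k) (\<xi> + of_int l)))\<^sup>2)"
          using Bp[of k] by (simp add: parseval_set_def)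
        also have "\<dots> = (\<Sum>l\<in>B k - B j. (cmod (mprod p D (m k) (\<xi> + of_int l)))\<^sup>2) + (\<Sum>l\<in>B j. (cmod (mprod p D (m k) (\<xi> + of_int l)))\<^sup>2)"
          by (rule sum.subset_diff[OF sub finB])
        also have "(\<Sum>l\<in>B k - B j. (cmod (mprod p D (m k) (\<xi> + of_int l)))\<^sup>2)
            \<le> (\<Sum>l\<in>B k - B j. (4 / \<epsilon>\<^sup>2) * (cmod (?F (\<xi> + of_int l)))\<^sup>2)"
          using k by (intro sum_mono low) auto
        also have "\<dots> = (4 / \<epsilon>\<^sup>2) * (\<Sum>l\<in>B k - B j. (cmod (?F (\<xi> + of_int l)))\<^sup>2)"
          by (rule sum_distrib_left[symmetric])
        also have "(\<Sum>l\<in>B k - B j. (cmod (?F (\<xi> + of_int l)))\<^sup>2) = a k - a j"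
          unfolding a_def using sum.subset_diff[OF sub finB, of "\<lambda>l. (cmod (?F (\<xi> + of_int l)))\<^sup>2"]
          by linarith
        also have "(4 / \<epsilon>\<^sup>2) * (a k - a j) \<le> (4 / \<epsilon>\<^sup>2) * (S - a j)" using S(2)[of k] by (intro mult_left_mono) auto
        finally show "1 \<le> (\<Sum>l\<in>B j. (cmod (mprod p D (m k) (\<xi> + of_int l)))\<^sup>2) + (4 / \<epsilon>\<^sup>2) * (S - a j)" by simp
      qed
    qed
    have "(\<lambda>j. a j + (4 / \<epsilon>\<^sup>2) * (S - a j)) \<longlonglongrightarrow> S + (4 / \<epsilon>\<^sup>2) * (S - S)"
      by (intro tendsto_add tendsto_mult tendsto_diff tendsto_const S(1))
    hence "1 \<le> S + (4 / \<epsilon>\<^sup>2) * (S - S)" by (rule LIMSEQ_le_const) (use key in blast)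
    hence "S = 1" using S1 by simp
    hence "a \<longlonglongrightarrow> 1" using S(1) by simp
    thus "(\<lambda>k. \<Sum>l\<in>real_of_int ` B k. (cmod (?F (\<xi> + l)))\<^sup>2) \<longlonglongrightarrow> 1"
      by (simp add: a_def[abs_def] sum.reindex inj_on_def)
  next
    fix j k :: nat assume "j \<le> k"
    thus "real_of_int ` B j \<subseteq> real_of_int ` B k" by (intro image_mono Bmono)
  qed (use finB in auto)
qed

end

section \<open>Splitting of points\<close>

text \<open>Compactness: the sum \<phi> of products of masks over pairs of distinct translates is
  continuous, and by \<open>exists_two_nonzero_iff\<close> it is positive on the closed set of
  admissible points in [0, 1]. The condition on l1 - l2 says that the two descendants differ modulo
  1.\<close>

lemma doubling:
  assumes H: "hadamard_triple p D L" and z: "0 \<in> D" and d: "\<delta> > 0"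
  shows "\<exists>c>0. \<forall>x. (card D < p \<or> (\<forall>m::int. \<delta> \<le> \<bar>x - of_int m / of_int (Gcd D)\<bar>)) \<longrightarrow>
    (\<exists>l1 l2::int. \<not> int p dvd l1 - l2 \<and> c \<le> cmod (dmask D ((x + of_int l1) / real p)) \<and>
       c \<le> cmod (dmask D ((x + of_int l2) / real p)))"
proof -
  define Q where "Q x \<longleftrightarrow> card D < p \<or> (\<forall>m::int. \<delta> \<le> \<bar>x - of_int m / of_int (Gcd D)\<bar>)" for x
  define A where "A l x = cmod (dmask D ((x + of_int l) / real p))" for l :: int and x
  have p: "p > 1" using hadamardD[OF H] by simp
  have A1: "A l x \<le> 1" "A l x \<ge> 0" for l x by (simp_all add: A_def norm_dmask_le)
  let ?I = "SIGMA l1:{0..<int p}. {0..<int p} - {l1}"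
  define \<phi> where "\<phi> x = (\<Sum>(l1, l2)\<in>?I. A l1 x * A l2 x)" for x
  have finI: "finite ?I" by auto
  have cont: "continuous_on UNIV \<phi>"
    unfolding \<phi>_def A_def case_prod_beta by (intro continuous_intros) (use p in auto)
  have pos: "\<phi> x > 0" if Qx: "Q x" for x
  proof -
    have "card D < p \<or> of_int (Gcd D) * x \<notin> \<int>"
    proof (rule ccontr)
      assume "\<not> ?thesis"
      hence c: "card D = p" and "of_int (Gcd D) * x \<in> \<int>" using hadamard_card_le[OF H] by auto
      then obtain i where i: "of_int (Gcd D) * x = of_int i" by (elim Ints_cases)
      have "Gcd D \<noteq> 0"
      proof
        assume "Gcd D = 0"
        hence "D \<subseteq> {0}" by (simp add: Gcd_0_iff)
        hence "card D \<le> 1" using card_mono[of "{0}" D] by simp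
        thus False using c p by simp
      qed
      hence "x = of_int i / of_int (Gcd D)" using i by (simp add: field_simps)
      moreover have "\<delta> \<le> \<bar>x - of_int i / of_int (Gcd D)\<bar>" using Qx c by (simp add: Q_def)
      ultimately show False using d by simp
    qed
    from this[folded exists_two_nonzero_iff[OF H z, of x]]
    obtain l1 l2 where l: "(l1, l2) \<in> ?I" "A l1 x > 0" "A l2 x > 0" unfolding A_def by auto
    have "0 < A l1 x * A l2 x" using l by simp
    also have "\<dots> \<le> \<phi> x" unfolding \<phi>_def
      using member_le_sum[OF l(1), of "\<lambda>(l1, l2). A l1 x * A l2 x"] A1 finI by auto
    finally show ?thesis .
  qed
  define S where "S = {0..1} \<inter> {x. Q x}"
  have "closed {x. Q x}"
  proof -
    have "closed (\<Inter>m::int. {x::real. \<delta> \<le> \<bar>x - of_int m / of_int (Gcd D)\<bar>})"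
      by (intro closed_INT ballI closed_Collect_le continuous_intros)
    moreover have "{x. Q x} = (if card D < p then UNIV else (\<Inter>m::int. {x::real. \<delta> \<le> \<bar>x - of_int m / of_int (Gcd D)\<bar>}))"
      by (auto simp: Q_def)
    ultimately show ?thesis by auto
  qed
  hence compS: "compact S" unfolding S_def by (intro compact_Int_closed) auto
  have "\<exists>\<mu>>0. \<forall>x\<in>S. \<mu> \<le> \<phi> x"
  proof (cases "S = {}")
    case False
    then obtain x0 where "x0 \<in> S" "\<forall>x\<in>S. \<phi> x0 \<le> \<phi> x"
      using continuous_attains_inf[OF compS _ continuous_on_subset[OF cont]] by blast
    thus ?thesis using pos[of x0] by (auto simp: S_def)
  qed (auto intro: exI[of _ 1])
  then obtain \<mu> where \<mu>: "\<mu> > 0" "\<And>x. x \<in> S \<Longrightarrow> \<mu> \<le> \<phi> x" by blast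
  have I0: "card ?I > 0" using finI p by (auto simp: card_gt_0_iff intro!: exI[of _ 0] exI[of _ 1])
  define c where "c = \<mu> / (2 * real (card ?I))"
  have c0: "c > 0" using \<mu> I0 by (simp add: c_def)
  show ?thesis
  proof (intro exI[of _ c] conjI allI impI c0)
    fix x assume "card D < p \<or> (\<forall>m::int. \<delta> \<le> \<bar>x - of_int m / of_int (Gcd D)\<bar>)"
    hence Qx: "Q x" by (simp add: Q_def)
    \<comment> \<open>Admissibility is 1-periodic because (1/g)Z contains the integers.\<close>
    have Qf: "Q (frac x)"
    proof (cases "card D < p")
      case False
      hence *: "\<delta> \<le> \<bar>x - of_int m / of_int (Gcd D)\<bar>" for m :: int using Qx by (simp add: Q_def)
      have "\<delta> \<le> \<bar>frac x - of_int m / of_int (Gcd D)\<bar>" for m :: int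
      proof (cases "Gcd D = 0")
        case True
        hence "D \<subseteq> {0}" by (simp add: Gcd_0_iff)
        hence "card D \<le> 1" using card_mono[of "{0}" D] by simp
        thus ?thesis using False p by simp
      next
        case gnz: False
        have "frac x - of_int m / of_int (Gcd D) = x - of_int (m + \<lfloor>x\<rfloor> * Gcd D) / of_int (Gcd D)"
          using gnz by (simp add: frac_def add_divide_distrib)
        thus ?thesis using *[of "m + \<lfloor>x\<rfloor> * Gcd D"] by simp
      qed
      thus ?thesis by (simp add: Q_def)
    qed (simp add: Q_def)
    have fS: "frac x \<in> S" using Qf frac_lt_1[of x] by (simp add: S_def frac_ge_0)
    have "\<exists>i\<in>?I. c \<le> (case i of (l1, l2) \<Rightarrow> A l1 (frac x) * A l2 (frac x))"
    proof (rule ccontr)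
      assume "\<not> ?thesis"
      hence "\<phi> (frac x) \<le> (\<Sum>i\<in>?I. c)" unfolding \<phi>_def by (intro sum_mono) force
      also have "\<dots> < \<mu>" using \<mu> I0 by (simp add: c_def)
      finally show False using \<mu>(2)[OF fS] by simp
    qed
    then obtain i where i: "i \<in> ?I" "c \<le> (case i of (l1, l2) \<Rightarrow> A l1 (frac x) * A l2 (frac x))" by blast
    obtain l1 l2 where "i = (l1, l2)" by (cases i)
    with i have l: "l1 \<in> {0..<int p}" "l2 \<in> {0..<int p}" "l1 \<noteq> l2" "c \<le> A l1 (frac x) * A l2 (frac x)"
      by simp_all
    \<comment> \<open>Both factors are at most 1, so a bound below for the product bounds each of
      them.\<close>
    have "A l1 (frac x) * A l2 (frac x) \<le> A l1 (frac x)" "A l1 (frac x) * A l2 (frac x) \<le> A l2 (frac x)"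
      using A1 by (auto intro: mult_right_le_one_le mult_left_le_one_le)
    hence cl: "c \<le> A l1 (frac x)" "c \<le> A l2 (frac x)" using l by auto
    have sh: "(x + of_int (l - \<lfloor>x\<rfloor>)) = frac x + of_int l" for l by (simp add: frac_def)
    have "\<not> int p dvd l1 - l2"
    proof
      assume "int p dvd l1 - l2"
      hence "l1 mod int p = l2 mod int p" by (simp add: mod_eq_dvd_iff)
      thus False using l by simp
    qed
    thus "\<exists>l1 l2::int. \<not> int p dvd l1 - l2 \<and> c \<le> cmod (dmask D ((x + of_int l1) / real p)) \<and>
       c \<le> cmod (dmask D ((x + of_int l2) / real p))"
      using cl by (intro exI[of _ "l1 - \<lfloor>x\<rfloor>"] exI[of _ "l2 - \<lfloor>x\<rfloor>"]) (simp only: sh, simp add: A_def)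
  qed
qed

text \<open>Squared masks over #D translates sum to 1, and a mask of modulus at most 1 dominates its
  square. This carries along those points of a family that are not the one being split.\<close>

lemma single_child:
  assumes H: "hadamard_triple p D L" and ne: "D \<noteq> {}"
  shows "\<exists>l::int. 1 / real (card D) \<le> cmod (dmask D ((x + of_int l) / real p))"
proof (rule ccontr)
  assume "\<not> ?thesis"
  hence lt: "cmod (dmask D ((x + of_int l) / real p)) < 1 / real (card D)" for l :: int by (simp add: not_le)
  have N: "card D > 0" "card L = card D" using hadamardD[OF H] ne by (auto simp: card_gt_0_iff)
  have "(\<Sum>l\<in>L. (cmod (dmask D ((x + of_int l) / real p)))\<^sup>2) < (\<Sum>l\<in>L. 1 / real (card D))"
  proof (rule sum_strict_mono)
    fix l assume "l \<in> L"
    let ?a = "cmod (dmask D ((x + of_int l) / real p))"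
    have "?a\<^sup>2 \<le> ?a" using norm_dmask_le by (simp add: power2_eq_square mult_left_le_one_le)
    thus "?a\<^sup>2 < 1 / real (card D)" using lt[of l] by linarith
  qed (use hadamardD[OF H] N in auto)
  also have "\<dots> = 1" using N by simp
  finally show False using hadamard_dmask_sum[OF H ne, of x] by simp
qed

text \<open>Greedy choice: taking the minimum and discarding the window of length s above it costs
  at most s elements.\<close>

lemma spread_subset:
  fixes X :: "nat set"
  assumes "finite X" "K * s \<le> card X" "s > 0"
  shows "\<exists>Y\<subseteq>X. card Y = K \<and> (\<forall>a\<in>Y. \<forall>b\<in>Y. a < b \<longrightarrow> a + s \<le> b)"
  using assms
proof (induction K arbitrary: X)
  case (Suc K)
  define a where "a = Min X"
  have ne: "X \<noteq> {}" using Suc.prems by auto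
  define X' where "X' = X - {a..<a + s}"
  have "card (X \<inter> {a..<a + s}) \<le> s" using card_mono[of "{a..<a + s}" "X \<inter> {a..<a + s}"] by simp
  hence "card X \<le> card X' + s" using card_Diff_subset_Int[of X "{a..<a + s}"] Suc.prems(1) by (simp add: X'_def)
  hence "K * s \<le> card X'" using Suc.prems by simp
  then obtain Y where Y: "Y \<subseteq> X'" "card Y = K" "\<forall>a\<in>Y. \<forall>b\<in>Y. a < b \<longrightarrow> a + s \<le> b"
    using Suc.IH[of X'] Suc.prems by (auto simp: X'_def)
  have aX: "a \<in> X" using ne Suc.prems by (simp add: a_def)
  have far: "a + s \<le> b" if "b \<in> Y" for b
  proof -
    have "b \<in> X" "b \<notin> {a..<a + s}" using that Y by (auto simp: X'_def)
    moreover have "a \<le> b" using \<open>b \<in> X\<close> Suc.prems by (simp add: a_def)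
    ultimately show ?thesis by auto
  qed
  have "finite Y" using Y Suc.prems by (auto simp: X'_def intro: finite_subset)
  moreover have "a \<notin> Y" using far[of a] Suc.prems(3) by auto
  ultimately have "card (insert a Y) = Suc K" using Y by simp
  moreover have "insert a Y \<subseteq> X" using aX Y by (auto simp: X'_def)
  moreover have "\<forall>c\<in>insert a Y. \<forall>b\<in>insert a Y. c < b \<longrightarrow> c + s \<le> b"
    using Y(3) far by fastforce
  ultimately show ?case by blast
qed auto

section \<open>Transferring lower bounds from descendants to their ancestors\<close>

context moran_system begin

lemma attains_add_int: "attains n e (x + of_int j) \<longleftrightarrow> attains n e x"
proof
  assume "attains n e (x + of_int j)"
  then obtain k :: int where "e \<le> cmod (fourier (moran_tail p D n) (x + of_int (j + k)))"
    unfolding attains_def by (auto simp: add.assoc)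
  thus "attains n e x" unfolding attains_def by blast
next
  assume "attains n e x"
  then obtain k :: int where k: "e \<le> cmod (fourier (moran_tail p D n) (x + of_int k))"
    unfolding attains_def by blast
  have "x + of_int j + of_int (k - j) = x + of_int k" by simp
  thus "attains n e (x + of_int j)" unfolding attains_def using k by metis
qed

lemma attains_frac: "attains n e (frac x) \<longleftrightarrow> attains n e x"
  using attains_add_int[of n e "frac x" "\<lfloor>x\<rfloor>"] by (simp add: frac_def)

lemma attains_mono: "attains n e x \<Longrightarrow> e' \<le> e \<Longrightarrow> attains n e' x"
  unfolding attains_def by (meson order_trans)

lemma attains_near_Ints:
  assumes "4 * pi * C * \<bar>x + of_int m\<bar> \<le> 1 / 2"
  shows "attains n (1 / 2) x"
  unfolding attains_def using assms fourier_tail_near_0[where n = n and a = "x + of_int m"]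
  by (intro exI[of _ m]) linarith

text \<open>A translate j at the lower level pulls back to the translate l + P j above, and the k
  skipped masks do not see P j by periodicity.\<close>

lemma attains_jump:
  assumes "attains (n + k) e ((x + of_int l) / pprod (\<lambda>i. p (n + i)) k)"
  shows "attains n (cmod (mprod (\<lambda>i. p (n + i)) (\<lambda>i. D (n + i)) k (x + of_int l)) * e) x"
proof -
  let ?P = "pprod (\<lambda>i. p (n + i)) k" and ?m = "mprod (\<lambda>i. p (n + i)) (\<lambda>i. D (n + i)) k"
  have P: "?P > 0" by (rule moran_system.pprod_pos[OF shift])
  obtain j :: int where j: "e \<le> cmod (fourier (moran_tail p D (n + k)) ((x + of_int l) / ?P + of_int j))"
    using assms unfolding attains_def by blast
  define i where "i = l + (\<Prod>i\<in>{1..k}. int (p (n + i))) * j"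
  have i: "x + of_int i = (x + of_int l) + ?P * of_int j"
    by (simp add: i_def pprod_def)
  have "fourier (moran_tail p D n) (x + of_int i) =
      ?m (x + of_int l) * fourier (moran_tail p D (n + k)) ((x + of_int l) / ?P + of_int j)"
    unfolding fourier_tail_split[of n _ k] i moran_system.mprod_periodic[OF shift Ints_of_int]
    using P by (simp add: add_divide_distrib)
  hence "cmod (?m (x + of_int l)) * e \<le> cmod (fourier (moran_tail p D n) (x + of_int i))"
    using j by (simp add: norm_mult mult_left_mono)
  thus ?thesis unfolding attains_def by blast
qed

lemma attains_step:
  assumes "attains (Suc n) e ((x + of_int l) / real (p (Suc n)))"
    and "c \<le> cmod (dmask (D (Suc n)) ((x + of_int l) / real (p (Suc n))))" "e \<ge> 0"
  shows "attains n (c * e) x"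
proof (rule attains_mono)
  have 1: "pprod (\<lambda>i. p (n + i)) 1 = real (p (Suc n))"
    "mprod (\<lambda>i. p (n + i)) (\<lambda>i. D (n + i)) 1 (x + of_int l) = dmask (D (Suc n)) ((x + of_int l) / real (p (Suc n)))"
    by (simp_all add: pprod_def mprod_def)
  show "attains n (cmod (dmask (D (Suc n)) ((x + of_int l) / real (p (Suc n)))) * e) x"
    using attains_jump[of n 1 e x l] assms(1) unfolding 1 by simp
qed (use assms in \<open>simp add: mult_right_mono\<close>)

end

context moran_system begin

text \<open>A point within \<open>\<eta>\<close> of a rational u that is invisible to all digit sets between levels n and t
  can be transported from n to t in one step, because u contributes nothing to the masks.\<close>

lemma attains_transport:
  fixes u \<eta> :: real and G :: int
  assumes had: "\<And>j. n < j \<Longrightarrow> j \<le> n + k \<Longrightarrow> \<exists>L. hadamard_triple (p j) (D j) L"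
    and full: "\<And>j. n < j \<Longrightarrow> j \<le> n + k \<Longrightarrow> card (D j) = p j \<and> of_int (Gcd (D j)) * u \<in> \<int>"
    and G: "G \<noteq> 0" "of_int G * u \<in> \<int>"
  obtains u' where "of_int G * u' \<in> \<int>" "pprod (\<lambda>i. p (n + i)) k * u' - u \<in> \<int>"
    "\<And>e. e \<ge> 0 \<Longrightarrow> attains (n + k) e (u' + \<eta> / pprod (\<lambda>i. p (n + i)) k) \<Longrightarrow>
       attains n ((1 - 4 * pi * C * \<bar>\<eta>\<bar>) * e) (u + \<eta>)"
proof -
  let ?p = "\<lambda>i. p (n + i)" and ?D = "\<lambda>i. D (n + i)"
  let ?P = "pprod ?p k"
  have P: "?P > 0" by (rule moran_system.pprod_pos[OF shift])
  \<comment> \<open>The denominator b of u divides every skipped gcd, so it is prime to every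
    skipped modulus and u can be lifted through all k levels by a single congruence modulo their
    product.\<close>
  obtain b :: nat where b: "b > 0" "\<And>j::int. of_int j * u \<in> \<int> \<longleftrightarrow> int b dvd j"
    using denominator_ideal[OF G] by metis
  have dvd: "int b dvd Gcd (?D i)" if "i \<in> {1..k}" for i using full[of "n + i"] that b by auto
  have "coprime (int b) (int (?p i))" if i: "i \<in> {1..k}" for i
  proof -
    obtain L where "hadamard_triple (?p i) (?D i) L" using had[of "n + i"] i by auto
    from coprime_Gcd_modulus[OF this] have "coprime (Gcd (?D i)) (int (?p i))" using full[of "n + i"] i by auto
    thus ?thesis using dvd[OF i] coprime_divisors dvd_refl by blast
  qed
  hence cop: "coprime (int b) (\<Prod>i\<in>{1..k}. int (?p i))" by (intro prod_coprime_right)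
  have Pi: "?P = of_int (\<Prod>i\<in>{1..k}. int (?p i))" by (simp add: pprod_def)
  have Pi0: "(\<Prod>i\<in>{1..k}. int (?p i)) > 0" using P unfolding Pi by (simp only: of_int_0_less_iff)
  have bu: "of_int (int b) * u \<in> \<int>" by (simp only: b(2) dvd_refl)
  obtain l where l: "of_int (int b) * ((u + of_int l) / ?P) \<in> \<int>"
    using coprime_lift[OF cop bu Pi0] unfolding Pi by metis
  define u' where "u' = (u + of_int l) / ?P"
  have Pu: "?P * u' = u + of_int l" using P by (simp add: u'_def)
  have mult: "of_int j * u' \<in> \<int>" if j: "int b dvd j" for j
  proof -
    obtain i where "j = int b * i" using j by (elim dvdE)
    hence "of_int j * u' = of_int i * (of_int (int b) * u')" by simp
    moreover have "of_int (int b) * u' \<in> \<int>" unfolding u'_def by (rule l)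
    ultimately show ?thesis by (metis Ints_mult Ints_of_int)
  qed
  have eq: "mprod ?p ?D k (u + \<eta> + of_int l) = mprod ?p ?D k \<eta>"
    unfolding mprod_def
  proof (rule prod.cong[OF refl])
    fix i assume i: "i \<in> {1..k}"
    \<comment> \<open>The product of the moduli below level i: there the point appears, up to the
      perturbation, as R u', which is still invisible because R is an integer.\<close>
    define R where "R = (\<Prod>j\<in>{i<..k}. real (?p j))"
    have Pi: "pprod ?p i > 0" by (rule moran_system.pprod_pos[OF shift])
    have "{1..k} = {1..i} \<union> {i<..k}" using i by auto
    hence "?P = pprod ?p i * R" unfolding pprod_def R_def
      by (simp only:) (rule prod.union_disjoint, auto)
    hence "(u + \<eta> + of_int l) / pprod ?p i = R * u' + \<eta> / pprod ?p i"
      using Pu Pi by (simp add: field_simps)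
    moreover have "of_int d * (R * u') \<in> \<int>" if d: "d \<in> ?D i" for d
    proof -
      have "int b dvd d" using dvd[OF i] d by (meson Gcd_dvd dvd_trans)
      hence "of_int d * u' \<in> \<int>" by (rule mult)
      moreover have "R \<in> \<int>" unfolding R_def by (intro Ints_prod) auto
      ultimately have "R * (of_int d * u') \<in> \<int>" by (rule Ints_mult[rotated])
      thus ?thesis by (simp add: mult_ac)
    qed
    ultimately show "dmask (?D i) ((u + \<eta> + of_int l) / pprod ?p i) = dmask (?D i) (\<eta> / pprod ?p i)"
      by (simp add: dmask_invisible)
  qed
  show ?thesis
  proof (rule that)
    show "of_int G * u' \<in> \<int>" using G b by (intro mult) blast
    show "?P * u' - u \<in> \<int>" using Pu by simp
    fix e :: real assume e: "e \<ge> 0" and a: "attains (n + k) e (u' + \<eta> / ?P)"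
    have "u' + \<eta> / ?P = (u + \<eta> + of_int l) / ?P" by (simp add: u'_def add_divide_distrib)
    from attains_jump[OF a[unfolded this]]
    have "attains n (cmod (mprod ?p ?D k \<eta>) * e) (u + \<eta>)" by (simp only: eq)
    \<comment> \<open>The skipped masks are compared with 1 as one partial transform, so the loss
      depends on \<eta> and not on k.\<close>
    moreover have "1 - 4 * pi * C * \<bar>\<eta>\<bar> \<le> cmod (mprod ?p ?D k \<eta>)"
    proof -
      have "1 \<le> cmod (mprod ?p ?D k \<eta>) + cmod (mprod ?p ?D k \<eta> - 1)"
        using norm_triangle_ineq4[of "mprod ?p ?D k \<eta>" "mprod ?p ?D k \<eta> - 1"] by simp
      thus ?thesis using moran_system.mprod_near_1[OF shift, of n k \<eta>] by simp
    qed
    ultimately show "attains n ((1 - 4 * pi * C * \<bar>\<eta>\<bar>) * e) (u + \<eta>)"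
      using e by (elim attains_mono) (rule mult_right_mono)
  qed
qed

end

text \<open>Distance on the circle of reals modulo 1, with arbitrary real representatives; indices
  identify each point with its successor as the family moves down.\<close>

definition circle_separated :: "real \<Rightarrow> nat \<Rightarrow> (nat \<Rightarrow> real) \<Rightarrow> bool" where
  "circle_separated \<sigma> j y \<longleftrightarrow> (\<forall>i<j. \<forall>k<j. i \<noteq> k \<longrightarrow> (\<forall>m::int. \<sigma> \<le> \<bar>y i - y k + of_int m\<bar>))"

text \<open>A point invisible from level n on would be mapped into the integers by the gcd of all
  later digit gcds; if that gcd is 1, the point is an integer.\<close>

lemma eventually_visible:
  fixes D :: "nat \<Rightarrow> int set" and p :: "nat \<Rightarrow> nat" and u :: real
  assumes dense: "infinite {j. j \<ge> 1 \<and> p j > card (D j)} \<or> (\<forall>n\<ge>1. Gcd ((\<lambda>j. Gcd (D j)) ` {n..}) = 1)"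
    and n: "n \<ge> 1" and u: "u \<notin> \<int>"
  shows "\<exists>k\<ge>n. card (D k) < p k \<or> of_int (Gcd (D k)) * u \<notin> \<int>"
  using dense
proof
  assume "infinite {j. j \<ge> 1 \<and> p j > card (D j)}"
  hence "\<exists>j>n. j \<in> {j. j \<ge> 1 \<and> p j > card (D j)}" unfolding infinite_nat_iff_unbounded by blast
  thus ?thesis by (auto intro: less_imp_le)
next
  assume "\<forall>n\<ge>1. Gcd ((\<lambda>j. Gcd (D j)) ` {n..}) = 1"
  hence g: "Gcd ((\<lambda>j. Gcd (D j)) ` {n..}) = 1" using n by simp
  show ?thesis
  proof (rule ccontr)
    assume "\<not> ?thesis"
    hence "of_int (Gcd (D k)) * u \<in> \<int>" if "k \<ge> n" for k using that by blast
    hence "of_int (Gcd ((\<lambda>j. Gcd (D j)) ` {n..})) * u \<in> \<int>" by (intro Gcd_times_in_Ints) auto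
    thus False using u g by simp
  qed
qed

text \<open>\<open>G\<close> is a common multiple of the gcds at all full levels, so the exceptional
  lattices (1/g)Z all lie in the single lattice (1/G)Z. \<open>Pmax\<close> leaves finitely many
  digit sets.\<close>

locale bounded_hadamard_moran = moran_system +
  fixes L :: "nat \<Rightarrow> int set" and Pmax :: nat and G :: int
  assumes had: "n \<ge> 1 \<Longrightarrow> hadamard_triple (p n) (D n) (L n)"
    and p_le: "n \<ge> 1 \<Longrightarrow> p n \<le> Pmax"
    and G_pos: "G > 0"
    and Gcd_dvd_G: "n \<ge> 1 \<Longrightarrow> card (D n) = p n \<Longrightarrow> Gcd (D n) dvd G"
    and dense: "infinite {j. j \<ge> 1 \<and> p j > card (D j)} \<or>
               (\<forall>n\<ge>1. Gcd ((\<lambda>j. Gcd (D j)) ` {n..}) = 1)"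
begin

lemma card_less_or_full: "n \<ge> 1 \<Longrightarrow> card (D n) < p n \<or> card (D n) = p n"
  using hadamard_card_le[OF had] by (simp add: le_less)

text \<open>The hypothesis of \<open>doubling\<close> at level n + 1, which is the first level that
  the n-th tail contains.\<close>

definition splits :: "real \<Rightarrow> nat \<Rightarrow> real \<Rightarrow> bool" where
  "splits \<delta> n x \<longleftrightarrow> card (D (Suc n)) < p (Suc n) \<or> (\<forall>m::int. \<delta> \<le> \<bar>x - of_int m / of_int (Gcd (D (Suc n)))\<bar>)"

lemma lattice_distance:
  fixes x :: real
  assumes "of_int G * x \<in> \<int>" "x \<noteq> 0"
  shows "1 / of_int G \<le> \<bar>x\<bar>"
proof -
  have "1 \<le> \<bar>of_int G * x\<bar>" using assms G_pos by (intro Ints_nonzero_abs_ge1) auto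
  thus ?thesis using G_pos by (simp add: abs_mult field_simps)
qed

text \<open>A point near an integer gives the bound at once, and a point far from (1/G)Z splits at t
  itself. Otherwise all points are near nonintegral points of (1/G)Z, and the family is transported
  to the first level where one of these is visible or p exceeds #D. Separation survives because
  distinct points of (1/G)Z are at least 1/G apart, of which the perturbations take at most
  half.\<close>

lemma reach_split:
  assumes j: "j \<ge> 1" and sep: "circle_separated \<sigma> j y"
    and \<delta>: "\<delta> > 0" "2 * \<delta> < \<sigma>" "2 * \<delta> \<le> 1 / (2 * of_int G)" "4 * pi * C * \<delta> \<le> 1 / 2"
  shows "(\<exists>i<j. attains t (1 / 2) (y i)) \<or>
    (\<exists>s y' i0. circle_separated (min \<sigma> (1 / (2 * of_int G))) j y' \<and> i0 < j \<and> splits \<delta> s (y' i0) \<and>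
       (\<forall>i<j. \<forall>e>0. attains s e (y' i) \<longrightarrow> attains t (e / 2) (y i)))"
proof (cases "\<exists>i<j. \<exists>m::int. \<bar>y i + of_int m\<bar> \<le> \<delta>")
  case True
  then obtain i m where i: "i < j" "\<bar>y i + of_int m\<bar> \<le> \<delta>" by blast
  have "4 * pi * C * \<bar>y i + of_int m\<bar> \<le> 4 * pi * C * \<delta>" using i C_nonneg by (intro mult_left_mono) auto
  hence "attains t (1 / 2) (y i)" using \<delta> by (intro attains_near_Ints[of _ m]) linarith
  thus ?thesis using i by blast
next
  case far: False
  have sepm: "circle_separated (min \<sigma> (1 / (2 * of_int G))) j y"
    using sep unfolding circle_separated_def by (auto simp: min_le_iff_disj)
  show ?thesis
  proof (cases "\<exists>i<j. \<forall>m::int. \<delta> < \<bar>y i - of_int m / of_int G\<bar>")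
    case True
    then obtain i0 where i0: "i0 < j" "\<And>m::int. \<delta> < \<bar>y i0 - of_int m / of_int G\<bar>" by blast
    have "splits \<delta> t (y i0)"
    proof (cases "card (D (Suc t)) < p (Suc t)")
      case False
      hence full: "card (D (Suc t)) = p (Suc t)" using card_less_or_full[of "Suc t"] by simp
      obtain q where q: "G = Gcd (D (Suc t)) * q" using Gcd_dvd_G[OF _ full] by auto
      have "of_int m / of_int (Gcd (D (Suc t))) = real_of_int (m * q) / of_int G" for m
        using G_pos unfolding q by (cases "q = 0") auto
      thus ?thesis unfolding splits_def using i0(2) less_imp_le by metis
    qed (simp add: splits_def)
    moreover have "\<forall>i<j. \<forall>e>0. attains t e (y i) \<longrightarrow> attains t (e / 2) (y i)"
      by (auto elim!: attains_mono)
    ultimately show ?thesis using sepm i0(1) by blast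
  next
    case False
    hence "\<exists>m::int. \<bar>y i - of_int m / of_int G\<bar> \<le> \<delta>" if "i < j" for i using that by (meson not_less)
    then obtain a :: "nat \<Rightarrow> int" where a: "\<And>i. i < j \<Longrightarrow> \<bar>y i - of_int (a i) / of_int G\<bar> \<le> \<delta>" by metis
    define u where "u i = real_of_int (a i) / of_int G" for i
    define \<eta> where "\<eta> i = y i - u i" for i
    have yu: "y i = u i + \<eta> i" for i by (simp add: \<eta>_def)
    have \<eta>: "\<bar>\<eta> i\<bar> \<le> \<delta>" if "i < j" for i using a[OF that] by (simp add: \<eta>_def u_def)
    have Gu: "of_int G * u i \<in> \<int>" for i using G_pos by (simp add: u_def)
    have uZ: "u i \<notin> \<int>" if "i < j" for i
    proof
      assume "u i \<in> \<int>"
      then obtain m where "u i = of_int m" by (elim Ints_cases)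
      hence "\<bar>y i + of_int (- m)\<bar> \<le> \<delta>" using \<eta>[OF that] by (simp add: yu)
      thus False using far that by blast
    qed
    \<comment> \<open>Visibility is judged by the unperturbed lattice points u i at level s +
      1.\<close>
    define Vis where "Vis s \<longleftrightarrow> card (D (Suc s)) < p (Suc s) \<or> (\<exists>i<j. of_int (Gcd (D (Suc s))) * u i \<notin> \<int>)" for s
    have "\<exists>s. s \<ge> t \<and> Vis s"
    proof -
      obtain k where k: "k \<ge> Suc t" "card (D k) < p k \<or> of_int (Gcd (D k)) * u 0 \<notin> \<int>"
        using eventually_visible[OF dense _ uZ[of 0], of "Suc t"] j by auto
      thus ?thesis using j by (intro exI[of _ "k - 1"]) (auto simp: Vis_def)
    qed
    \<comment> \<open>Minimality makes all levels between full and blind to every u i, as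
      simultaneous transport requires.\<close>
    define s where "s = (LEAST s. s \<ge> t \<and> Vis s)"
    have s: "s \<ge> t" "Vis s" using LeastI_ex[OF \<open>\<exists>s. s \<ge> t \<and> Vis s\<close>] by (simp_all add: s_def)
    have before: "\<not> Vis r" if "t \<le> r" "r < s" for r
      using not_less_Least[of r "\<lambda>s. s \<ge> t \<and> Vis s"] that by (auto simp: s_def)
    define k where "k = s - t"
    have sk: "t + k = s" using s by (simp add: k_def)
    let ?P = "pprod (\<lambda>i. p (t + i)) k"
    have P1: "?P \<ge> 1"
    proof -
      have "(1::real) \<le> 2 ^ k" by simp
      also have "\<dots> \<le> ?P" by (rule moran_system.pprod_ge[OF shift])
      finally show ?thesis .
    qed
    have invis: "card (D r) = p r \<and> of_int (Gcd (D r)) * u i \<in> \<int>" if "t < r" "r \<le> t + k" "i < j" for r i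
      using before[of "r - 1"] that sk card_less_or_full[of r] by (auto simp: Vis_def)
    have "\<exists>u'. of_int G * u' \<in> \<int> \<and> ?P * u' - u i \<in> \<int> \<and> (\<forall>e\<ge>0. attains s e (u' + \<eta> i / ?P) \<longrightarrow>
       attains t ((1 - 4 * pi * C * \<bar>\<eta> i\<bar>) * e) (y i))" if i: "i < j" for i
    proof -
      obtain u' where "of_int G * u' \<in> \<int>" "?P * u' - u i \<in> \<int>"
        "\<And>e. e \<ge> 0 \<Longrightarrow> attains (t + k) e (u' + \<eta> i / ?P) \<Longrightarrow> attains t ((1 - 4 * pi * C * \<bar>\<eta> i\<bar>) * e) (u i + \<eta> i)"
      proof (rule attains_transport[of t k "u i" G "\<eta> i"])
        fix r assume "t < r" "r \<le> t + k"
        thus "\<exists>L. hadamard_triple (p r) (D r) L" using had[of r] by auto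
      qed (use G_pos Gu invis i in auto)
      thus ?thesis unfolding sk yu[symmetric] by blast
    qed
    then obtain u' where u': "\<And>i. i < j \<Longrightarrow> of_int G * u' i \<in> \<int>" "\<And>i. i < j \<Longrightarrow> ?P * u' i - u i \<in> \<int>"
      "\<And>i e. i < j \<Longrightarrow> e \<ge> 0 \<Longrightarrow> attains s e (u' i + \<eta> i / ?P) \<Longrightarrow> attains t ((1 - 4 * pi * C * \<bar>\<eta> i\<bar>) * e) (y i)"
      by metis
    define y' where "y' i = u' i + \<eta> i / ?P" for i
    have \<eta>P: "\<bar>\<eta> i / ?P\<bar> \<le> \<delta>" if "i < j" for i
    proof -
      have "\<bar>\<eta> i / ?P\<bar> = \<bar>\<eta> i\<bar> / ?P" using P1 by (simp add: abs_divide)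
      also have "\<dots> \<le> \<bar>\<eta> i\<bar>" using P1 by (simp add: divide_le_eq mult_left_le_one_le mult_le_cancel_left1)
      finally show ?thesis using \<eta>[OF that] by simp
    qed
    have att: "attains t (e / 2) (y i)" if "i < j" "e > 0" "attains s e (y' i)" for i e
    proof (rule attains_mono[OF u'(3)])
      have "4 * pi * C * \<bar>\<eta> i\<bar> \<le> 4 * pi * C * \<delta>" using \<eta>[OF that(1)] C_nonneg by (intro mult_left_mono) auto
      hence "1 / 2 \<le> 1 - 4 * pi * C * \<bar>\<eta> i\<bar>" using \<delta>(4) by linarith
      from mult_right_mono[OF this, of e] show "e / 2 \<le> (1 - 4 * pi * C * \<bar>\<eta> i\<bar>) * e" using that by simp
    qed (use that in \<open>auto simp: y'_def\<close>)
    have Pint: "?P \<in> \<int>" by (rule pprod_Ints)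
    have sep': "1 / (2 * of_int G) \<le> \<bar>y' i - y' l + of_int m\<bar>" if il: "i < j" "l < j" "i \<noteq> l" for i l and m :: int
    proof -
      \<comment> \<open>P u' is u modulo 1, so a coincidence of the lifted points would make u i and
        u l agree modulo 1, and y i and y l would be within 2 \<delta> < \<sigma> on the
        circle.\<close>
      have "u' i - u' l + of_int m \<noteq> 0"
      proof
        assume z: "u' i - u' l + of_int m = 0"
        have "(u i - u l) = (?P * u' i - ?P * u' l) - ((?P * u' i - u i) - (?P * u' l - u l))" by simp
        also have "?P * u' i - ?P * u' l = ?P * (u' i - u' l)" by (rule right_diff_distrib[symmetric])
        also have "u' i - u' l = - of_int m" using z by linarith
        finally have e: "u i - u l = ?P * - of_int m - ((?P * u' i - u i) - (?P * u' l - u l))" .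
        have "u i - u l \<in> \<int>" unfolding e
          by (rule Ints_diff[OF Ints_mult[OF Pint] Ints_diff[OF u'(2)[OF il(1)] u'(2)[OF il(2)]]]) simp
        then obtain q where q: "u i - u l = of_int q" by (elim Ints_cases)
        have "\<bar>y i - y l + of_int (- q)\<bar> = \<bar>\<eta> i - \<eta> l\<bar>" using q by (simp add: yu)
        also have "\<dots> \<le> 2 * \<delta>" using \<eta>[OF il(1)] \<eta>[OF il(2)] by linarith
        also have "\<dots> < \<sigma>" by (rule \<delta>)
        also have "\<sigma> \<le> \<bar>y i - y l + of_int (- q)\<bar>" using sep il unfolding circle_separated_def by blast
        finally show False by simp
      qed
      moreover have "of_int G * (u' i - u' l + of_int m) \<in> \<int>"
        using u'(1)[OF il(1)] u'(1)[OF il(2)] by (simp add: distrib_left right_diff_distrib)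
      ultimately have "1 / of_int G \<le> \<bar>u' i - u' l + of_int m\<bar>" by (rule lattice_distance[rotated])
      moreover have "\<bar>u' i - u' l + of_int m\<bar> \<le> \<bar>y' i - y' l + of_int m\<bar> + \<bar>\<eta> i / ?P\<bar> + \<bar>\<eta> l / ?P\<bar>"
        unfolding y'_def by linarith
      moreover have "1 / real_of_int G = 1 / (2 * of_int G) + 1 / (2 * of_int G)" using G_pos by (simp add: field_simps)
      ultimately show ?thesis using \<eta>P[OF il(1)] \<eta>P[OF il(2)] \<delta>(3) by linarith
    qed
    have "\<exists>i0<j. splits \<delta> s (y' i0)"
    proof (cases "card (D (Suc s)) < p (Suc s)")
      case True
      thus ?thesis using j by (intro exI[of _ 0]) (simp add: splits_def)
    next
      case False
      then obtain i0 where i0: "i0 < j" "of_int (Gcd (D (Suc s))) * u i0 \<notin> \<int>" using s(2) unfolding Vis_def by blast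
      let ?g = "real_of_int (Gcd (D (Suc s)))"
      have full: "card (D (Suc s)) = p (Suc s)" using False card_less_or_full[of "Suc s"] by simp
      obtain q where q: "G = Gcd (D (Suc s)) * q" using Gcd_dvd_G[OF _ full] by auto
      have "Gcd (D (Suc s)) \<noteq> 0" using q G_pos by (metis mult_zero_left order_less_irrefl)
      hence g0: "?g \<noteq> 0" by (simp only: of_int_eq_0_iff not_False_eq_True)
      have "\<delta> \<le> \<bar>y' i0 - of_int m / ?g\<bar>" for m :: int
      proof -
        \<comment> \<open>Visibility passes from u to its lift: if g u' were an integer, so would be
          g u, since P u' is u modulo 1.\<close>
        have "u' i0 - of_int m / ?g \<noteq> 0"
        proof
          assume "u' i0 - of_int m / ?g = 0"
          hence gu: "?g * u' i0 = of_int m" using g0 by (simp add: field_simps)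
          have "?g * u i0 = ?P * (?g * u' i0) - ?g * (?P * u' i0 - u i0)" by (simp add: algebra_simps)
          moreover have "\<dots> \<in> \<int>" unfolding gu by (rule Ints_diff[OF Ints_mult[OF Pint] Ints_mult[OF _ u'(2)[OF i0(1)]]]) auto
          ultimately show False using i0(2) by simp
        qed
        moreover have "of_int G * (u' i0 - of_int m / ?g) \<in> \<int>"
        proof -
          have "of_int G * (of_int m / ?g) = real_of_int (q * m)" using g0 by (simp add: q)
          hence "of_int G * (u' i0 - of_int m / ?g) = of_int G * u' i0 - real_of_int (q * m)" by (simp only: right_diff_distrib)
          thus ?thesis using u'(1)[OF i0(1)] by (metis Ints_diff Ints_of_int)
        qed
        ultimately have "1 / of_int G \<le> \<bar>u' i0 - of_int m / ?g\<bar>" by (rule lattice_distance[rotated])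
        moreover have "1 / real_of_int G = 1 / (2 * of_int G) + 1 / (2 * of_int G)" using G_pos by (simp add: field_simps)
        moreover have "\<bar>u' i0 - of_int m / ?g\<bar> \<le> \<bar>y' i0 - of_int m / ?g\<bar> + \<bar>\<eta> i0 / ?P\<bar>"
          unfolding y'_def by linarith
        ultimately show ?thesis using \<eta>P[OF i0(1)] \<delta>(1,3) by linarith
      qed
      thus ?thesis using i0 by (auto simp: splits_def)
    qed
    then obtain i0 where "i0 < j" "splits \<delta> s (y' i0)" by blast
    moreover have "circle_separated (min \<sigma> (1 / (2 * of_int G))) j y'"
      using sep' unfolding circle_separated_def by (auto simp: min_le_iff_disj)
    ultimately show ?thesis using att by blast
  qed
qed

end

section \<open>Uniform lower bounds for tail transforms\<close>

lemma finite_uniform_bound: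
  fixes Q :: "'a \<Rightarrow> real \<Rightarrow> bool"
  assumes "finite A" "\<And>a. a \<in> A \<Longrightarrow> \<exists>c>0. Q a c"
    and anti: "\<And>a c c'. Q a c \<Longrightarrow> 0 < c' \<Longrightarrow> c' \<le> c \<Longrightarrow> Q a c'"
  shows "\<exists>c>0. \<forall>a\<in>A. Q a c"
  using assms(1,2)
proof (induction A rule: finite_induct)
  case (insert a A)
  obtain c where c: "c > 0" "\<forall>a\<in>A. Q a c" using insert.IH insert.prems by blast
  obtain c' where c': "c' > 0" "Q a c'" using insert.prems by blast
  have "Q b (min c c')" if "b \<in> insert a A" for b
    using that c c' anti[of b c "min c c'"] anti[of b c' "min c c'"] by auto
  thus ?case using c c' by (intro exI[of _ "min c c'"]) auto
qed (auto intro: exI[of _ 1])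

context bounded_hadamard_moran begin

lemma uniform_doubling:
  assumes "\<delta> > 0"
  shows "\<exists>c>0. \<forall>n x. splits \<delta> n x \<longrightarrow>
    (\<exists>l1 l2::int. \<not> int (p (Suc n)) dvd l1 - l2 \<and>
       c \<le> cmod (dmask (D (Suc n)) ((x + of_int l1) / real (p (Suc n)))) \<and>
       c \<le> cmod (dmask (D (Suc n)) ((x + of_int l2) / real (p (Suc n)))))"
proof -
  let ?Q = "\<lambda>(q, E) c. \<forall>x. (card E < q \<or> (\<forall>m::int. \<delta> \<le> \<bar>x - of_int m / of_int (Gcd E)\<bar>)) \<longrightarrow>
    (\<exists>l1 l2::int. \<not> int q dvd l1 - l2 \<and> c \<le> cmod (dmask E ((x + of_int l1) / real q)) \<and>
       c \<le> cmod (dmask E ((x + of_int l2) / real q)))"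
  let ?A = "range (\<lambda>n. (p (Suc n), D (Suc n)))"
  have "\<exists>c>0. \<forall>a\<in>?A. ?Q a c"
  proof (rule finite_uniform_bound)
    have "?A \<subseteq> {..Pmax} \<times> Pow {0..\<lceil>C * real Pmax\<rceil>}"
    proof safe
      fix n d assume d: "d \<in> D (Suc n)"
      have "of_int d \<le> C * real (p (Suc n))" using bound_D[OF _ d] by simp
      also have "\<dots> \<le> C * real Pmax" using p_le[of "Suc n"] C_nonneg by (intro mult_left_mono) auto
      finally have "d \<le> \<lceil>C * real Pmax\<rceil>" by linarith
      thus "d \<in> {0..\<lceil>C * real Pmax\<rceil>}" using nonneg_D[OF _ d] by simp
    qed (use p_le in auto)
    thus "finite ?A" by (rule finite_subset) auto
  next
    fix a assume "a \<in> ?A"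
    then obtain n where n: "a = (p (Suc n), D (Suc n))" by blast
    show "\<exists>c>0. ?Q a c" unfolding n prod.case
      by (rule doubling[OF had zero_D assms]) auto
  next
    fix a c c' assume "?Q a c" "0 < c'" "c' \<le> (c::real)"
    thus "?Q a c'" by (cases a) (simp, meson order_trans)
  qed
  thus ?thesis unfolding splits_def by auto
qed

text \<open>One more point per induction step: \<open>reach_split\<close> brings the family to a
  level where some point splits; one level further that point has two descendants and each other
  point keeps one. Both w and \<sigma> shrink by amounts independent of n and x.\<close>

lemma many_separated_points:
  "\<exists>w>0. \<exists>\<sigma>>0. w \<le> 1 \<and> (\<forall>n x. attains n w x \<or>
     (\<exists>t y. circle_separated \<sigma> (Suc j) y \<and> (\<forall>i<Suc j. \<forall>e>0. attains t e (y i) \<longrightarrow> attains n (w * e) x)))"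
proof (induction j)
  case 0
  have "\<exists>t y. circle_separated 1 (Suc 0) y \<and> (\<forall>i<Suc 0. \<forall>e>0. attains t e (y i) \<longrightarrow> attains n (1 * e) x)" for n x
    by (rule exI[of _ n], rule exI[of _ "\<lambda>_. x"]) (simp add: circle_separated_def)
  hence "(0::real) < 1 \<and> (1::real) \<le> 1 \<and> (\<forall>n x. attains n 1 x \<or>
     (\<exists>t y. circle_separated 1 (Suc 0) y \<and> (\<forall>i<Suc 0. \<forall>e>0. attains t e (y i) \<longrightarrow> attains n (1 * e) x)))" by simp
  thus ?case by blast
next
  case (Suc j)
  then obtain w \<sigma> where w: "w > 0" "w \<le> 1" and \<sigma>: "\<sigma> > 0"
    and IH: "\<And>n x. attains n w x \<or> (\<exists>t y. circle_separated \<sigma> (Suc j) y \<and>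
       (\<forall>i<Suc j. \<forall>e>0. attains t e (y i) \<longrightarrow> attains n (w * e) x))" by blast
  \<comment> \<open>The three terms answer, in this order, the requirements of
    \<open>reach_split\<close> on \<sigma>, on \<open>G\<close> and on the Lipschitz constant; C + 1
    avoids division by 0.\<close>
  define \<delta> where "\<delta> = min (\<sigma> / 4) (min (1 / (4 * of_int G)) (1 / (8 * pi * (C + 1))))"
  have \<delta>: "\<delta> > 0" "2 * \<delta> < \<sigma>" "2 * \<delta> \<le> 1 / (2 * of_int G)" "4 * pi * C * \<delta> \<le> 1 / 2"
  proof -
    show "\<delta> > 0" using \<sigma> G_pos C_nonneg by (simp add: \<delta>_def)
    have "\<delta> \<le> \<sigma> / 4" by (simp add: \<delta>_def)
    thus "2 * \<delta> < \<sigma>" using \<sigma> by simp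
    have "\<delta> \<le> 1 / (4 * of_int G)" by (simp add: \<delta>_def)
    thus "2 * \<delta> \<le> 1 / (2 * of_int G)" by simp
    have "4 * pi * C * \<delta> \<le> 4 * pi * (C + 1) * \<delta>" using \<open>\<delta> > 0\<close> by (intro mult_right_mono mult_left_mono) auto
    also have "\<dots> \<le> 4 * pi * (C + 1) * (1 / (8 * pi * (C + 1)))" using C_nonneg by (intro mult_left_mono) (auto simp: \<delta>_def)
    also have "\<dots> = 1 / 2" using C_nonneg by simp
    finally show "4 * pi * C * \<delta> \<le> 1 / 2" .
  qed
  obtain c where c: "c > 0" and dbl: "\<And>n x. splits \<delta> n x \<Longrightarrow>
    (\<exists>l1 l2::int. \<not> int (p (Suc n)) dvd l1 - l2 \<and>
       c \<le> cmod (dmask (D (Suc n)) ((x + of_int l1) / real (p (Suc n)))) \<and>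
       c \<le> cmod (dmask (D (Suc n)) ((x + of_int l2) / real (p (Suc n)))))"
    using uniform_doubling[OF \<delta>(1)] by blast
  have Pm: "Pmax \<ge> 1" using p_le[of 1] p_gt_1[of 1] by simp
  \<comment> \<open>Serves both kinds of descendant: c for the two of the splitting point, 1 /
    \<open>Pmax\<close> for the single ones.\<close>
  define c0 where "c0 = min c (1 / real Pmax)"
  have c0: "c0 > 0" "c0 \<le> 1" "c0 \<le> c" "c0 \<le> 1 / real Pmax"
    using c Pm by (auto simp: c0_def min_le_iff_disj)
  define \<sigma>1 where "\<sigma>1 = min \<sigma> (1 / (2 * of_int G))"
  \<comment> \<open>Passing down a level divides distances by at most \<open>Pmax\<close>;
    descendants of different points start from \<sigma>1, the two of one point from distance at
    least 1.\<close>
  define \<sigma>2 where "\<sigma>2 = min \<sigma>1 1 / real Pmax"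
  have \<sigma>2: "\<sigma>2 > 0" using \<sigma> G_pos Pm by (simp add: \<sigma>1_def \<sigma>2_def)
  \<comment> \<open>The factor 1/2 is lost in \<open>reach_split\<close> and c0 in the step to the
    descendants.\<close>
  define w' where "w' = w * (c0 / 2)"
  have w': "w' > 0" "w' \<le> w / 2" "w' \<le> 1"
  proof -
    show "w' > 0" using w c0 by (simp add: w'_def)
    show "w' \<le> w / 2" using w c0 by (simp add: w'_def)
    thus "w' \<le> 1" using w by simp
  qed
  show ?case
  proof (rule exI[of _ w'], intro conjI w'(1), rule exI[of _ \<sigma>2], intro conjI allI w'(3) \<sigma>2)
    fix n x
    show "attains n w' x \<or> (\<exists>t y. circle_separated \<sigma>2 (Suc (Suc j)) y \<and>
       (\<forall>i<Suc (Suc j). \<forall>e>0. attains t e (y i) \<longrightarrow> attains n (w' * e) x))"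
    \<comment> \<open>If some point of the family already attains 1/2 at level t, then x attains w /
      2; this case has to be excluded before splitting.\<close>
    proof (cases "attains n (w / 2) x")
      case True
      thus ?thesis using attains_mono w'(2) by blast
    next
      case no: False
      hence "\<not> attains n w x" using w attains_mono[of n w x "w / 2"] by auto
      then obtain t y where y: "circle_separated \<sigma> (Suc j) y"
        "\<And>i e. i < Suc j \<Longrightarrow> e > 0 \<Longrightarrow> attains t e (y i) \<Longrightarrow> attains n (w * e) x" using IH by blast
      have "\<not> attains t (1 / 2) (y i)" if "i < Suc j" for i using y(2)[OF that, of "1 / 2"] no by auto
      then obtain s y' i0 where s: "circle_separated \<sigma>1 (Suc j) y'" "i0 < Suc j" "splits \<delta> s (y' i0)"
        "\<And>i e. i < Suc j \<Longrightarrow> e > 0 \<Longrightarrow> attains s e (y' i) \<Longrightarrow> attains t (e / 2) (y i)"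
        using reach_split[OF _ y(1) \<delta>, of t] unfolding \<sigma>1_def by auto
      let ?q = "p (Suc s)" and ?m = "\<lambda>i l. cmod (dmask (D (Suc s)) ((y' i + real_of_int l) / real (p (Suc s))))"
      have q: "?q > 1" "?q \<le> Pmax" using p_gt_1 p_le by auto
      obtain l1 l2 where l12: "\<not> int ?q dvd l1 - l2" "c \<le> ?m i0 l1" "c \<le> ?m i0 l2" using dbl[OF s(3)] by blast
      have "\<exists>l::int. c0 \<le> ?m i l \<and> (i = i0 \<longrightarrow> l = l1)" for i
      proof (cases "i = i0")
        case True
        thus ?thesis using l12 c0 by (intro exI[of _ l1]) auto
      next
        case False
        have ne: "D (Suc s) \<noteq> {}" using D_nonempty by simp
        have N: "card (D (Suc s)) > 0" using ne finite_D[of "Suc s"] by (simp add: card_gt_0_iff)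
        have "card (D (Suc s)) \<le> Pmax" using hadamard_card_le[OF had, of "Suc s"] q by simp
        hence "c0 \<le> 1 / real (card (D (Suc s)))" using c0(4) N Pm by (elim order_trans) (simp add: frac_le)
        thus ?thesis using single_child[OF had ne, of "y' i"] False by (auto intro: order_trans)
      qed
      then obtain l where l: "\<And>i. c0 \<le> ?m i (l i)" "l i0 = l1" by metis
      \<comment> \<open>Indices up to j keep their own parent; the new index \<open>Suc j\<close> is
        the second descendant of i0.\<close>
      define par where "par i = (if i < Suc j then i else i0)" for i
      define lab where "lab i = (if i < Suc j then l i else l2)" for i
      define z where "z i = (y' (par i) + of_int (lab i)) / real ?q" for i
      have par: "par i < Suc j" for i using s(2) by (simp add: par_def)
      have mz: "c0 \<le> ?m (par i) (lab i)" for i using l l12 c0 by (auto simp: par_def lab_def)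
      have "circle_separated \<sigma>2 (Suc (Suc j)) z" unfolding circle_separated_def
      proof (intro allI impI)
        fix i k and m :: int assume ik: "i < Suc (Suc j)" "k < Suc (Suc j)" "i \<noteq> k"
        have e: "z i - z k + of_int m = (y' (par i) - y' (par k) + of_int (lab i - lab k + int ?q * m)) / real ?q"
          using q by (simp add: z_def field_simps)
        have "min \<sigma>1 1 \<le> \<bar>y' (par i) - y' (par k) + of_int (lab i - lab k + int ?q * m)\<bar>"
        proof (cases "par i = par k")
          case False
          thus ?thesis using s(1) par unfolding circle_separated_def by (meson min.coboundedI1)
        next
          case True
          hence "(i = i0 \<and> k = Suc j) \<or> (k = i0 \<and> i = Suc j)"
            using ik s(2) by (auto simp: par_def split: if_splits)
          hence "\<not> int ?q dvd lab i - lab k"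
            using l12(1) l(2) s(2) by (auto simp: lab_def dvd_diff_commute)
          hence "lab i - lab k + int ?q * m \<noteq> 0"
            by (metis add_eq_0_iff dvd_minus_iff dvd_triv_left)
          hence "1 \<le> \<bar>real_of_int (lab i - lab k + int ?q * m)\<bar>" by (metis Ints_of_int Ints_nonzero_abs_ge1 of_int_eq_0_iff)
          thus ?thesis using True by simp
        qed
        hence "min \<sigma>1 1 / real ?q \<le> \<bar>z i - z k + of_int m\<bar>" unfolding e abs_divide using q by (simp add: divide_right_mono)
        moreover have "\<sigma>2 \<le> min \<sigma>1 1 / real ?q" unfolding \<sigma>2_def
          using q \<sigma> G_pos by (intro divide_left_mono) (auto simp: \<sigma>1_def)
        ultimately show "\<sigma>2 \<le> \<bar>z i - z k + of_int m\<bar>" by simp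
      qed
      moreover have "attains n (w' * e) x" if e: "e > 0" "attains (Suc s) e (z i)" for i e
      proof -
        have "attains s (c0 * e) (y' (par i))"
          using attains_step[OF e(2)[unfolded z_def] mz] e by simp
        hence "attains t (c0 * e / 2) (y (par i))" using s(4) par c0 e by simp
        hence "attains n (w * (c0 * e / 2)) x" by (rule y(2)[OF par, rotated]) (use c0 e in simp)
        thus ?thesis by (simp add: w'_def mult_ac)
      qed
      ultimately show ?thesis by blast
    qed
  qed
qed

text \<open>K comes from the support bound, then the separation from producing K points, then
  \<epsilon> from K and the separation. Fractional parts move the points into [0, 1], where the
  interpolation lives.\<close>

lemma equi_level_bounded: "\<exists>\<epsilon>>0. \<forall>n. equi_level \<epsilon> n"
proof -
  obtain K where K: "K > 0" and big: "\<And>\<sigma>. 0 < \<sigma> \<Longrightarrow> \<sigma> \<le> 1 \<Longrightarrow> \<exists>\<epsilon>>0. large_at_separated (2 * C) K \<sigma> \<epsilon>"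
    using fourier_large_at_separated_points[of "2 * C"] by blast
  obtain w \<sigma> where w: "w > 0" and \<sigma>: "\<sigma> > 0" and wy: "\<And>n x. attains n w x \<or>
     (\<exists>t y. circle_separated \<sigma> K y \<and> (\<forall>i<K. \<forall>e>0. attains t e (y i) \<longrightarrow> attains n (w * e) x))"
    using many_separated_points[of "K - 1"] K by auto
  obtain \<epsilon> where \<epsilon>: "\<epsilon> > 0" and large: "large_at_separated (2 * C) K (min \<sigma> 1) \<epsilon>"
    using big[of "min \<sigma> 1"] \<sigma> by auto
  have "attains n (min w (w * \<epsilon>)) x" for n x
  proof (cases "attains n w x")
    case False
    then obtain t y where y: "circle_separated \<sigma> K y"
      "\<And>i e. i < K \<Longrightarrow> e > 0 \<Longrightarrow> attains t e (y i) \<Longrightarrow> attains n (w * e) x" using wy by blast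
    have sep: "\<sigma> \<le> \<bar>frac (y i) - frac (y k)\<bar>" if "i < K" "k < K" "i \<noteq> k" for i k
    proof -
      have "frac (y i) - frac (y k) = y i - y k + of_int (\<lfloor>y k\<rfloor> - \<lfloor>y i\<rfloor>)" by (simp add: frac_def)
      thus ?thesis using y(1) that unfolding circle_separated_def by metis
    qed
    let ?Y = "(\<lambda>i. frac (y i)) ` {..<K}"
    have inj: "inj_on (\<lambda>i. frac (y i)) {..<K}"
      using sep \<sigma> by (intro inj_onI) (metis abs_zero diff_self lessThan_iff not_less)
    have "\<exists>z\<in>?Y. \<epsilon> \<le> cmod (fourier (moran_tail p D t) z)"
    proof (rule large_at_separatedD[OF large real_distribution_tail AE_tail])
      show "card ?Y = K" using card_image[OF inj] by simp
      show "?Y \<subseteq> {0..1}" using less_imp_le[OF frac_lt_1] by (auto simp: frac_ge_0)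
      fix a b assume "a \<in> ?Y" "b \<in> ?Y" "a \<noteq> b"
      thus "min \<sigma> 1 \<le> \<bar>a - b\<bar>" using sep by (auto simp: min_le_iff_disj)
    qed simp
    then obtain i where i: "i < K" "\<epsilon> \<le> cmod (fourier (moran_tail p D t) (frac (y i)))" by auto
    hence "attains t \<epsilon> (frac (y i))" unfolding attains_def by (intro exI[of _ 0]) simp
    hence "attains n (w * \<epsilon>) x" using y(2)[OF i(1) \<epsilon>] by (simp add: attains_frac)
    thus ?thesis by (rule attains_mono) simp
  qed (auto elim: attains_mono)
  thus ?thesis using w \<epsilon> by (intro exI[of _ "min w (w * \<epsilon>)"]) (simp add: equi_level_def)
qed

end

section \<open>Levels followed by a large modulus\<close>

context moran_system begin

text \<open>The squared masks over all p translates sum to at least p / M, while masks below 1 / (2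
  M) contribute at most half of that. So at least p / (2 M) descendants have a good mask, and a
  fixed proportion of the equally spaced descendants contains K well separated ones.\<close>

lemma equi_level_large_modulus:
  assumes had: "\<And>n. n \<ge> 1 \<Longrightarrow> hadamard_triple (p n) (D n) (L n)"
    and M: "\<And>n. n \<ge> 1 \<Longrightarrow> card (D n) \<le> M"
  shows "\<exists>\<epsilon>>0. \<exists>P0. \<forall>n. P0 \<le> p (Suc n) \<longrightarrow> equi_level \<epsilon> n"
proof -
  obtain K where K: "K > 0" and big: "\<And>\<sigma>. 0 < \<sigma> \<Longrightarrow> \<sigma> \<le> 1 \<Longrightarrow> \<exists>\<epsilon>>0. large_at_separated (2 * C) K \<sigma> \<epsilon>"
    using fourier_large_at_separated_points[of "2 * C"] by blast
  have "card (D 1) > 0" using finite_D[of 1] D_nonempty[of 1] by (simp add: card_gt_0_iff)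
  hence M1: "M \<ge> 1" using M[of 1] by simp
  \<comment> \<open>The later spacing is s / q with s the integer part of q / (2 M K); rounding down
    loses at most a factor 2 once s is positive.\<close>
  define \<sigma> where "\<sigma> = 1 / (4 * real M * real K)"
  have "1 \<le> real M * real K" using mult_mono[of 1 "real M" 1 "real K"] M1 K by simp
  hence \<sigma>: "0 < \<sigma>" "\<sigma> \<le> 1" using M1 K by (auto simp: \<sigma>_def)
  obtain \<epsilon> where \<epsilon>: "\<epsilon> > 0" and large: "large_at_separated (2 * C) K \<sigma> \<epsilon>"
    using big[OF \<sigma>] by blast
  have main: "attains n (1 / (2 * real M) * \<epsilon>) x" if P: "2 * M * K \<le> p (Suc n)" and x: "x \<in> {0..<1}" for n x
  proof -
    let ?q = "p (Suc n)" and ?D = "D (Suc n)"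
    let ?m = "\<lambda>l::nat. cmod (dmask ?D ((x + of_int (int l)) / real ?q))"
    have H: "hadamard_triple ?q ?D (L (Suc n))" by (rule had) simp
    have q: "?q > 1" using p_gt_1 by simp
    have ne: "?D \<noteq> {}" using D_nonempty by simp
    have N: "card ?D > 0" "card ?D \<le> M" using ne finite_D[of "Suc n"] M by (auto simp: card_gt_0_iff)
    define X where "X = {l. l < ?q \<and> 1 / (2 * real M) \<le> ?m l}"
    have Xsub: "X \<subseteq> {..<?q}" by (auto simp: X_def)
    have finX: "finite X" using Xsub by (rule finite_subset) simp
    have "real ?q / real (card ?D) = (\<Sum>l<?q. (?m l)\<^sup>2)"
    proof -
      have "{0..<int ?q} = int ` {..<?q}" by (simp add: image_int_atLeastLessThan lessThan_atLeast0)
      thus ?thesis using hadamard_dmask_sum_full[OF H ne, of x] by (simp add: sum.reindex)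
    qed
    \<comment> \<open>A square is at most its base here, so a mask below the threshold 1 / (2 M)
      also has its square below it.\<close>
    also have "\<dots> \<le> (\<Sum>l<?q. (if l \<in> X then 1 else 0) + 1 / (2 * real M))"
    proof (rule sum_mono)
      fix l assume l: "l \<in> {..<?q}"
      have "(?m l)\<^sup>2 \<le> ?m l" using norm_dmask_le by (simp add: power2_eq_square mult_left_le_one_le)
      have "?m l \<le> 1" by (rule norm_dmask_le)
      have "0 \<le> 1 / (2 * real M)" by simp
      show "(?m l)\<^sup>2 \<le> (if l \<in> X then 1 else 0) + 1 / (2 * real M)"
      proof (cases "l \<in> X")
        case True
        thus ?thesis unfolding if_P[OF True] using \<open>(?m l)\<^sup>2 \<le> ?m l\<close> \<open>?m l \<le> 1\<close> \<open>0 \<le> 1 / (2 * real M)\<close> by linarith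
      next
        case False
        have "?m l < 1 / (2 * real M)" using l False by (simp add: X_def not_le)
        thus ?thesis unfolding if_not_P[OF False] using \<open>(?m l)\<^sup>2 \<le> ?m l\<close> by linarith
      qed
    qed
    also have "\<dots> = real (card X) + real ?q / (2 * real M)"
      using Xsub finX by (simp add: sum.distrib sum.If_cases Int_absorb1)
    finally have "real ?q / real (card ?D) \<le> real (card X) + real ?q / (2 * real M)" .
    moreover have "real ?q / real M \<le> real ?q / real (card ?D)" using N by (intro divide_left_mono) auto
    moreover have "real ?q / real M = real ?q / (2 * real M) + real ?q / (2 * real M)" using M1 by (simp add: field_simps)
    ultimately have cX: "real ?q / (2 * real M) \<le> real (card X)" by linarith
    define s where "s = ?q div (2 * M * K)"
    have s: "s > 0" using P M1 K by (simp add: s_def div_greater_zero_iff)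
    have qs: "?q < 4 * M * K * s"
    proof -
      have "?q < (s + 1) * (2 * M * K)" unfolding s_def using M1 K
        by (metis Suc_eq_plus1 dividend_less_div_times div_mult_self_is_m add.commute mult.commute mult_Suc nat_0_less_mult_iff less_le_trans zero_less_one zero_less_numeral)
      also have "\<dots> \<le> (2 * s) * (2 * M * K)" using s by (intro mult_right_mono) auto
      finally show ?thesis by (simp add: mult_ac)
    qed
    have "K * s \<le> card X"
    proof -
      have "s * (2 * M * K) \<le> ?q" unfolding s_def by (rule div_times_less_eq_dividend)
      hence "real (s * (2 * M * K)) \<le> real ?q" by (simp only: of_nat_le_iff)
      hence "real (K * s) \<le> real ?q / (2 * real M)" using M1 by (simp add: field_simps)
      thus ?thesis using cX by linarith
    qed
    then obtain Y0 where Y0: "Y0 \<subseteq> X" "card Y0 = K" "\<forall>a\<in>Y0. \<forall>b\<in>Y0. a < b \<longrightarrow> a + s \<le> b"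
      using spread_subset[OF finX _ s] by blast
    let ?f = "\<lambda>l. (x + real l) / real ?q"
    have inj: "inj_on ?f Y0" using q by (auto simp: inj_on_def)
    have sep1: "\<sigma> \<le> \<bar>?f a - ?f b\<bar>" if "a \<in> Y0" "b \<in> Y0" "a < b" for a b
    proof -
      have "real a + real s \<le> real b" using Y0(3) that by (metis of_nat_add of_nat_le_iff)
      moreover have "\<bar>?f a - ?f b\<bar> = \<bar>real a - real b\<bar> / real ?q" by (simp flip: diff_divide_distrib)
      moreover have "real s \<le> \<bar>real a - real b\<bar>" using calculation(1) by linarith
      ultimately have "real s / real ?q \<le> \<bar>?f a - ?f b\<bar>" by (simp add: divide_right_mono)
      moreover have "\<sigma> \<le> real s / real ?q"
      proof -
        have "real ?q \<le> real (4 * M * K * s)" using qs by (simp only: of_nat_le_iff less_imp_le)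
        thus ?thesis using M1 K q by (simp add: \<sigma>_def field_simps)
      qed
      ultimately show ?thesis by simp
    qed
    have sep: "\<sigma> \<le> \<bar>?f a - ?f b\<bar>" if "a \<in> Y0" "b \<in> Y0" "a \<noteq> b" for a b
      using sep1[of a b] sep1[of b a] that by (cases "a < b") (auto simp: abs_minus_commute)
    have "\<exists>y\<in>?f ` Y0. \<epsilon> \<le> cmod (fourier (moran_tail p D (Suc n)) y)"
    proof (rule large_at_separatedD[OF large real_distribution_tail AE_tail])
      show "finite (?f ` Y0)" using finite_subset[OF Y0(1) finX] by simp
      show "card (?f ` Y0) = K" using card_image[OF inj] Y0 by simp
      show "?f ` Y0 \<subseteq> {0..1}"
      proof safe
        fix l assume "l \<in> Y0"
        hence "Suc l \<le> ?q" using Y0 Xsub by auto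
        hence "real l + 1 \<le> real ?q" by (metis of_nat_Suc of_nat_le_iff add.commute)
        thus "?f l \<in> {0..1}" using x q by (auto simp: divide_le_eq)
      qed
      fix y z assume "y \<in> ?f ` Y0" "z \<in> ?f ` Y0" "y \<noteq> z"
      thus "\<sigma> \<le> \<bar>y - z\<bar>" using sep by blast
    qed
    then obtain l where l: "l \<in> Y0" "\<epsilon> \<le> cmod (fourier (moran_tail p D (Suc n)) (?f l))" by blast
    have "attains (Suc n) \<epsilon> ((x + of_int (int l)) / real ?q)"
      using l(2) unfolding attains_def by (intro exI[of _ 0]) simp
    moreover have "1 / (2 * real M) \<le> ?m l" using l(1) Y0(1) by (auto simp: X_def)
    ultimately show ?thesis using \<epsilon> by (intro attains_step[where l = "int l"]) auto
  qed
  show ?thesis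
  proof (intro exI conjI allI impI)
    show "0 < 1 / (2 * real M) * \<epsilon>" using M1 \<epsilon> by simp
    fix n assume "2 * M * K \<le> p (Suc n)"
    thus "equi_level (1 / (2 * real M) * \<epsilon>) n" unfolding equi_level_def using main by blast
  qed
qed

end

section \<open>The equivalences\<close>

context moran_system begin

text \<open>If no partial product vanished at \<xi> = 1/g + k, each division by the next modulus
  would keep g \<xi> / P_i an integer by \<open>dmask_nonzero_imp\<close>; it is nonzero and tends
  to 0, which is absurd.\<close>

lemma common_divisor_annihilates:
  assumes had: "\<And>j. j > n \<Longrightarrow> hadamard_triple (p j) (D j) (L j)"
    and full: "\<And>j. j > n \<Longrightarrow> card (D j) = p j" and g: "g \<ge> 2" "\<And>j. j > n \<Longrightarrow> g dvd Gcd (D j)"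
  shows "fourier (moran_tail p D n) (1 / of_int g + of_int k) = 0"
proof -
  let ?p = "\<lambda>i. p (n + i)" and ?D = "\<lambda>i. D (n + i)"
  define \<xi> where "\<xi> = 1 / real_of_int g + of_int k"
  have g\<xi>: "of_int g * \<xi> = real_of_int (1 + g * k)" using g by (simp add: \<xi>_def field_simps)
  have m0: "1 + g * k \<noteq> 0"
  proof
    assume "1 + g * k = 0"
    hence "g * (- k) = 1" by simp
    hence "g dvd 1" by (metis dvd_triv_left)
    thus False using g by simp
  qed
  have "\<exists>i. mprod ?p ?D i \<xi> = 0"
  proof (rule ccontr)
    assume "\<not> ?thesis"
    hence nz: "mprod ?p ?D i \<xi> \<noteq> 0" for i by blast
    have int: "of_int g * (\<xi> / pprod ?p i) \<in> \<int>" for i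
    proof (induction i)
      case 0
      thus ?case by (simp add: g\<xi> del: of_int_add of_int_mult)
    next
      case (Suc i)
      let ?x = "\<xi> / pprod ?p i" and ?q = "p (n + Suc i)" and ?E = "D (n + Suc i)"
      have H: "hadamard_triple ?q ?E (L (n + Suc i))" by (rule had) simp
      have c: "card ?E = ?q" by (rule full) simp
      have q: "?q > 1" using p_gt_1 by simp
      have y: "\<xi> / pprod ?p (Suc i) = ?x / real ?q" by (simp add: pprod_Suc)
      obtain h where h: "Gcd ?E = g * h" using g(2)[of "n + Suc i"] by (auto elim: dvdE)
      have "of_int (Gcd ?E) * ?x = of_int h * (of_int g * ?x)" by (simp only: h of_int_mult mult_ac)
      hence Gx: "of_int (Gcd ?E) * ?x \<in> \<int>" using Suc by (metis Ints_mult Ints_of_int)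
      have "dmask ?E (?x / real ?q) \<noteq> 0" using nz[of "Suc i"] by (simp add: mprod_Suc y)
      from dmask_nonzero_imp[OF H c Gx this]
      have 1: "of_int (Gcd ?E) * (?x / real ?q) \<in> \<int>" .
      have "coprime (g * h) (int ?q)" using coprime_Gcd_modulus[OF H c] by (simp only: h)
      hence "coprime h (int ?q)" by simp
      \<comment> \<open>\<open>dmask_nonzero_imp\<close> gives integrality only against the full gcd
        g h; since h is prime to the modulus q, combining it with the integrality of g x, where x =
        q z, removes the factor h.\<close>
      then obtain a b where ab: "a * h + b * int ?q = 1" using bezout_int[of h "int ?q"] by auto
      define z where "z = ?x / real ?q"
      have xz: "?x = real ?q * z" using q by (simp add: z_def)
      have "of_int a * (of_int (Gcd ?E) * z) + of_int b * (of_int g * ?x)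
          = real_of_int (a * h + b * int ?q) * (of_int g * z)"
        unfolding h xz by (simp add: algebra_simps)
      hence "of_int g * z = of_int a * (of_int (Gcd ?E) * z) + of_int b * (of_int g * ?x)"
        unfolding ab by simp
      moreover have "\<dots> \<in> \<int>" unfolding z_def by (rule Ints_add[OF Ints_mult[OF Ints_of_int 1] Ints_mult[OF Ints_of_int Suc]])
      ultimately show ?case unfolding y z_def by simp
    qed
    obtain i where i: "\<bar>real_of_int (1 + g * k)\<bar> + 1 \<le> pprod ?p i"
      using moran_system.pprod_exceeds[OF shift] by blast
    have P: "pprod ?p i > 0" by (rule moran_system.pprod_pos[OF shift])
    have E: "of_int g * (\<xi> / pprod ?p i) = real_of_int (1 + g * k) / pprod ?p i"
      by (simp only: g\<xi>[symmetric] times_divide_eq_right)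
    have "real_of_int (1 + g * k) \<noteq> 0" using m0 by (simp only: of_int_eq_0_iff not_False_eq_True)
    hence "of_int g * (\<xi> / pprod ?p i) \<noteq> 0" unfolding E using P by simp
    with int have "1 \<le> \<bar>of_int g * (\<xi> / pprod ?p i)\<bar>" by (rule Ints_nonzero_abs_ge1)
    also have "\<dots> = \<bar>real_of_int (1 + g * k)\<bar> / pprod ?p i"
      unfolding E using P by (simp add: abs_divide)
    also have "\<dots> < 1" using i P by simp
    finally show False by simp
  qed
  then obtain i where "mprod ?p ?D i \<xi> = 0" by blast
  hence "fourier (moran_tail p D n) \<xi> = 0" using fourier_tail_split[of n \<xi> i] by simp
  thus ?thesis by (simp add: \<xi>_def)
qed

lemma equi_level_mono: "equi_level \<epsilon> n \<Longrightarrow> \<epsilon>' \<le> \<epsilon> \<Longrightarrow> equi_level \<epsilon>' n"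
  unfolding equi_level_def using attains_mono by blast

lemma equi_positive_imp_levels:
  fixes nk :: "nat \<Rightarrow> nat"
  assumes "strict_mono nk" "nk 0 \<ge> 1" "equi_positive (range (\<lambda>k. moran_tail p D (nk k)))"
  shows "\<exists>\<epsilon>>0. infinite {n. n \<ge> 1 \<and> equi_level \<epsilon> n}"
proof -
  obtain \<epsilon> where e: "\<epsilon> > 0" "\<forall>x\<in>{0..<1}. \<forall>\<nu>\<in>range (\<lambda>k. moran_tail p D (nk k)). \<exists>k::int. cmod (fourier \<nu> (x + of_int k)) > \<epsilon>"
    using assms(3) unfolding equi_positive_def by blast
  hence "equi_level \<epsilon> (nk k)" for k unfolding equi_level_def attains_def by (meson less_imp_le rangeI)
  moreover have "nk k \<ge> 1" for k using le_trans[OF assms(2) strict_mono_leD[OF assms(1) le0]] by simp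
  ultimately have "range nk \<subseteq> {n. n \<ge> 1 \<and> equi_level \<epsilon> n}" by blast
  moreover have "infinite (range nk)" using range_inj_infinite strict_mono_imp_inj_on[OF assms(1)] by blast
  ultimately show ?thesis using e(1) infinite_super by blast
qed

lemma levels_imp_equi_positive:
  assumes e: "\<epsilon> > 0" and inf: "infinite {n. n \<ge> 1 \<and> equi_level \<epsilon> n}"
  shows "\<exists>nk::nat \<Rightarrow> nat. strict_mono nk \<and> nk 0 \<ge> 1 \<and> equi_positive (range (\<lambda>k. moran_tail p D (nk k)))"
proof -
  define nk where "nk = enumerate {n. n \<ge> 1 \<and> equi_level \<epsilon> n}"
  have nk: "nk k \<ge> 1 \<and> equi_level \<epsilon> (nk k)" for k using enumerate_in_set[OF inf, of k] by (simp add: nk_def)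
  have "equi_positive (range (\<lambda>k. moran_tail p D (nk k)))" unfolding equi_positive_def
  \<comment> \<open>Half of \<epsilon> because \<open>equi_positive\<close> asks for a strict
    inequality and \<open>attains\<close> gives a weak one.\<close>
  proof (intro conjI exI[of _ "{0..2 * C}"] exI[of _ "\<epsilon> / 2"] ballI)
    fix \<nu> assume "\<nu> \<in> range (\<lambda>k. moran_tail p D (nk k))"
    then obtain k where k: "\<nu> = moran_tail p D (nk k)" by blast
    show R: "real_distribution \<nu>" unfolding k by (rule real_distribution_tail)
    interpret real_distribution \<nu> by fact
    have "AE x in \<nu>. x \<notin> UNIV - {0..2 * C}" using AE_tail unfolding k by (rule eventually_mono) auto
    moreover have "(AE x in \<nu>. x \<notin> UNIV - {0..2 * C}) \<longleftrightarrow> emeasure \<nu> (UNIV - {0..2 * C}) = 0"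
      by (rule AE_iff_measurable) auto
    ultimately show "emeasure \<nu> (UNIV - {0..2 * C}) = 0" by simp
    fix x :: real assume "x \<in> {0..<1}"
    then obtain j :: int where "\<epsilon> \<le> cmod (fourier \<nu> (x + of_int j))"
      using nk[of k] unfolding k equi_level_def attains_def by blast
    thus "\<exists>k::int. \<epsilon> / 2 < cmod (fourier \<nu> (x + of_int k))" using e by (intro exI[of _ j]) linarith
  qed (use e in auto)
  moreover have "strict_mono nk" unfolding nk_def by (rule strict_mono_enumerate[OF inf])
  ultimately show ?thesis using nk by blast
qed

text \<open>For bounded moduli all levels are good; for unbounded moduli those that precede a
  modulus beyond the threshold are, and there are infinitely many of them.\<close>

lemma equi_levels_exist:
  assumes had: "\<And>n. n \<ge> 1 \<Longrightarrow> hadamard_triple (p n) (D n) (L n)"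
    and M: "\<And>n. n \<ge> 1 \<Longrightarrow> card (D n) \<le> M"
    and dense: "infinite {j. j \<ge> 1 \<and> p j > card (D j)} \<or> (\<forall>n\<ge>1. Gcd ((\<lambda>j. Gcd (D j)) ` {n..}) = 1)"
  shows "\<exists>\<epsilon>>0. infinite {n. n \<ge> 1 \<and> equi_level \<epsilon> n}"
proof (cases "\<exists>Pmax. \<forall>n\<ge>1. p n \<le> Pmax")
  case True
  then obtain Pmax where Pmax: "\<And>n. n \<ge> 1 \<Longrightarrow> p n \<le> Pmax" by blast
  \<comment> \<open>A factorial: the gcd at a full level is at most any positive digit, hence at
    most C times \<open>Pmax\<close>, and so is one of the factors.\<close>
  define G where "G = (\<Prod>i\<in>{1..\<lceil>C * real Pmax\<rceil>}. i)"
  interpret bounded_hadamard_moran p D C L Pmax G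
  proof
    show "0 < G" unfolding G_def by (rule prod_pos) auto
    fix n :: nat assume n: "n \<ge> 1" and full: "card (D n) = p n"
    have "\<not> D n \<subseteq> {0}" using card_mono[of "{0}" "D n"] full p_gt_1[OF n] by auto
    then obtain d where d: "d \<in> D n" "d \<noteq> 0" by blast
    have d0: "d > 0" using nonneg_D[OF n d(1)] d(2) by simp
    have "Gcd (D n) \<le> d" using Gcd_dvd[OF d(1)] d0 by (rule zdvd_imp_le)
    moreover have "of_int d \<le> C * real Pmax"
      using bound_D[OF n d(1)] mult_left_mono[OF _ C_nonneg, of "real (p n)" "real Pmax"] Pmax[OF n] by simp
    ultimately have "Gcd (D n) \<le> \<lceil>C * real Pmax\<rceil>" by linarith
    moreover have "Gcd (D n) \<noteq> 0" using d by (auto simp: Gcd_0_iff)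
    hence "1 \<le> Gcd (D n)" using Gcd_int_greater_eq_0[of "D n"] by linarith
    ultimately have "Gcd (D n) \<in> {1..\<lceil>C * real Pmax\<rceil>}" by simp
    thus "Gcd (D n) dvd G" unfolding G_def by (intro dvd_prodI) auto
  qed (use had Pmax dense in auto)
  obtain \<epsilon> where e: "\<epsilon> > 0" "\<forall>n. equi_level \<epsilon> n" using equi_level_bounded by blast
  have "{n. n \<ge> 1 \<and> equi_level \<epsilon> n} = {1..}" using e by auto
  thus ?thesis using e(1) infinite_Ici by metis
next
  case False
  obtain \<epsilon> P0 where e: "\<epsilon> > 0" "\<And>n. P0 \<le> p (Suc n) \<Longrightarrow> equi_level \<epsilon> n"
    using equi_level_large_modulus[OF had M] by blast
  have "infinite {n. n \<ge> 1 \<and> equi_level \<epsilon> n}"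
  proof
    assume "finite {n. n \<ge> 1 \<and> equi_level \<epsilon> n}"
    then obtain B where B: "\<And>n. n \<ge> 1 \<Longrightarrow> equi_level \<epsilon> n \<Longrightarrow> n \<le> B" using finite_nat_set_iff_bounded_le by auto
    have "p n \<le> max P0 (Max (p ` {..Suc B}))" if n: "n \<ge> 1" for n
    proof (cases "n \<le> Suc B")
      case True
      hence "p n \<le> Max (p ` {..Suc B})" by (intro Max_ge) auto
      thus ?thesis by simp
    next
      case nB: False
      have "n - 1 \<ge> 1" "\<not> n - 1 \<le> B" using nB by linarith+
      hence "\<not> P0 \<le> p (Suc (n - 1))" using e(2)[of "n - 1"] B[of "n - 1"] by blast
      thus ?thesis using n by simp
    qed
    thus False using False by blast
  qed
  thus ?thesis using e(1) by blast
qed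

end

text \<open>Beyond the last level with p > #D all levels are full. The gcd of a tail is not 1 by
  assumption, and not 0 because a full level has at least two digits.\<close>

lemma common_tail_divisor:
  fixes p :: "nat \<Rightarrow> nat" and D :: "nat \<Rightarrow> int set"
  assumes had: "\<And>n. n \<ge> 1 \<Longrightarrow> hadamard_triple (p n) (D n) (L n)"
    and not_dense: "\<not> (infinite {j. j \<ge> 1 \<and> p j > card (D j)} \<or> (\<forall>n\<ge>1. Gcd ((\<lambda>j. Gcd (D j)) ` {n..}) = 1))"
  shows "\<exists>N\<ge>1. \<exists>g\<ge>2. \<forall>j\<ge>N. card (D j) = p j \<and> g dvd Gcd (D j)"
proof -
  obtain B where B: "\<And>j. j \<ge> 1 \<Longrightarrow> p j > card (D j) \<Longrightarrow> j \<le> B"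
    using not_dense finite_nat_set_iff_bounded_le by auto
  obtain n where n: "n \<ge> 1" "Gcd ((\<lambda>j. Gcd (D j)) ` {n..}) \<noteq> 1" using not_dense by blast
  define g where "g = Gcd ((\<lambda>j. Gcd (D j)) ` {n..})"
  define N where "N = max n (Suc B)"
  have N: "N \<ge> 1" using n by (simp add: N_def)
  have full: "card (D j) = p j" if "j \<ge> N" for j
  proof -
    have "j \<ge> 1" "\<not> j \<le> B" using that N by (auto simp: N_def)
    thus ?thesis using B[of j] hadamard_card_le[OF had, of j] by force
  qed
  have dvd: "g dvd Gcd (D j)" if "j \<ge> N" for j
    unfolding g_def by (rule Gcd_dvd) (use that in \<open>simp add: N_def\<close>)
  have "g \<noteq> 0"
  proof
    assume "g = 0"
    hence "Gcd (D N) = 0" using dvd[of N] by simp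
    hence "D N \<subseteq> {0}" by (simp add: Gcd_0_iff)
    hence "card (D N) \<le> 1" using card_mono[of "{0}" "D N"] by simp
    thus False using full[of N] hadamardD(1)[OF had[OF N]] by simp
  qed
  moreover have "g \<ge> 0" by (simp add: g_def)
  moreover have "g \<noteq> 1" using n by (simp add: g_def)
  ultimately have "g \<ge> 2" by simp
  thus ?thesis using N full dvd by blast
qed

theorem theorem2p1:
  fixes p :: "nat \<Rightarrow> nat" and D L :: "nat \<Rightarrow> int set"
  assumes had: "\<forall>n\<ge>1. hadamard_triple (p n) (D n) (L n)"
    and zero: "\<forall>n\<ge>1. 0 \<in> D n"
    and nonneg: "\<forall>n\<ge>1. D n \<subseteq> {0..}"
    and bdd_digits: "\<exists>C::real. \<forall>n\<ge>1. \<forall>d\<in>D n. of_int d / real (p n) \<le> C"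
    and bdd_card: "\<exists>M::nat. \<forall>n\<ge>1. card (D n) \<le> M"
  shows "((\<exists>nk::nat \<Rightarrow> nat. strict_mono nk \<and> nk 0 \<ge> 1 \<and>
              equi_positive (range (\<lambda>k. moran_tail p D (nk k))))
          \<longleftrightarrow> {0<..<1} \<subseteq> (\<Inter>n\<in>{1..}. \<Union>k\<in>{n..}. DPCS (p k) (D k)))
       \<and> ({0<..<1} \<subseteq> (\<Inter>n\<in>{1..}. \<Union>k\<in>{n..}. DPCS (p k) (D k))
          \<longleftrightarrow> (infinite {j. j \<ge> 1 \<and> p j > card (D j)} \<or>
               (\<forall>n\<ge>1. Gcd ((\<lambda>j. Gcd (D j)) ` {n..}) = 1)))
       \<and> ({0<..<1} \<subseteq> (\<Inter>n\<in>{1..}. \<Union>k\<in>{n..}. DPCS (p k) (D k))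
          \<longrightarrow> spectral_measure (moran p D))"
proof -
  obtain C :: real where C: "\<And>n d. n \<ge> 1 \<Longrightarrow> d \<in> D n \<Longrightarrow> of_int d / real (p n) \<le> C"
    using bdd_digits by blast
  obtain M where M: "\<And>n. n \<ge> 1 \<Longrightarrow> card (D n) \<le> M" using bdd_card by blast
  have H: "hadamard_triple (p n) (D n) (L n)" if "n \<ge> 1" for n using had that by blast
  interpret moran_system p D C
  proof
    fix n :: nat and d assume n: "n \<ge> 1"
    show p: "p n > 1" and "finite (D n)" using hadamardD[OF H[OF n]] by auto
    show "0 \<in> D n" using zero n by blast
    assume d: "d \<in> D n"
    show "0 \<le> d" using nonneg n d by auto
    show "of_int d \<le> C * real (p n)" using C[OF n d] p by (simp add: pos_divide_le_eq)
  qed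
  define I where "I \<longleftrightarrow> (\<exists>nk::nat \<Rightarrow> nat. strict_mono nk \<and> nk 0 \<ge> 1 \<and> equi_positive (range (\<lambda>k. moran_tail p D (nk k))))"
  define II where "II \<longleftrightarrow> {0<..<1} \<subseteq> (\<Inter>n\<in>{1..}. \<Union>k\<in>{n..}. DPCS (p k) (D k))"
  define III where "III \<longleftrightarrow> infinite {j. j \<ge> 1 \<and> p j > card (D j)} \<or> (\<forall>n\<ge>1. Gcd ((\<lambda>j. Gcd (D j)) ` {n..}) = 1)"
  have mem: "x \<in> DPCS (p k) (D k) \<longleftrightarrow> 0 \<le> x \<and> x < 1 \<and> (card (D k) < p k \<or> of_int (Gcd (D k)) * x \<notin> \<int>)"
    if "k \<ge> 1" for x k using DPCS_iff[OF H zero_D] that by blast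
  have III_II: "II" if iii: III
    unfolding II_def
  proof (intro subsetI INT_I)
    fix x :: real and n :: nat assume x: "x \<in> {0<..<1}" and n: "n \<in> {1..}"
    have "x \<notin> \<int>" using x by (auto elim!: Ints_cases)
    then obtain k where k: "k \<ge> n" "card (D k) < p k \<or> of_int (Gcd (D k)) * x \<notin> \<int>"
      using eventually_visible[OF iii[unfolded III_def] _ \<open>x \<notin> \<int>\<close>, of n] n by auto
    hence "x \<in> DPCS (p k) (D k)" using mem[of k x] x n by auto
    thus "x \<in> (\<Union>k\<in>{n..}. DPCS (p k) (D k))" using k by blast
  qed
  \<comment> \<open>A single point refutes both: 1/g, with g a common divisor of all late digits,
    lies in no late double point set, and the late tail transforms vanish on all its integer
    translates.\<close>
  have not_III: "\<not> II \<and> \<not> I" if nIII: "\<not> III"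
  proof -
    obtain N g where N: "N \<ge> 1" "g \<ge> 2" and tail: "\<And>j. j \<ge> N \<Longrightarrow> card (D j) = p j \<and> g dvd Gcd (D j)"
      using common_tail_divisor[OF H nIII[unfolded III_def]] by blast
    have "1 / real_of_int g \<notin> DPCS (p k) (D k)" if k: "k \<ge> N" for k
    proof -
      obtain h where "Gcd (D k) = g * h" using tail[OF k] by (auto elim: dvdE)
      hence "of_int (Gcd (D k)) * (1 / real_of_int g) \<in> \<int>" using N by simp
      thus ?thesis using mem[of k] k N tail[OF k] by auto
    qed
    moreover have "1 / real_of_int g \<in> {0<..<1}" using N by simp
    ultimately have "\<not> II" using N(1) unfolding II_def by blast
    moreover have "\<not> I"
    proof
      assume I
      then obtain \<epsilon> where e: "\<epsilon> > 0" "infinite {n. n \<ge> 1 \<and> equi_level \<epsilon> n}"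
        unfolding I_def using equi_positive_imp_levels by blast
      have "\<exists>n>N. n \<in> {n. n \<ge> 1 \<and> equi_level \<epsilon> n}" using e(2) unfolding infinite_nat_iff_unbounded by blast
      then obtain n where n: "n > N" "equi_level \<epsilon> n" by blast
      have "1 / real_of_int g \<in> {0..<1}" using N by simp
      then obtain k :: int where "\<epsilon> \<le> cmod (fourier (moran_tail p D n) (1 / of_int g + of_int k))"
        using n(2) unfolding equi_level_def attains_def by blast
      moreover have "fourier (moran_tail p D n) (1 / of_int g + of_int k) = 0"
      proof (rule common_divisor_annihilates[OF _ _ N(2)])
        fix j assume "j > n"
        hence j: "j \<ge> N" "j \<ge> 1" using n by auto
        show "hadamard_triple (p j) (D j) (L j)" using H j by blast
        show "card (D j) = p j" "g dvd Gcd (D j)" using tail[OF j(1)] by auto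
      qed
      ultimately show False using e(1) by simp
    qed
    ultimately show ?thesis by blast
  qed
  have levels: "\<exists>\<epsilon>>0. infinite {n. n \<ge> 1 \<and> equi_level \<epsilon> n}" if III
    by (rule equi_levels_exist[OF H M]) (use that III_def in auto)
  have III_I: "I" if III
    using levels[OF that] levels_imp_equi_positive unfolding I_def by blast
  have III_spectral: "spectral_measure (moran p D)" if iii: III
  proof -
    obtain \<epsilon> where e: "\<epsilon> > 0" "infinite {n. n \<ge> 1 \<and> equi_level \<epsilon> n}" using levels[OF iii] by blast
    have "{n. n \<ge> 1 \<and> equi_level \<epsilon> n} \<subseteq> {n. equi_level (min \<epsilon> (1 / 2)) n}"
      using equi_level_mono[of \<epsilon> _ "min \<epsilon> (1 / 2)"] by auto
    hence "infinite {n. equi_level (min \<epsilon> (1 / 2)) n}" using e(2) infinite_super by blast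
    thus ?thesis using H e(1) by (intro spectral_of_equi_levels[of "min \<epsilon> (1 / 2)"]) auto
  qed
  show ?thesis
    unfolding I_def[symmetric] II_def[symmetric] III_def[symmetric]
    using III_II not_III III_I III_spectral by blast
qed

end
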